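(* Let $r > 9$ be an integer, let $a > 0$ be a real number, and let $(d_i, m_i)_{i}$ be a sequence of pairs of positive integers such that $$\frac{d_i^2}{m_i^2 \cdot r} \xrightarrow{\ i \to \infty\ } \frac{1}{a^2} \geq 1$$ and such that, for every $i$, the space $\mathcal{L}_{d_i}(r^{m_i+1})$ has the expected dimension and this dimension is $\geq 0$. Let $\pi : \widetilde{X} \to \mathbb{P}^2$ be the blow up of the complex projective plane in $r$ very general points, $H$ the pull back of a line to $\widetilde{X}$, and $E_1,\ldots,E_r$ the exceptional divisors over these points. Then the $\mathbb{R}$-divisor $$H - a \cdot \sqrt{\frac{1}{r}} \sum_{j=1}^r E_j$$ is nef on $\widetilde{X}$. In particular, if $a = 1$, then Nagata's conjecture is true for $r$ general points in $\mathbb{P}^2$, i.e. $H - \sqrt{\tfrac{1}{r}} \sum_{j=1}^r E_j$ is nef on $\widetilde{X}$.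
   Context: For integers $d,n,m \ge 1$, $\mathcal{L}_d(n^m)$ denotes the (projective) linear system of plane curves of degree $d$ in $\mathbb{P}^2$ having multiplicity at least $m$ at each of $n$ general points. Its expected dimension is $$\max\left(-1, \frac{d(d+3)}{2} - n\cdot\frac{m(m+1)}{2}\right),$$ and it "has expected dimension" if its actual projective dimension (with $-1$ for the empty system) equals this number. *)

theory Defs
  imports "HOL-Analysis.Analysis" "HOL-Library.Poly_Mapping"
begin

subsection \<open>Polynomials over the complex numbers\<close>

text \<open>A polynomial in variables of type \<^typ>\<open>'v\<close> is a finitely supported map from
  exponent vectors to coefficients, with the convolution product of \<^typ>\<open>('v \<Rightarrow>\<^sub>0 nat) \<Rightarrow>\<^sub>0 complex\<close>.\<close>

type_synonym 'v cpoly = "('v \<Rightarrow>\<^sub>0 nat) \<Rightarrow>\<^sub>0 complex"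

definition cpoly_scale :: "complex \<Rightarrow> 'v cpoly \<Rightarrow> 'v cpoly" where
  "cpoly_scale c F = Poly_Mapping.map ((*) c) F"

lemma lookup_cpoly_scale [simp]:
  "Poly_Mapping.lookup (cpoly_scale c F) \<alpha> = c * Poly_Mapping.lookup F \<alpha>"
  unfolding cpoly_scale_def by transfer (simp add: when_def)

global_interpretation cpoly: vector_space "cpoly_scale :: complex \<Rightarrow> 'v cpoly \<Rightarrow> 'v cpoly"
  by unfold_locales (auto intro!: poly_mapping_eqI simp: lookup_add algebra_simps)

definition cpoly_eval :: "('v \<Rightarrow> complex) \<Rightarrow> 'v cpoly \<Rightarrow> complex" where
  "cpoly_eval x F = (\<Sum>\<alpha>\<in>Poly_Mapping.keys F. Poly_Mapping.lookup F \<alpha> *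
     (\<Prod>v\<in>Poly_Mapping.keys \<alpha>. x v ^ Poly_Mapping.lookup \<alpha> v))"

text \<open>Partial derivative. If the variable does not occur in \<open>\<alpha>\<close>, the truncated subtraction of
  exponents is harmless because the coefficient is zero.\<close>

definition cpoly_pderiv :: "'v \<Rightarrow> 'v cpoly \<Rightarrow> 'v cpoly" where
  "cpoly_pderiv v F = (\<Sum>\<alpha>\<in>Poly_Mapping.keys F.
     Poly_Mapping.single (\<alpha> - Poly_Mapping.single v 1)
       (of_nat (Poly_Mapping.lookup \<alpha> v) * Poly_Mapping.lookup F \<alpha>))"


subsection \<open>The complex projective plane and Zariski closed sets of tuples of points\<close>

typedef cp2 = "{L :: (complex ^ 3) set. vec.subspace L \<and> vec.dim L = 1}"
proof -
  have "vec.dim (vec.span {axis 1 1 :: complex ^ 3}) = 1"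
    by (simp add: vec.dim_eq_card_independent vec.dependent_single axis_eq_0_iff)
  then show ?thesis
    by (intro exI[of _ "vec.span {axis 1 1}"]) (simp del: vec.dim_span)
qed

text \<open>Homogeneous coordinate vectors of a point.\<close>

definition hcoords :: "cp2 \<Rightarrow> (complex ^ 3) set" where
  "hcoords x = Rep_cp2 x - {0}"

text \<open>Lines in the plane are points of the dual plane, for which the same type is used: the line
  with coordinates \<open>w\<close> consists of the points with coordinates \<open>v\<close> such that
  \<open>v\<^sub>1 w\<^sub>1 + v\<^sub>2 w\<^sub>2 + v\<^sub>3 w\<^sub>3 = 0\<close>. The relation is symmetric.\<close>

definition incident :: "cp2 \<Rightarrow> cp2 \<Rightarrow> bool" where
  "incident x l \<longleftrightarrow> (\<forall>v\<in>hcoords x. \<forall>w\<in>hcoords l. (\<Sum>i\<in>UNIV. v $ i * w $ i) = 0)"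

text \<open>The product of copies of the plane indexed by \<open>K\<close>. The factor with index \<open>k\<close> has the
  homogeneous coordinates \<open>(k, 1), (k, 2), (k, 3)\<close>.\<close>

definition multiproj :: "nat set \<Rightarrow> (nat \<Rightarrow> cp2) set" where
  "multiproj K = K \<rightarrow>\<^sub>E UNIV"

definition multihomogeneous :: "nat set \<Rightarrow> (nat \<Rightarrow> nat) \<Rightarrow> (nat \<times> 3) cpoly \<Rightarrow> bool" where
  "multihomogeneous K b f \<longleftrightarrow> (\<forall>\<alpha>\<in>Poly_Mapping.keys f.
     (\<forall>k\<in>K. (\<Sum>i\<in>UNIV. Poly_Mapping.lookup \<alpha> (k, i)) = b k) \<and>
     (\<forall>k i. k \<notin> K \<longrightarrow> Poly_Mapping.lookup \<alpha> (k, i) = 0))"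

definition vanishes_at :: "nat set \<Rightarrow> (nat \<times> 3) cpoly \<Rightarrow> (nat \<Rightarrow> cp2) \<Rightarrow> bool" where
  "vanishes_at K f y \<longleftrightarrow>
     (\<forall>x. (\<forall>k\<in>K. x k \<in> hcoords (y k)) \<longrightarrow> cpoly_eval (\<lambda>(k, i). x k $ i) f = 0)"

definition zariski_closed :: "nat set \<Rightarrow> (nat \<Rightarrow> cp2) set \<Rightarrow> bool" where
  "zariski_closed K Z \<longleftrightarrow> (\<exists>S. (\<forall>f\<in>S. \<exists>b. multihomogeneous K b f) \<and>
     Z = {y \<in> multiproj K. \<forall>f\<in>S. vanishes_at K f y})"

definition irreducible_closed :: "nat set \<Rightarrow> (nat \<Rightarrow> cp2) set \<Rightarrow> bool" where
  "irreducible_closed K Z \<longleftrightarrow> zariski_closed K Z \<and> Z \<noteq> {} \<and>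
     (\<forall>A B. zariski_closed K A \<and> zariski_closed K B \<and> Z \<subseteq> A \<union> B \<longrightarrow> Z \<subseteq> A \<or> Z \<subseteq> B)"

text \<open>Krull dimension one: the longest chains of irreducible closed subsets of \<open>C\<close> have
  the form \<open>Z \<subset> C\<close>.\<close>

definition irreducible_curve :: "nat set \<Rightarrow> (nat \<Rightarrow> cp2) set \<Rightarrow> bool" where
  "irreducible_curve K C \<longleftrightarrow> irreducible_closed K C \<and>
     (\<exists>Z. irreducible_closed K Z \<and> Z \<subset> C) \<and>
     \<not> (\<exists>Z Z'. irreducible_closed K Z \<and> irreducible_closed K Z' \<and> Z \<subset> Z' \<and> Z' \<subset> C)"

text \<open>A property of \<open>n\<close> general points holds outside a proper closed subset of the (irreducible)
  variety of \<open>n\<close>-tuples of points; for very general points, outside a countable union of proper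
  closed subsets. Points are numbered from 1 to \<open>n\<close>.\<close>

definition for_general :: "nat \<Rightarrow> ((nat \<Rightarrow> cp2) \<Rightarrow> bool) \<Rightarrow> bool" where
  "for_general n P \<longleftrightarrow> (\<exists>Z. zariski_closed {1..n} Z \<and> Z \<noteq> multiproj {1..n} \<and>
     (\<forall>p\<in>multiproj {1..n} - Z. P p))"

definition for_very_general :: "nat \<Rightarrow> ((nat \<Rightarrow> cp2) \<Rightarrow> bool) \<Rightarrow> bool" where
  "for_very_general n P \<longleftrightarrow> (\<exists>\<Z>. countable \<Z> \<and>
     (\<forall>Z\<in>\<Z>. zariski_closed {1..n} Z \<and> Z \<noteq> multiproj {1..n}) \<and>
     (\<forall>p\<in>multiproj {1..n} - \<Union>\<Z>. P p))"


subsection \<open>Linear systems of plane curves with assigned multiplicities\<close>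

definition homogeneous :: "nat \<Rightarrow> 3 cpoly \<Rightarrow> bool" where
  "homogeneous d F \<longleftrightarrow>
     (\<forall>\<alpha>\<in>Poly_Mapping.keys F. (\<Sum>i\<in>UNIV. Poly_Mapping.lookup \<alpha> i) = d)"

text \<open>The curve \<open>F = 0\<close> has multiplicity at least \<open>m\<close> at \<open>x\<close>: all partial derivatives of order less
  than \<open>m\<close> vanish at \<open>x\<close>. By Euler's relation, this can be tested in the homogeneous coordinates.
  The list \<open>vs\<close> gives the variables of differentiation.\<close>

definition mult_ge :: "nat \<Rightarrow> 3 cpoly \<Rightarrow> cp2 \<Rightarrow> bool" where
  "mult_ge m F x \<longleftrightarrow> (\<forall>v\<in>hcoords x. \<forall>vs. length vs < m \<longrightarrow>
     cpoly_eval (\<lambda>i. v $ i) (foldr cpoly_pderiv vs F) = 0)"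

text \<open>The vector space whose projectivization is the linear system of curves of degree \<open>d\<close> with
  multiplicity at least \<open>m\<close> at \<open>p 1, \<dots>, p n\<close>.\<close>

definition linsys :: "nat \<Rightarrow> nat \<Rightarrow> nat \<Rightarrow> (nat \<Rightarrow> cp2) \<Rightarrow> 3 cpoly set" where
  "linsys d n m p = {F. homogeneous d F \<and> (\<forall>j\<in>{1..n}. mult_ge m F (p j))}"

definition linsys_dim :: "nat \<Rightarrow> nat \<Rightarrow> nat \<Rightarrow> (nat \<Rightarrow> cp2) \<Rightarrow> int" where
  "linsys_dim d n m p = int (cpoly.dim (linsys d n m p)) - 1"

text \<open>Both divisions by 2 are exact.\<close>

definition expected_dim :: "nat \<Rightarrow> nat \<Rightarrow> nat \<Rightarrow> int" where
  "expected_dim d n m =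
     max (- 1) (int (d * (d + 3) div 2) - int (n * (m * (m + 1) div 2)))"

definition has_expected_dim :: "nat \<Rightarrow> nat \<Rightarrow> nat \<Rightarrow> bool" where
  "has_expected_dim d n m \<longleftrightarrow> for_general n (\<lambda>p. linsys_dim d n m p = expected_dim d n m)"


subsection \<open>The blow up of the plane in \<open>n\<close> points\<close>

text \<open>The blow up of the plane in one point \<open>p\<close> is the incidence variety of the pairs of a point \<open>x\<close>
  and a line through \<open>x\<close> and \<open>p\<close>. The blow up in \<open>n\<close> distinct points is the fibre product over the
  plane of the blow ups in the single points; its elements are the tuples \<open>y\<close> with \<open>y 0\<close> a point
  of the plane and \<open>y j\<close> a line through \<open>y 0\<close> and \<open>p j\<close>. (If points coincide, this is not the
  blow up, but very general points are distinct.) The blow up map is \<open>y \<mapsto> y 0\<close> and the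
  exceptional divisor over \<open>p j\<close> is the set of all \<open>y\<close> with \<open>y 0 = p j\<close>.\<close>

definition blowup :: "nat \<Rightarrow> (nat \<Rightarrow> cp2) \<Rightarrow> (nat \<Rightarrow> cp2) set" where
  "blowup n p = {y \<in> multiproj {0..n}. \<forall>j\<in>{1..n}. incident (y 0) (y j) \<and> incident (p j) (y j)}"

text \<open>Let \<open>L\<^sub>k\<close> be the pull back of \<open>O(1)\<close> from the \<open>k\<close>-th factor to the blow up. Its degree on a curve
  \<open>C\<close> is the intersection number of \<open>C\<close> with the base point free linear system of pulled back
  lines of this factor, i.e. the number of points of \<open>C\<close> on a general member of this system (by Bertini,
  a general member meets \<open>C\<close> transversally in smooth points of \<open>C\<close>).\<close>

definition line_degree :: "(nat \<Rightarrow> cp2) set \<Rightarrow> nat \<Rightarrow> nat" where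
  "line_degree C k = (THE N. for_general 1 (\<lambda>h.
     finite {y \<in> C. incident (y k) (h 1)} \<and> card {y \<in> C. incident (y k) (h 1)} = N))"

text \<open>A function \<open>D\<close> stands for the class of \<open>\<real>\<close>-divisors with \<open>O(D) = \<Otimes>\<^sub>k L\<^sub>k\<^bsup>D k\<^esup>\<close>, where \<open>k\<close> ranges
  over \<open>0, \<dots>, n\<close>. These line bundles form a basis of the Picard group of the blow up.\<close>

type_synonym rdivisor = "nat \<Rightarrow> real"

definition div_H :: rdivisor where
  "div_H k = (if k = 0 then 1 else 0)"

text \<open>\<open>O(E\<^sub>j)\<close> is \<open>L\<^sub>0 \<otimes> L\<^sub>j\<^sup>-\<^sup>1\<close>: the vector product of \<open>y 0\<close> and \<open>p j\<close> is a multiple \<open>\<lambda>\<close> of \<open>y j\<close>, and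
  \<open>\<lambda>\<close> is a section of \<open>L\<^sub>0 \<otimes> L\<^sub>j\<^sup>-\<^sup>1\<close> which vanishes, to first order, exactly where \<open>y 0 = p j\<close>.
  Equivalently, the pull back of a line \<open>l\<close> through \<open>p j\<close> (and no other \<open>p i\<close>) is the sum of \<open>E\<^sub>j\<close> and the
  strict transform of \<open>l\<close>, which is the locus \<open>y j = l\<close> and has class \<open>L\<^sub>j\<close>.\<close>

definition div_E :: "nat \<Rightarrow> rdivisor" where
  "div_E j k = (if k = 0 then 1 else if k = j then - 1 else 0)"

definition intersection_number :: "nat \<Rightarrow> rdivisor \<Rightarrow> (nat \<Rightarrow> cp2) set \<Rightarrow> real" where
  "intersection_number n D C = (\<Sum>k\<in>{0..n}. D k * real (line_degree C k))"

definition nef :: "nat \<Rightarrow> (nat \<Rightarrow> cp2) \<Rightarrow> rdivisor \<Rightarrow> bool" where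
  "nef n p D \<longleftrightarrow> (\<forall>C. irreducible_curve {0..n} C \<and> C \<subseteq> blowup n p \<longrightarrow>
     intersection_number n D C \<ge> 0)"

end

theory Submission
  imports Defs "HOL-Computational_Algebra.Polynomial_Factorial"
    "HOL-Computational_Algebra.Fundamental_Theorem_Algebra" "HOL-Computational_Algebra.Field_as_Ring"
begin

text \<open>
  Write \<open>d, m\<close> for some \<open>d\<^sub>i, m\<^sub>i\<close>. A form of degree \<open>d\<close> has \<open>(m + 1) (m + 2) / 2\<close> Taylor coefficients of order
  at most \<open>m\<close> at each of the \<open>r\<close> points. If the forms on which all of them vanish make up a space of
  the expected dimension, and this space is not zero, then these coefficients are linearly independent
  functionals: forms of degree \<open>d\<close> take arbitrary \<open>m\<close>-jets at the points
  (\<open>interpolates_if_expected_dim\<close>). Multiplying \<open>k\<close> such forms gives forms of degree \<open>k d\<close> with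
  arbitrary leading terms up to order \<open>k m\<close>, so that the forms of degree \<open>k d\<close> with multiplicity
  \<open>k m + 1\<close> at all points have the expected dimension for every \<open>k\<close> as well
  (\<open>interpolates_multiple\<close>, \<open>dim_linsys_at_if_interpolates\<close>).

  Let \<open>G\<close> be a form of degree \<open>e\<close> with multiplicity at least \<open>\<mu>\<^sub>j\<close> at the \<open>j\<close>-th point. Multiplication by
  \<open>G\<close> embeds the forms of degree \<open>k d - e\<close> with multiplicities \<open>k m + 1 - \<mu>\<^sub>j\<close> into the forms of degree
  \<open>k d\<close> with multiplicities \<open>k m + 1\<close>. The dimension of the first space is at least what counting conditions
  predicts, that of the second is equal to this prediction. The terms linear in \<open>k\<close> yield \<open>m \<Sum> \<mu>\<^sub>j \<le> d e\<close>
  (\<open>sum_multiplicities_le\<close>). In contrast to Bezout's theorem,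
  \<open>G\<close> may divide all forms of the linear system.

  Now let \<open>C\<close> be an irreducible curve on the blow up. If \<open>C\<close> lies over one of the points, then it meets
  the divisor \<open>H - c \<Sum> E\<^sub>j\<close> (for \<open>c \<ge> 0\<close>) nonnegatively, because \<open>H\<close> has degree zero on \<open>C\<close>. Otherwise the
  forms that vanish on the image of \<open>C\<close> in the plane are the multiples of a prime form \<open>G\<close>
  (\<open>plane_equation\<close>), and outside the exceptional divisors \<open>C\<close> is the curve \<open>G = 0\<close>
  (\<open>curve_off_centres\<close>). If \<open>G\<close> has degree \<open>e\<close>, then a general line meets this curve in \<open>e\<close> points
  (\<open>general_line_count\<close>), and a general line through the \<open>j\<close>-th point meets it in \<open>e - \<mu>\<^sub>j\<close> further points,
  where \<open>G\<close> has multiplicity at least \<open>\<mu>\<^sub>j\<close> at that point (\<open>lines_through_point_count\<close>). These numbers are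
  the degrees of the line bundles \<open>L\<^sub>0\<close> and \<open>L\<^sub>j\<close> on \<open>C\<close>, and the intersection number of \<open>C\<close> with
  \<open>H - c \<Sum> E\<^sub>j\<close> is \<open>e - c \<Sum> \<mu>\<^sub>j\<close> (\<open>intersection_number_nonneg_or_eq\<close>). Since \<open>m\<^sub>i / d\<^sub>i\<close> converges to
  \<open>c = a / \<surd>r\<close>, the inequality \<open>m\<^sub>i \<Sum> \<mu>\<^sub>j \<le> d\<^sub>i e\<close> shows that this number is nonnegative
  (\<open>nef_if_interpolates\<close>). The exceptional set of tuples of points is the union of those of the
  countably many linear systems; outside it the points are distinct, because equal points would have
  equal jets (\<open>distinct_if_interpolates\<close>).

  Two devices replace elimination theory. Statements on the intersection of plane curves come
  from counting dimensions of forms modulo a prime form, whose existence rests on unique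
  factorization in polynomial rings. Statements on general points are certified by one nonzero
  polynomial; several of them hold simultaneously because a product of nonzero polynomials is nonzero.
\<close>

abbreviation lookup where "lookup \<equiv> Poly_Mapping.lookup"
abbreviation keys where "keys \<equiv> Poly_Mapping.keys"
abbreviation single where "single \<equiv> Poly_Mapping.single"

section \<open>Evaluation of polynomials in commutative rings\<close>

text \<open>Evaluation at a point, substitution, restriction to a line and the passage to iterated
  univariate polynomials are ring homomorphisms between different rings; a predicate on functions
  treats them uniformly.\<close>

definition is_ring_hom :: "('a::comm_ring_1 \<Rightarrow> 'b::comm_ring_1) \<Rightarrow> bool" where
  "is_ring_hom h \<longleftrightarrow> h 1 = 1 \<and> (\<forall>a b. h (a + b) = h a + h b) \<and> (\<forall>a b. h (a * b) = h a * h b)"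

lemma is_ring_homI:
  "h 1 = 1 \<Longrightarrow> (\<And>a b. h (a + b) = h a + h b) \<Longrightarrow> (\<And>a b. h (a * b) = h a * h b) \<Longrightarrow> is_ring_hom h"
  by (simp add: is_ring_hom_def)

context
  fixes h :: "'a::comm_ring_1 \<Rightarrow> 'b::comm_ring_1"
  assumes h: "is_ring_hom h"
begin

lemma hom_one: "h 1 = 1" and hom_add: "h (a + b) = h a + h b" and hom_mult: "h (a * b) = h a * h b"
  using h by (auto simp: is_ring_hom_def)

lemma hom_zero: "h 0 = 0"
  using hom_add[of 0 0] by simp

lemma hom_uminus: "h (- a) = - h a"
  using hom_add[of a "- a"] hom_zero by (simp add: eq_neg_iff_add_eq_0 add.commute)

lemma hom_diff: "h (a - b) = h a - h b"
  using hom_add[of a "- b"] hom_uminus[of b] by simp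

lemma hom_sum: "h (sum f A) = (\<Sum>i\<in>A. h (f i))"
  by (induction A rule: infinite_finite_induct) (auto simp: hom_zero hom_add)

lemma hom_prod: "h (prod f A) = (\<Prod>i\<in>A. h (f i))"
  by (induction A rule: infinite_finite_induct) (auto simp: hom_one hom_mult)

lemma hom_power: "h (a ^ n) = h a ^ n"
  by (induction n) (auto simp: hom_one hom_mult)

lemma hom_dvd: "a dvd b \<Longrightarrow> h a dvd h b"
  by (auto simp: dvd_def hom_mult)

end

lemma is_ring_hom_id: "is_ring_hom (\<lambda>x. x)"
  by (simp add: is_ring_hom_def)

lemma is_ring_hom_const_poly: "is_ring_hom (\<lambda>c::'a::comm_ring_1. [:c:])"
  by (simp add: is_ring_hom_def one_pCons)

lemma is_ring_hom_comp: "is_ring_hom f \<Longrightarrow> is_ring_hom g \<Longrightarrow> is_ring_hom (\<lambda>x. f (g x))"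
  by (simp add: is_ring_hom_def)

lemma is_ring_hom_poly: "is_ring_hom (\<lambda>p. poly p x)"
  by (simp add: is_ring_hom_def)

definition monomial_value :: "('v \<Rightarrow> 'r::comm_ring_1) \<Rightarrow> ('v \<Rightarrow>\<^sub>0 nat) \<Rightarrow> 'r" where
  "monomial_value x \<alpha> = (\<Prod>v\<in>keys \<alpha>. x v ^ lookup \<alpha> v)"

lemma monomial_value_superset:
  assumes "finite A" "keys \<alpha> \<subseteq> A"
  shows "monomial_value x \<alpha> = (\<Prod>v\<in>A. x v ^ lookup \<alpha> v)"
  unfolding monomial_value_def using assms
  by (intro prod.mono_neutral_left) (auto simp: in_keys_iff)

lemma monomial_value_zero [simp]: "monomial_value x 0 = 1"
  by (simp add: monomial_value_def)

lemma monomial_value_single [simp]: "monomial_value x (single v n) = x v ^ n"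
  by (simp add: monomial_value_def)

lemma monomial_value_add: "monomial_value x (\<alpha> + \<beta>) = monomial_value x \<alpha> * monomial_value x \<beta>"
proof -
  let ?A = "keys \<alpha> \<union> keys \<beta>"
  have "monomial_value x (\<alpha> + \<beta>) = (\<Prod>v\<in>?A. x v ^ lookup (\<alpha> + \<beta>) v)"
    by (rule monomial_value_superset) (simp_all add: Poly_Mapping.keys_add)
  also have "\<dots> = monomial_value x \<alpha> * monomial_value x \<beta>"
    by (subst (1 2) monomial_value_superset[of ?A])
       (auto simp: lookup_add power_add prod.distrib)
  finally show ?thesis .
qed

lemma monomial_value_hom: "is_ring_hom h \<Longrightarrow> h (monomial_value x \<alpha>) = monomial_value (\<lambda>v. h (x v)) \<alpha>"
  by (simp add: monomial_value_def hom_prod hom_power)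

lemma monomial_value_mult:
  "monomial_value (\<lambda>v. x v * y v) \<alpha> = monomial_value x \<alpha> * monomial_value y \<alpha>"
  by (simp add: monomial_value_def power_mult_distrib prod.distrib)

lemma monomial_value_const: 
  fixes \<alpha> :: "'v::finite \<Rightarrow>\<^sub>0 nat"
  shows "monomial_value (\<lambda>v. c) \<alpha> = c ^ (\<Sum>i\<in>UNIV. lookup \<alpha> i)"
  by (subst monomial_value_superset[of UNIV]) (auto simp: power_sum)

text \<open>The value of \<open>F\<close> at a tuple of elements of an arbitrary commutative ring, where \<open>h\<close> embeds the
  coefficients into this ring.\<close>

definition poly_subst :: "(complex \<Rightarrow> 'r::comm_ring_1) \<Rightarrow> ('v \<Rightarrow> 'r) \<Rightarrow> 'v cpoly \<Rightarrow> 'r" where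
  "poly_subst h x F = (\<Sum>\<alpha>\<in>keys F. h (lookup F \<alpha>) * monomial_value x \<alpha>)"

lemma cpoly_eval_conv_subst: "cpoly_eval x = poly_subst (\<lambda>c. c) x"
  by (rule ext) (simp add: cpoly_eval_def poly_subst_def monomial_value_def)

definition Cst :: "complex \<Rightarrow> 'v cpoly" where "Cst c = single 0 c"
definition Var :: "'v \<Rightarrow> 'v cpoly" where "Var v = single (single v 1) 1"

lemma is_ring_hom_Cst: "is_ring_hom Cst"
  by (simp add: is_ring_hom_def Cst_def single_add mult_single)

lemma cpoly_as_sum: "F = (\<Sum>\<alpha>\<in>keys F. single \<alpha> (lookup F \<alpha>))"
proof (rule poly_mapping_eqI)
  fix \<beta>
  show "lookup F \<beta> = lookup (\<Sum>\<alpha>\<in>keys F. single \<alpha> (lookup F \<alpha>)) \<beta>"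
    by (simp add: lookup_sum lookup_single when_def in_keys_iff)
qed

lemma poly_subst_cong: "(\<And>c. h c = h' c) \<Longrightarrow> (\<And>v. x v = y v) \<Longrightarrow> poly_subst h x F = poly_subst h' y F"
  by (simp add: poly_subst_def monomial_value_def)

lemma poly_subst_hom:
  assumes "is_ring_hom g"
  shows "g (poly_subst h x F) = poly_subst (\<lambda>c. g (h c)) (\<lambda>v. g (x v)) F"
  by (simp add: poly_subst_def hom_sum[OF assms] hom_mult[OF assms] monomial_value_hom[OF assms])

context
  fixes h :: "complex \<Rightarrow> 'r::comm_ring_1"
  assumes h: "is_ring_hom h"
begin

lemma poly_subst_superset:
  assumes "finite A" "keys F \<subseteq> A"
  shows "poly_subst h x F = (\<Sum>\<alpha>\<in>A. h (lookup F \<alpha>) * monomial_value x \<alpha>)"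
  unfolding poly_subst_def using assms
  by (intro sum.mono_neutral_left) (auto simp: in_keys_iff hom_zero[OF h])

lemma poly_subst_single: "poly_subst h x (single \<alpha> c) = h c * monomial_value x \<alpha>"
  by (subst poly_subst_superset[of "{\<alpha>}"]) auto

lemma poly_subst_zero: "poly_subst h x 0 = 0"
  by (simp add: poly_subst_def)

lemma poly_subst_add: "poly_subst h x (F + G) = poly_subst h x F + poly_subst h x G"
proof -
  let ?A = "keys F \<union> keys G"
  have "poly_subst h x (F + G) = (\<Sum>\<alpha>\<in>?A. h (lookup (F + G) \<alpha>) * monomial_value x \<alpha>)"
    by (rule poly_subst_superset) (simp_all add: Poly_Mapping.keys_add)
  also have "\<dots> = poly_subst h x F + poly_subst h x G"
    by (subst (1 2) poly_subst_superset[of ?A])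
       (auto simp: lookup_add hom_add[OF h] algebra_simps sum.distrib)
  finally show ?thesis .
qed

lemma poly_subst_sum: "poly_subst h x (sum f A) = (\<Sum>i\<in>A. poly_subst h x (f i))"
  by (induction A rule: infinite_finite_induct) (auto simp: poly_subst_zero poly_subst_add)

lemma poly_subst_mult: "poly_subst h x (F * G) = poly_subst h x F * poly_subst h x G"
proof -
  have "F * G = (\<Sum>\<alpha>\<in>keys F. \<Sum>\<beta>\<in>keys G. single (\<alpha> + \<beta>) (lookup F \<alpha> * lookup G \<beta>))"
    by (subst cpoly_as_sum[of F], subst cpoly_as_sum[of G]) (simp add: sum_product mult_single)
  then have "poly_subst h x (F * G) = 
    (\<Sum>\<alpha>\<in>keys F. \<Sum>\<beta>\<in>keys G. h (lookup F \<alpha> * lookup G \<beta>) * monomial_value x (\<alpha> + \<beta>))"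
    by (simp add: poly_subst_sum poly_subst_single)
  also have "\<dots> = poly_subst h x F * poly_subst h x G"
    by (simp add: poly_subst_def sum_product monomial_value_add hom_mult[OF h] mult_ac)
  finally show ?thesis .
qed

lemma is_ring_hom_poly_subst: "is_ring_hom (poly_subst h x)"
  by (rule is_ring_homI)
     (auto simp: poly_subst_add poly_subst_mult poly_subst_single[of x 0 1, simplified] hom_one[OF h])

lemma poly_subst_Cst: "poly_subst h x (Cst c) = h c"
  by (simp add: Cst_def poly_subst_single)

lemma poly_subst_Var: "poly_subst h x (Var v) = x v"
  by (simp add: Var_def poly_subst_single hom_one[OF h])

end

lemma monomial_value_Var: "monomial_value Var \<alpha> = single \<alpha> 1"
proof -
  have pow: "Var v ^ n = single (single v n) 1" for v :: 'v and n
    by (induction n) (auto simp: Var_def mult_single single_add[symmetric])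
  have prd: "(\<Prod>i\<in>A. single (f i) (1::complex)) = single (sum f A) 1" for A and f :: "'v \<Rightarrow> 'v \<Rightarrow>\<^sub>0 nat"
    by (induction A rule: infinite_finite_induct) (auto simp: mult_single)
  have "\<alpha> = (\<Sum>v\<in>keys \<alpha>. single v (lookup \<alpha> v))"
    by (rule poly_mapping_eqI) (simp add: lookup_sum lookup_single when_def in_keys_iff)
  then show ?thesis
    unfolding monomial_value_def by (simp add: pow prd)
qed

lemma poly_subst_Var_self: "poly_subst Cst Var F = F"
proof -
  have "poly_subst Cst Var F = (\<Sum>\<alpha>\<in>keys F. single \<alpha> (lookup F \<alpha>))"
    by (simp add: poly_subst_def monomial_value_Var Cst_def mult_single)
  then show ?thesis using cpoly_as_sum[of F] by simp
qed

lemma cpoly_induct [case_names const var add mult]: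
  assumes "\<And>c. P (Cst c)" "\<And>v. P (Var v)" "\<And>F G. P F \<Longrightarrow> P G \<Longrightarrow> P (F + G)"
    "\<And>F G. P F \<Longrightarrow> P G \<Longrightarrow> P (F * G)"
  shows "P F"
proof -
  have one: "P 1" and zero: "P 0" using assms(1)[of 1] assms(1)[of 0] by (simp_all add: Cst_def)
  have pw: "P (F ^ n)" if "P F" for F n using that by (induction n) (auto simp: one assms)
  have "P (\<Prod>v\<in>A. f v)" if "\<And>v. P (f v)" for A and f :: "'a \<Rightarrow> 'a cpoly"
    using that by (induction A rule: infinite_finite_induct) (auto simp: one assms)
  then have mv: "P (monomial_value Var \<alpha>)" for \<alpha>
    by (simp add: monomial_value_def pw assms)
  have "P (\<Sum>v\<in>A. f v)" if "\<And>v. P (f v)" for A and f :: "('a \<Rightarrow>\<^sub>0 nat) \<Rightarrow> 'a cpoly"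
    using that by (induction A rule: infinite_finite_induct) (auto simp: zero assms)
  then have "P (poly_subst Cst Var F)"
    unfolding poly_subst_def by (simp add: mv assms)
  then show ?thesis by (simp add: poly_subst_Var_self)
qed

lemma hom_eq_on_cpoly:
  assumes "is_ring_hom f" "is_ring_hom g" "\<And>c. f (Cst c) = g (Cst c)" "\<And>v. f (Var v) = g (Var v)"
  shows "f F = g F"
  by (induction F rule: cpoly_induct) (auto simp: assms hom_add hom_mult)

lemma is_ring_hom_eval: "is_ring_hom (cpoly_eval x)"
  by (simp add: cpoly_eval_conv_subst is_ring_hom_poly_subst is_ring_hom_id)

lemmas cpoly_eval_simps [simp] =
  hom_one[OF is_ring_hom_eval] hom_zero[OF is_ring_hom_eval] hom_add[OF is_ring_hom_eval]
  hom_mult[OF is_ring_hom_eval] hom_uminus[OF is_ring_hom_eval] hom_diff[OF is_ring_hom_eval]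
  hom_sum[OF is_ring_hom_eval] hom_prod[OF is_ring_hom_eval] hom_power[OF is_ring_hom_eval]

lemma cpoly_eval_Cst [simp]: "cpoly_eval x (Cst c) = c"
  and cpoly_eval_Var [simp]: "cpoly_eval x (Var v) = x v"
  by (simp_all add: cpoly_eval_conv_subst poly_subst_Cst poly_subst_Var is_ring_hom_id)

lemma cpoly_scale_conv_mult: "cpoly_scale c F = Cst c * F"
  unfolding cpoly_scale_def Cst_def by (rule mult_map_scale_conv_mult)

lemma cpoly_eval_scale [simp]: "cpoly_eval x (cpoly_scale c F) = c * cpoly_eval x F"
  by (simp add: cpoly_scale_conv_mult)

lemma cpoly_eval_subst:
  "cpoly_eval x (poly_subst Cst y F) = cpoly_eval (\<lambda>v. cpoly_eval x (y v)) F"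
  by (simp add: poly_subst_hom[OF is_ring_hom_eval] cpoly_eval_conv_subst[symmetric])

section \<open>Polynomials are determined by their values\<close>

text \<open>Kronecker's trick: weighting the variables by powers of a large number makes the weighted
  degrees of finitely many given monomials distinct.\<close>

lemma separating_weights:
  assumes "finite V" "finite K"
  shows "\<exists>n::'v \<Rightarrow> nat. \<forall>\<alpha>\<in>K. \<forall>\<beta>\<in>K. (\<Sum>v\<in>V. \<alpha> v * n v) = (\<Sum>v\<in>V. \<beta> v * n v) \<longrightarrow> (\<forall>v\<in>V. \<alpha> v = (\<beta> v :: nat))"
  using assms(1)
proof (induction V)
  case empty then show ?case by simp
next
  case (insert w V)
  then obtain n where n: "\<forall>\<alpha>\<in>K. \<forall>\<beta>\<in>K. (\<Sum>v\<in>V. \<alpha> v * n v) = (\<Sum>v\<in>V. \<beta> v * n v) \<longrightarrow> (\<forall>v\<in>V. \<alpha> v = \<beta> v)"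
    by blast
  define M where "M = Suc (\<Sum>\<alpha>\<in>K. \<Sum>v\<in>V. \<alpha> v * n v)"
  have "0 < M" by (simp add: M_def)
  have M: "(\<Sum>v\<in>V. \<alpha> v * n v) < M" if "\<alpha> \<in> K" for \<alpha>
    unfolding M_def using member_le_sum[of \<alpha> K "\<lambda>\<alpha>. \<Sum>v\<in>V. \<alpha> v * n v"] that assms(2) by simp
  define n' where "n' = n(w := M)"
  have eq: "(\<Sum>v\<in>insert w V. \<alpha> v * n' v) = \<alpha> w * M + (\<Sum>v\<in>V. \<alpha> v * n v)" for \<alpha>
  proof -
    have "(\<Sum>v\<in>V. \<alpha> v * n' v) = (\<Sum>v\<in>V. \<alpha> v * n v)"
      using insert.hyps by (intro sum.cong) (auto simp: n'_def)
    then show ?thesis using insert.hyps by (simp add: n'_def)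
  qed
  show ?case
  proof (intro exI[of _ n'] ballI impI)
    fix \<alpha> \<beta> v assume a: "\<alpha> \<in> K" "\<beta> \<in> K"
      "(\<Sum>v\<in>insert w V. \<alpha> v * n' v) = (\<Sum>v\<in>insert w V. \<beta> v * n' v)" "v \<in> insert w V"
    let ?A = "\<Sum>v\<in>V. \<alpha> v * n v" and ?B = "\<Sum>v\<in>V. \<beta> v * n v"
    have e: "\<alpha> w * M + ?A = \<beta> w * M + ?B" using a(3) by (simp only: eq)
    have "(\<alpha> w * M + ?A) mod M = ?A" "(\<beta> w * M + ?B) mod M = ?B" using M[OF a(1)] M[OF a(2)] by simp_all
    then have AB: "?A = ?B" using e by metis
    then have "\<alpha> w * M = \<beta> w * M" using e by linarith
    then have "\<alpha> w = \<beta> w" using \<open>0 < M\<close> by simp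
    moreover have "\<forall>v\<in>V. \<alpha> v = \<beta> v" using n a AB by blast
    ultimately show "\<alpha> v = \<beta> v" using a(4) by auto
  qed
qed

text \<open>After the substitution of \<open>y ^ n v\<close> for the variable \<open>v\<close>, with weights \<open>n\<close> that separate the monomials
  of \<open>F\<close>, the coefficients of \<open>F\<close> become those of a univariate polynomial with infinitely many zeros.\<close>

lemma cpoly_eq_zeroI:
  assumes "\<And>x. cpoly_eval x F = 0"
  shows "F = 0"
proof (rule ccontr)
  assume "F \<noteq> 0"
  define V where "V = (\<Union>\<alpha>\<in>keys F. keys \<alpha>)"
  have "finite V" by (simp add: V_def)
  have "finite (lookup ` keys F)" by simp
  from separating_weights[OF \<open>finite V\<close> this]
  obtain n where n: "\<forall>\<alpha>\<in>lookup ` keys F. \<forall>\<beta>\<in>lookup ` keys F. 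
      (\<Sum>v\<in>V. \<alpha> v * n v) = (\<Sum>v\<in>V. \<beta> v * n v) \<longrightarrow> (\<forall>v\<in>V. \<alpha> v = \<beta> v)"
    by (rule exE)
  define w where "w \<alpha> = (\<Sum>v\<in>V. lookup \<alpha> v * n v)" for \<alpha>
  have inj: "inj_on w (keys F)"
  proof (rule inj_onI, rule poly_mapping_eqI)
    fix \<alpha> \<beta> v assume a: "\<alpha> \<in> keys F" "\<beta> \<in> keys F" "w \<alpha> = w \<beta>"
    then have "\<forall>v\<in>V. lookup \<alpha> v = lookup \<beta> v" 
      using n[rule_format, OF imageI[OF a(1)] imageI[OF a(2)]] by (simp add: w_def)
    moreover have "v \<notin> V \<Longrightarrow> lookup \<alpha> v = 0 \<and> lookup \<beta> v = 0"
      using a by (auto simp: V_def in_keys_iff)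
    ultimately show "lookup \<alpha> v = lookup \<beta> v" by (cases "v \<in> V") auto
  qed
  define p where "p = (\<Sum>\<alpha>\<in>keys F. monom (lookup F \<alpha>) (w \<alpha>))"
  have "poly p y = 0" for y
  proof -
    have "monomial_value (\<lambda>v. y ^ n v) \<alpha> = y ^ w \<alpha>" if "\<alpha> \<in> keys F" for \<alpha>
      using that \<open>finite V\<close> 
      by (subst monomial_value_superset[of V]) (auto simp: V_def w_def power_sum power_mult[symmetric] mult.commute)
    then have "poly p y = cpoly_eval (\<lambda>v. y ^ n v) F"
      by (simp add: p_def poly_sum poly_monom cpoly_eval_conv_subst poly_subst_def)
    then show ?thesis using assms by simp
  qed
  then have "p = 0" using poly_all_0_iff_0 by blast
  obtain \<alpha> where \<alpha>: "\<alpha> \<in> keys F" using \<open>F \<noteq> 0\<close> by (metis keys_eq_empty equals0I)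
  have "coeff p (w \<alpha>) = (\<Sum>\<beta>\<in>keys F. if \<beta> = \<alpha> then lookup F \<beta> else 0)"
    unfolding p_def coeff_sum using inj \<alpha> by (intro sum.cong) (auto dest: inj_onD)
  then show False using \<alpha> \<open>p = 0\<close> by (simp add: in_keys_iff)
qed

lemma cpoly_eqI: "(\<And>x. cpoly_eval x F = cpoly_eval x G) \<Longrightarrow> F = G"
  using cpoly_eq_zeroI[of "F - G"] by simp

text \<open>The polynomial \<open>F (a + t b)\<close> in \<open>t\<close>.\<close>

definition along :: "('v \<Rightarrow> complex) \<Rightarrow> ('v \<Rightarrow> complex) \<Rightarrow> 'v cpoly \<Rightarrow> complex poly" where
  "along a b = poly_subst (\<lambda>c. [:c:]) (\<lambda>v. [:a v, b v:])"

lemma is_ring_hom_along: "is_ring_hom (along a b)"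
  unfolding along_def by (intro is_ring_hom_poly_subst is_ring_hom_const_poly)

lemmas along_simps [simp] =
  hom_one[OF is_ring_hom_along] hom_zero[OF is_ring_hom_along] hom_add[OF is_ring_hom_along]
  hom_mult[OF is_ring_hom_along] hom_uminus[OF is_ring_hom_along] hom_diff[OF is_ring_hom_along]
  hom_sum[OF is_ring_hom_along] hom_prod[OF is_ring_hom_along] hom_power[OF is_ring_hom_along]

lemma along_Cst [simp]: "along a b (Cst c) = [:c:]"
  and along_Var [simp]: "along a b (Var v) = [:a v, b v:]"
  unfolding along_def by (simp_all add: poly_subst_Cst poly_subst_Var is_ring_hom_const_poly)

lemma poly_along: "poly (along a b F) t = cpoly_eval (\<lambda>v. a v + t * b v) F"
  unfolding along_def cpoly_eval_conv_subst poly_subst_hom[OF is_ring_hom_poly]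
  by (rule poly_subst_cong) auto

text \<open>On the line that joins two points, both restricted polynomials are nonzero, so a value of the
  parameter avoids the roots of both.\<close>

lemma cpoly_common_nonzero:
  assumes "cpoly_eval x F \<noteq> 0" "cpoly_eval y G \<noteq> 0"
  shows "\<exists>t. cpoly_eval (\<lambda>v. x v + t * (y v - x v)) F \<noteq> 0 \<and> cpoly_eval (\<lambda>v. x v + t * (y v - x v)) G \<noteq> 0"
proof -
  let ?p = "along x (\<lambda>v. y v - x v)"
  have "poly (?p F) 0 \<noteq> 0" "poly (?p G) 1 \<noteq> 0" using assms by (simp_all add: poly_along)
  then have "?p F * ?p G \<noteq> 0" by auto
  then obtain t where "poly (?p F * ?p G) t \<noteq> 0" using poly_all_0_iff_0 by blast
  then show ?thesis by (auto simp: poly_along)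
qed

lemma cpoly_mult_eq_zero_iff [simp]: "(F * G :: 'v cpoly) = 0 \<longleftrightarrow> F = 0 \<or> G = 0"
proof (intro iffI; rule ccontr)
  assume "F * G = 0" "\<not> (F = 0 \<or> G = 0)"
  then obtain x y where "cpoly_eval x F \<noteq> 0" "cpoly_eval y G \<noteq> 0" using cpoly_eq_zeroI by metis
  from cpoly_common_nonzero[OF this] obtain z where "cpoly_eval z F * cpoly_eval z G \<noteq> 0" by auto
  then have "cpoly_eval z (F * G) \<noteq> 0" by simp
  then show False using \<open>F * G = 0\<close> by simp
qed auto

section \<open>Homogeneous polynomials\<close>

lemma cpoly_prod_nonzero: 
  "finite S \<Longrightarrow> (\<And>x. x \<in> S \<Longrightarrow> f x \<noteq> 0) \<Longrightarrow> (\<Prod>x\<in>S. f x) \<noteq> (0 :: 'v cpoly)"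
  by (induction S rule: finite_induct) auto

lemma eval_zero_of_dvd: "G dvd F \<Longrightarrow> cpoly_eval x G = 0 \<Longrightarrow> cpoly_eval x F = 0"
  by (auto simp: dvd_def)

text \<open>The coefficient of \<open>\<alpha>\<close> is multiplied by the value of the monomial \<open>\<alpha>\<close> at \<open>c\<close> when the variables are
  scaled by \<open>c\<close>. So homogeneity of all kinds can be read off from the values of a polynomial.\<close>

lemma keys_scaling:
  assumes "\<And>x. cpoly_eval (\<lambda>v. c v * x v) F = k * cpoly_eval x F" "\<alpha> \<in> keys F"
  shows "monomial_value c \<alpha> = k"
proof -
  define G where "G = poly_subst Cst (\<lambda>v. Cst (c v) * Var v) F"
  have "G = Cst k * F"
    by (rule cpoly_eqI) (simp add: G_def cpoly_eval_subst assms)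
  have "G = (\<Sum>\<alpha>\<in>keys F. single \<alpha> (lookup F \<alpha> * monomial_value c \<alpha>))"
    unfolding G_def poly_subst_def monomial_value_mult monomial_value_Var 
      monomial_value_hom[OF is_ring_hom_Cst, symmetric] by (simp add: Cst_def mult_single)
  then have "lookup G \<alpha> = lookup F \<alpha> * monomial_value c \<alpha>"
    using assms(2) by (simp add: lookup_sum lookup_single when_def)
  moreover have "lookup G \<alpha> = k * lookup F \<alpha>"
    by (simp add: \<open>G = Cst k * F\<close> cpoly_scale_conv_mult[symmetric])
  ultimately show ?thesis using assms(2) by (simp add: in_keys_iff)
qed

abbreviation ev :: "3 cpoly \<Rightarrow> complex^3 \<Rightarrow> complex" where
  "ev F v \<equiv> cpoly_eval (($) v) F"

lemma form_eq_zeroI: "(\<And>v. ev F v = 0) \<Longrightarrow> F = 0"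
proof (rule cpoly_eq_zeroI)
  fix x :: "3 \<Rightarrow> complex"
  assume "\<And>v. ev F v = 0"
  then have "ev F (vec_lambda x) = 0" by blast
  moreover have "($) (vec_lambda x) = x" by (rule ext) simp
  ultimately show "cpoly_eval x F = 0" by simp
qed

lemma form_eqI: "(\<And>v. ev F v = ev G v) \<Longrightarrow> F = G"
  using form_eq_zeroI[of "F - G"] by simp

lemma homogeneous_subst:
  assumes "homogeneous d F"
  shows "poly_subst h (\<lambda>i. c * x i) F = c ^ d * poly_subst h x F"
proof -
  have "h (lookup F \<alpha>) * monomial_value (\<lambda>i. c * x i) \<alpha> = c ^ d * (h (lookup F \<alpha>) * monomial_value x \<alpha>)"
    if "\<alpha> \<in> keys F" for \<alpha>
    using assms that by (simp add: homogeneous_def monomial_value_mult monomial_value_const mult_ac)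
  then show ?thesis by (simp add: poly_subst_def sum_distrib_left)
qed

lemma cpoly_eval_homogeneous_scale:
  fixes F :: "3 cpoly"
  shows "homogeneous d F \<Longrightarrow> cpoly_eval (\<lambda>i. c * x i) F = c ^ d * cpoly_eval x F"
  using homogeneous_subst[of d F "\<lambda>c. c" c x] by (simp add: cpoly_eval_conv_subst)

lemma homogeneous_eval:
  "homogeneous d F \<Longrightarrow> ev F (c *s v) = c ^ d * ev F v"
proof -
  assume "homogeneous d F"
  moreover have "($) (c *s v) = (\<lambda>i. c * v $ i)" by (rule ext) simp
  ultimately show ?thesis
    using homogeneous_subst[of d F "\<lambda>c. c" c "\<lambda>i. v $ i"] by (simp add: cpoly_eval_conv_subst)
qed

lemma two_power_eq: "(2::complex) ^ m = 2 ^ n \<longleftrightarrow> m = n"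
proof
  assume "(2::complex) ^ m = 2 ^ n"
  then have "norm ((2::complex) ^ m) = norm ((2::complex) ^ n)" by simp
  then show "m = n" by (simp add: norm_power)
qed simp

lemma homogeneousI:
  assumes "\<And>c v. ev F (c *s v) = c ^ d * ev F v"
  shows "homogeneous d F"
  unfolding homogeneous_def
proof
  fix \<alpha> assume a: "\<alpha> \<in> keys F"
  have "monomial_value (\<lambda>_. 2) \<alpha> = (2::complex) ^ d"
  proof (rule keys_scaling[OF _ a])
    fix x
    show "cpoly_eval (\<lambda>v. 2 * x v) F = 2 ^ d * cpoly_eval x F"
    proof -
      have "($) (vec_lambda x) = x" "($) (2 *s vec_lambda x) = (\<lambda>v. 2 * x v)" by (rule ext, simp)+
      then show ?thesis using assms[of 2 "vec_lambda x"] by simp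
    qed
  qed
  then show "(\<Sum>i\<in>UNIV. lookup \<alpha> i) = d" by (simp add: monomial_value_const two_power_eq)
qed

lemma homogeneous_0 [simp]: "homogeneous d 0"
  by (simp add: homogeneous_def)

lemma homogeneous_mult: "homogeneous a F \<Longrightarrow> homogeneous b G \<Longrightarrow> homogeneous (a + b) (F * G)"
  by (rule homogeneousI) (simp add: homogeneous_eval power_add)

lemma homogeneous_add: "homogeneous a F \<Longrightarrow> homogeneous a G \<Longrightarrow> homogeneous a (F + G)"
  by (rule homogeneousI) (simp add: homogeneous_eval algebra_simps)

lemma homogeneous_Cst: "homogeneous 0 (Cst c)"
  by (rule homogeneousI) simp

lemma homogeneous_scale: "homogeneous a F \<Longrightarrow> homogeneous a (cpoly_scale c F)"
  by (rule homogeneousI) (simp add: homogeneous_eval algebra_simps)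

lemma homogeneous_sum: "(\<And>i. i \<in> A \<Longrightarrow> homogeneous a (f i)) \<Longrightarrow> homogeneous a (sum f A)"
  by (induction A rule: infinite_finite_induct) (auto intro: homogeneous_add)

lemma homogeneous_prod:
  "(\<And>i. i \<in> A \<Longrightarrow> homogeneous (n i) (f i)) \<Longrightarrow> homogeneous (sum n A) (prod f A)"
  using homogeneous_Cst[of 1]
  by (induction A rule: infinite_finite_induct) (auto simp: Cst_def intro: homogeneous_mult)

lemma homogeneous_unique:
  assumes "homogeneous a F" "homogeneous b F" "F \<noteq> 0" shows "a = b"
  using assms by (metis homogeneous_def keys_eq_empty equals0I)

lemma homogeneous_power: "homogeneous a F \<Longrightarrow> homogeneous (n * a) (F ^ n)"
  by (rule homogeneousI) (simp add: homogeneous_eval power_mult_distrib power_mult mult.commute)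

text \<open>The homomorphism \<open>F \<mapsto> F (t X)\<close>. It maps exactly the forms of degree \<open>d\<close> to monomials \<open>F t\<^sup>d\<close>, which
  reduces the homogeneity of factors to the fact that factors of monomials are monomials.\<close>

definition grade :: "3 cpoly \<Rightarrow> 3 cpoly poly" where
  "grade = poly_subst (\<lambda>c. [:Cst c:]) (\<lambda>i. [:0, Var i:])"

lemma is_ring_hom_grade: "is_ring_hom grade"
  unfolding grade_def by (intro is_ring_hom_poly_subst is_ring_hom_comp[OF is_ring_hom_const_poly is_ring_hom_Cst])

lemma grade_homogeneous: "homogeneous d F \<Longrightarrow> grade F = monom F d"
proof -
  assume "homogeneous d F"
  have "grade F = poly_subst (\<lambda>c. [:Cst c:]) (\<lambda>i. [:0, 1:] * [:Var i:]) F"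
    unfolding grade_def by (rule poly_subst_cong) auto
  also have "\<dots> = [:0,1:] ^ d * poly_subst (\<lambda>c. [:Cst c:]) (\<lambda>i. [:Var i:]) F"
    by (rule homogeneous_subst[OF \<open>homogeneous d F\<close>])
  also have "poly_subst (\<lambda>c. [:Cst c:]) (\<lambda>i. [:Var i:]) F = [:F:]"
    using poly_subst_hom[OF is_ring_hom_const_poly, of Cst Var F] by (simp add: poly_subst_Var_self)
  also have "[:0,1:] ^ d * [:F:] = monom F d"
    by (simp add: monom_altdef)
  finally show ?thesis .
qed

lemma poly_eval_grade: "cpoly_eval v (poly (grade F) (Cst c)) = cpoly_eval (\<lambda>i. c * v i) F"
proof -
  have h: "is_ring_hom (\<lambda>p. cpoly_eval v (poly p (Cst c)))"
    by (intro is_ring_hom_comp[OF is_ring_hom_eval] is_ring_hom_poly)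
  show ?thesis
    unfolding grade_def poly_subst_hom[OF h] by (simp add: cpoly_eval_conv_subst[symmetric])
qed

lemma homogeneous_if_grade_monom:
  assumes "grade F = monom G d" shows "homogeneous d F"
proof (rule homogeneousI)
  fix c v
  have *: "cpoly_eval (\<lambda>i. c * v $ i) F = c ^ d * ev G v" for c
    using poly_eval_grade[of "($) v" F c] by (simp add: assms poly_monom mult.commute)
  have "ev G v = ev F v" using *[of 1] by simp
  moreover have "ev F (c *s v) = cpoly_eval (\<lambda>i. c * v $ i) F"
    by (rule arg_cong[of _ _ "\<lambda>x. cpoly_eval x F"]) auto
  ultimately show "ev F (c *s v) = c ^ d * ev F v" using *[of c] by simp
qed

text \<open>The order of vanishing at zero is at most the degree, with equality for monomials, and both are additive.\<close>

lemma monom_factor: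
  fixes p q :: "'a::idom poly"
  assumes "p * q = monom a d" "a \<noteq> 0"
  shows "\<exists>b. p = monom b (degree p)" "degree p + degree q = d"
proof -
  have nz: "p \<noteq> 0" "q \<noteq> 0" "p * q \<noteq> 0" using assms by auto
  have "order 0 p + order 0 q = d"
    using order_mult[OF nz(3), of 0] assms by (simp add: order_0_monom)
  moreover show deg: "degree p + degree q = d"
    using degree_mult_eq[OF nz(1,2)] assms by (simp add: degree_monom_eq)
  ultimately have "order 0 p = degree p" 
    using order_degree[OF nz(1), of 0] order_degree[OF nz(2), of 0] by simp
  then have "[:-0,1:] ^ degree p dvd p" using order_1[of 0 p] by simp
  then obtain r where r: "p = [:0,1:] ^ degree p * r" by auto
  then have "degree p = degree p + degree r" using nz
    by (metis degree_linear_power degree_mult_eq minus_zero mult_zero_left mult_zero_right neg_0_equal_iff_equal)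
  then obtain b where "r = [:b:]" by (metis add_cancel_right_right degree_0_id)
  then have "p = monom b (degree p)" using r by (simp add: monom_altdef)
  then show "\<exists>b. p = monom b (degree p)" by blast
qed

lemma homogeneous_factor:
  fixes q s :: "3 cpoly"
  assumes "homogeneous d (q * s)" "q * s \<noteq> 0"
  shows "\<exists>a b. homogeneous a q \<and> homogeneous b s \<and> a + b = d"
proof -
  have *: "grade q * grade s = monom (q * s) d"
    using grade_homogeneous[OF assms(1)] by (simp add: hom_mult[OF is_ring_hom_grade])
  then have **: "grade s * grade q = monom (q * s) d" by (simp add: mult.commute)
  show ?thesis
    using monom_factor[OF * assms(2)] monom_factor[OF ** assms(2)] homogeneous_if_grade_monom by metis
qed

section \<open>Derivatives\<close>

lemma cpoly_pderiv_superset: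
  assumes "finite A" "keys F \<subseteq> A"
  shows "cpoly_pderiv v F = (\<Sum>\<alpha>\<in>A. single (\<alpha> - single v 1) (of_nat (lookup \<alpha> v) * lookup F \<alpha>))"
  unfolding cpoly_pderiv_def using assms
  by (intro sum.mono_neutral_left) (auto simp: in_keys_iff)

lemma cpoly_pderiv_single:
  "cpoly_pderiv v (single \<alpha> c) = single (\<alpha> - single v 1) (of_nat (lookup \<alpha> v) * c)"
  by (subst cpoly_pderiv_superset[of "{\<alpha>}"]) auto

lemma cpoly_pderiv_0 [simp]: "cpoly_pderiv v 0 = 0"
  by (simp add: cpoly_pderiv_def)

lemma cpoly_pderiv_add: "cpoly_pderiv v (F + G) = cpoly_pderiv v F + cpoly_pderiv v G"
proof -
  let ?A = "keys F \<union> keys G"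
  have "cpoly_pderiv v (F + G) = 
      (\<Sum>\<alpha>\<in>?A. single (\<alpha> - single v 1) (of_nat (lookup \<alpha> v) * lookup (F + G) \<alpha>))"
    by (rule cpoly_pderiv_superset) (simp_all add: Poly_Mapping.keys_add)
  also have "\<dots> = cpoly_pderiv v F + cpoly_pderiv v G"
    by (subst (1 2) cpoly_pderiv_superset[of ?A])
       (auto simp: lookup_add algebra_simps single_add sum.distrib)
  finally show ?thesis .
qed

lemma cpoly_pderiv_sum: "cpoly_pderiv v (sum f A) = (\<Sum>i\<in>A. cpoly_pderiv v (f i))"
  by (induction A rule: infinite_finite_induct) (auto simp: cpoly_pderiv_add)

lemma diff_single_add:
  fixes \<alpha> \<beta> :: "'v \<Rightarrow>\<^sub>0 nat"
  assumes "lookup \<alpha> v > 0"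
  shows "\<alpha> - single v 1 + \<beta> = \<alpha> + \<beta> - single v 1"
  using assms by (intro poly_mapping_eqI) (auto simp: lookup_add lookup_minus lookup_single when_def)

lemma cpoly_pderiv_mult:
  "cpoly_pderiv v (F * G) = cpoly_pderiv v F * G + F * cpoly_pderiv v G"
proof -
  have *: "single (\<alpha> + \<beta> - single v 1) (of_nat (lookup (\<alpha> + \<beta>) v) * (c * d)) =
      cpoly_pderiv v (single \<alpha> c) * single \<beta> d + single \<alpha> c * cpoly_pderiv v (single \<beta> d)" for \<alpha> \<beta> c d
  proof -
    have 1: "cpoly_pderiv v (single \<alpha> c) * single \<beta> d = single (\<alpha> + \<beta> - single v 1) (of_nat (lookup \<alpha> v) * (c * d))"
      using diff_single_add[of \<alpha> v \<beta>] 
      by (cases "lookup \<alpha> v = 0") (auto simp: cpoly_pderiv_single mult_single mult.assoc)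
    have 2: "single \<alpha> c * cpoly_pderiv v (single \<beta> d) = single (\<alpha> + \<beta> - single v 1) (of_nat (lookup \<beta> v) * (c * d))"
      using diff_single_add[of \<beta> v \<alpha>] 
      by (cases "lookup \<beta> v = 0") (auto simp: cpoly_pderiv_single mult_single add.commute mult_ac)
    show ?thesis unfolding 1 2 by (simp add: lookup_add algebra_simps single_add[symmetric])
  qed
  have "F * G = (\<Sum>\<alpha>\<in>keys F. \<Sum>\<beta>\<in>keys G. single (\<alpha> + \<beta>) (lookup F \<alpha> * lookup G \<beta>))"
    by (subst cpoly_as_sum[of F], subst cpoly_as_sum[of G]) (simp add: sum_product mult_single)
  then have "cpoly_pderiv v (F * G) = (\<Sum>\<alpha>\<in>keys F. \<Sum>\<beta>\<in>keys G.
      cpoly_pderiv v (single \<alpha> (lookup F \<alpha>)) * single \<beta> (lookup G \<beta>) + 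
      single \<alpha> (lookup F \<alpha>) * cpoly_pderiv v (single \<beta> (lookup G \<beta>)))"
    by (simp only: cpoly_pderiv_sum cpoly_pderiv_single[of v "_ + _"] *)
  also have "\<dots> = cpoly_pderiv v (\<Sum>\<alpha>\<in>keys F. single \<alpha> (lookup F \<alpha>)) * (\<Sum>\<beta>\<in>keys G. single \<beta> (lookup G \<beta>)) + 
      (\<Sum>\<alpha>\<in>keys F. single \<alpha> (lookup F \<alpha>)) * cpoly_pderiv v (\<Sum>\<beta>\<in>keys G. single \<beta> (lookup G \<beta>))"
    by (simp only: cpoly_pderiv_sum sum_product sum.distrib)
  finally show ?thesis by (simp only: cpoly_as_sum[symmetric])
qed

lemma cpoly_pderiv_Cst [simp]: "cpoly_pderiv v (Cst c) = 0"
  by (simp add: Cst_def cpoly_pderiv_single)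

lemma cpoly_pderiv_Var: "cpoly_pderiv v (Var w) = (if v = w then 1 else 0)"
  by (auto simp: Var_def cpoly_pderiv_single lookup_single when_def)

definition dir_deriv :: "('v::finite \<Rightarrow> complex) \<Rightarrow> 'v cpoly \<Rightarrow> 'v cpoly" where
  "dir_deriv u F = (\<Sum>i\<in>UNIV. Cst (u i) * cpoly_pderiv i F)"

lemma dir_deriv_0 [simp]: "dir_deriv u 0 = 0"
  by (simp add: dir_deriv_def)

lemma dir_deriv_add: "dir_deriv u (F + G) = dir_deriv u F + dir_deriv u G"
  by (simp add: dir_deriv_def cpoly_pderiv_add distrib_left sum.distrib)

lemma dir_deriv_mult: "dir_deriv u (F * G) = dir_deriv u F * G + F * dir_deriv u G"
  by (simp add: dir_deriv_def cpoly_pderiv_mult distrib_left sum.distrib sum_distrib_left 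
      sum_distrib_right mult_ac)

lemma pderiv_along: "pderiv (along a b F) = along a b (dir_deriv b F)"
proof (induction F rule: cpoly_induct)
  case (var v)
  have "dir_deriv b (Var v) = Cst (b v)"
    by (simp add: dir_deriv_def cpoly_pderiv_Var if_distrib cong: if_cong)
  then show ?case by (simp add: pderiv_pCons)
next
  case (const c)
  show ?case by (simp add: dir_deriv_def)
qed (simp_all add: dir_deriv_add dir_deriv_mult pderiv_add pderiv_mult mult_ac)

lemma homogeneous_pderiv:
  assumes "homogeneous d F" shows "homogeneous (d - 1) (cpoly_pderiv v F)"
proof -
  have "homogeneous (d - 1) (single (\<alpha> - single v 1) (of_nat (lookup \<alpha> v) * lookup F \<alpha>))" 
    if "\<alpha> \<in> keys F" for \<alpha>
  proof (cases "lookup \<alpha> v = 0")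
    case False
    have "d = (\<Sum>i\<in>UNIV. lookup (\<alpha> - single v 1 + single v 1) i)"
      using assms that diff_single_add[of \<alpha> v "single v 1"] False by (simp add: homogeneous_def)
    also have "\<dots> = (\<Sum>i\<in>UNIV. lookup (\<alpha> - single v 1) i) + 1"
      by (simp add: lookup_add sum.distrib lookup_single when_def)
    finally show ?thesis by (simp add: homogeneous_def)
  qed simp
  then show ?thesis unfolding cpoly_pderiv_def by (intro homogeneous_sum)
qed

lemma homogeneous_dir_deriv: "homogeneous d F \<Longrightarrow> homogeneous (d - 1) (dir_deriv u F)"
  unfolding dir_deriv_def using homogeneous_mult[OF homogeneous_Cst homogeneous_pderiv, of d F]
  by (intro homogeneous_sum) simp

lemma ev_dir_deriv: "ev (dir_deriv u F) v = (\<Sum>i\<in>UNIV. u i * ev (cpoly_pderiv i F) v)"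
  by (simp add: dir_deriv_def)

text \<open>Along the line through \<open>v\<close> and the origin, a form of degree \<open>d\<close> is \<open>(1 + t)\<^sup>d\<close> times its value at \<open>v\<close>.\<close>

lemma euler:
  assumes "homogeneous d F" shows "ev (dir_deriv (($) v) F) v = of_nat d * ev F v"
proof -
  have "along (($) v) (($) v) F = poly_subst (\<lambda>c. [:c:]) (\<lambda>i. [:1,1:] * [:v $ i:]) F"
    unfolding along_def by (rule poly_subst_cong) auto
  also have "\<dots> = [:1,1:] ^ d * poly_subst (\<lambda>c. [:c:]) (\<lambda>i. [:v $ i:]) F"
    by (rule homogeneous_subst[OF assms])
  also have "poly_subst (\<lambda>c. [:c:]) (\<lambda>i. [:v $ i:]) F = [:ev F v:]"
    using poly_subst_hom[OF is_ring_hom_const_poly, of "\<lambda>c. c" "\<lambda>i. v $ i" F] 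
    by (simp add: cpoly_eval_conv_subst)
  also have "[:1,1:] ^ d * [:ev F v:] = smult (ev F v) ([:1,1:] ^ d)" by simp
  finally have "poly (pderiv (along (($) v) (($) v) F)) 0 = of_nat d * ev F v"
    by (simp only: pderiv_smult pderiv_power) (simp add: pderiv_pCons)
  moreover have "poly (pderiv (along (($) v) (($) v) F)) 0 = ev (dir_deriv (($) v) F) v"
    by (simp add: pderiv_along poly_along)
  ultimately show ?thesis by simp
qed

section \<open>Unique factorization\<close>

text \<open>An isomorphism with the ring of iterated univariate polynomials, in which factorization into primes
  is available.\<close>

definition nested :: "3 cpoly \<Rightarrow> complex poly poly poly" where
  "nested = poly_subst (\<lambda>c. [:[:[:c:]:]:]) 
     (\<lambda>i. if i = 1 then [:[:[:0, 1:]:]:] else if i = 2 then [:[:0, 1:]:] else [:0, 1:])"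

lemma is_ring_hom_const3: "is_ring_hom (\<lambda>c::complex. [:[:[:c:]:]:])"
  by (intro is_ring_hom_comp[OF is_ring_hom_const_poly] is_ring_hom_const_poly)

lemma is_ring_hom_nested: "is_ring_hom nested"
  unfolding nested_def by (intro is_ring_hom_poly_subst is_ring_hom_const3)

lemma nested_Cst: "nested (Cst c) = [:[:[:c:]:]:]"
  unfolding nested_def by (rule poly_subst_Cst[OF is_ring_hom_const3])

lemma nested_Var: "nested (Var i) = 
    (if i = 1 then [:[:[:0, 1:]:]:] else if i = 2 then [:[:0, 1:]:] else [:0, 1:])"
  unfolding nested_def by (rule poly_subst_Var[OF is_ring_hom_const3])

lemma nested_surj: "\<exists>F. nested F = p"
proof -
  note hom = hom_add[OF is_ring_hom_nested] hom_mult[OF is_ring_hom_nested] hom_zero[OF is_ring_hom_nested]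
  have 1: "\<exists>F. nested F = [:[:f:]:]" for f
  proof (induction f)
    case 0 then show ?case using hom by (intro exI[of _ 0]) simp
  next
    case (pCons a p)
    then obtain F where "nested F = [:[:p:]:]" by blast
    then have "nested (Cst a + Var 1 * F) = [:[:pCons a p:]:]"
      by (simp add: hom nested_Cst nested_Var)
    then show ?case by blast
  qed
  have 2: "\<exists>F. nested F = [:f:]" for f
  proof (induction f)
    case 0 then show ?case using hom by (intro exI[of _ 0]) simp
  next
    case (pCons a p)
    then obtain F where "nested F = [:p:]" by blast
    moreover obtain A where "nested A = [:[:a:]:]" using 1 by blast
    ultimately have "nested (A + Var 2 * F) = [:pCons a p:]"
      by (simp add: hom nested_Var)
    then show ?case by blast
  qed
  show ?thesis
  proof (induction p)
    case 0 then show ?case using hom by (intro exI[of _ 0]) simp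
  next
    case (pCons a p)
    then obtain F where "nested F = p" by blast
    moreover obtain A where "nested A = [:a:]" using 2 by blast
    ultimately have "nested (A + Var 3 * F) = pCons a p"
      by (simp add: hom nested_Var)
    then show ?case by blast
  qed
qed

lemma nested_eq_0_iff: "nested F = 0 \<longleftrightarrow> F = 0"
proof
  assume F: "nested F = 0"
  show "F = 0"
  proof (rule form_eq_zeroI)
    fix v :: "complex^3"
    define g where "g p = poly (poly (poly p [:[:v $ 3:]:]) [:v $ 2:]) (v $ 1)" for p
    have g: "is_ring_hom g" unfolding g_def by (simp add: is_ring_hom_def)
    have "is_ring_hom (\<lambda>F. g (nested F))" by (intro is_ring_hom_comp[OF g] is_ring_hom_nested)
    then have "g (nested F) = ev F v"
    proof (rule hom_eq_on_cpoly[OF _ is_ring_hom_eval])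
      fix i :: 3
      show "g (nested (Var i)) = ev (Var i) v"
        using exhaust_3[of i] by (auto simp: g_def nested_Var)
    qed (simp add: g_def nested_Cst)
    then show "ev F v = 0" using F by (simp add: g_def)
  qed
qed (simp add: hom_zero[OF is_ring_hom_nested])

lemma nested_inj: "nested F = nested G \<Longrightarrow> F = G"
  using nested_eq_0_iff[of "F - G"] by (simp add: hom_diff[OF is_ring_hom_nested])

lemma nested_dvd_iff: "nested F dvd nested G \<longleftrightarrow> F dvd G"
proof
  assume "nested F dvd nested G"
  then obtain p where "nested G = nested F * p" by (elim dvdE)
  moreover obtain H where "nested H = p" using nested_surj by blast
  ultimately have "nested G = nested (F * H)" by (simp add: hom_mult[OF is_ring_hom_nested])
  from nested_inj[OF this] show "F dvd G" by simp
qed (rule hom_dvd[OF is_ring_hom_nested])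

lemma nested_dvd_1_iff: "nested F dvd 1 \<longleftrightarrow> F dvd 1"
  using nested_dvd_iff[of F 1] by (simp add: hom_one[OF is_ring_hom_nested])

lemma cpoly_prime_divisor_exists:
  fixes F :: "3 cpoly"
  assumes "F \<noteq> 0" "\<not> F dvd 1"
  shows "\<exists>q. prime_elem q \<and> q dvd F"
proof -
  obtain b where b: "b dvd nested F" "prime b"
    using prime_divisor_exists[of "nested F"] assms by (auto simp: nested_eq_0_iff nested_dvd_1_iff)
  obtain q where q: "nested q = b" using nested_surj by blast
  have "prime_elem b" using b by (simp add: prime_def)
  have "prime_elem q"
  proof (rule prime_elemI)
    show "q \<noteq> 0" using \<open>prime_elem b\<close> q nested_eq_0_iff[of q] by (auto simp: prime_elem_def)
    show "\<not> q dvd 1" using \<open>prime_elem b\<close> q nested_dvd_1_iff[of q] by (auto simp: prime_elem_def)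
    fix F G assume "q dvd F * G"
    then have "b dvd nested F * nested G"
      using hom_dvd[OF is_ring_hom_nested, of q "F * G"] q by (simp add: hom_mult[OF is_ring_hom_nested])
    from prime_elem_dvd_multD[OF \<open>prime_elem b\<close> this]
    show "q dvd F \<or> q dvd G" unfolding q[symmetric] nested_dvd_iff .
  qed
  moreover have "q dvd F" using b(1) unfolding q[symmetric] nested_dvd_iff .
  ultimately show ?thesis by blast
qed

section \<open>Dimension counts\<close>

text \<open>The spaces of interest lie in a space of infinite dimension, hence the assumption that they are
  contained in the span of a finite set.\<close>

context vector_space
begin

lemma span_Un_image:
  assumes "x \<in> span (K \<union> f ` I)" "finite I"
  shows "\<exists>k\<in>span K. \<exists>c. x = k + (\<Sum>i\<in>I. scale (c i) (f i))"
proof -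
  define S where "S = {k + (\<Sum>i\<in>I. scale (c i) (f i)) | k c. k \<in> span K}"
  have S: "k + (\<Sum>i\<in>I. scale (c i) (f i)) \<in> S" if "k \<in> span K" for k c
    using that by (auto simp: S_def)
  have "subspace S"
  proof (rule subspaceI)
    show "0 \<in> S" using S[of 0 "\<lambda>_. 0"] by (simp add: span_zero)
  next
    fix x y assume "x \<in> S" "y \<in> S"
    then obtain k c l e where *: "k \<in> span K" "l \<in> span K" 
      "x = k + (\<Sum>i\<in>I. scale (c i) (f i))" "y = l + (\<Sum>i\<in>I. scale (e i) (f i))" 
      by (auto simp: S_def)
    show "x + y \<in> S" using S[of "k + l" "\<lambda>i. c i + e i"] * 
      by (simp add: span_add sum.distrib scale_left_distrib algebra_simps)
  next
    fix a x assume "x \<in> S"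
    then obtain k c where *: "k \<in> span K" "x = k + (\<Sum>i\<in>I. scale (c i) (f i))" by (auto simp: S_def)
    show "scale a x \<in> S" using S[of "scale a k" "\<lambda>i. a * c i"] *
      by (simp add: span_scale scale_sum_right scale_right_distrib)
  qed
  moreover have "K \<union> f ` I \<subseteq> S"
  proof (intro Un_least subsetI)
    fix x assume "x \<in> K" then show "x \<in> S" using S[of x "\<lambda>_. 0"] by (simp add: span_base)
  next
    fix x assume "x \<in> f ` I"
    then obtain i where "i \<in> I" "x = f i" by auto
    moreover have "(\<Sum>j\<in>I. scale (if j = i then 1 else 0) (f j)) = (\<Sum>j\<in>I. if j = i then f j else 0)"
      by (intro sum.cong) auto
    ultimately show "x \<in> S" using S[of 0 "\<lambda>j. if j = i then 1 else 0"] \<open>finite I\<close>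
      by (simp add: span_zero)
  qed
  ultimately have "span (K \<union> f ` I) \<subseteq> S" by (intro span_minimal)
  then have "x \<in> S" using assms(1) by (rule subsetD)
  then show ?thesis unfolding S_def by blast
qed

lemma independent_card_le_dim_of_span:
  assumes "independent B" "B \<subseteq> V" "V \<subseteq> span W" "finite W"
  shows "finite B" "card B \<le> dim V"
proof -
  obtain C where C: "C \<subseteq> V" "independent C" "V \<subseteq> span C" "card C = dim V"
    by (rule basis_exists[of "V"])
  have "finite C" using independent_span_bound[OF \<open>finite W\<close> C(2)] C(1) assms by blast
  then show "finite B" "card B \<le> dim V" 
    using independent_span_bound[of C B] C assms by auto
qed

text \<open>Vectors of \<open>V\<close> that are linearly independent modulo \<open>K\<close> extend a basis of \<open>K\<close>.\<close>

lemma dim_add_card_le: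
  assumes "finite I" "K \<subseteq> V" "f ` I \<subseteq> V" "V \<subseteq> span W" "finite W"
    and indep: "\<And>c i. (\<Sum>i\<in>I. c i *s f i) \<in> span K \<Longrightarrow> i \<in> I \<Longrightarrow> c i = 0"
  shows "dim K + card I \<le> dim V"
proof -
  obtain B where B: "B \<subseteq> K" "independent B" "K \<subseteq> span B" "card B = dim K"
    by (rule basis_exists[of "K"])
  have finB: "finite B" 
    using independent_card_le_dim_of_span(1)[OF B(2) _ assms(4,5)] B(1) assms(2) by blast
  have spB: "span B = span K"
    using B(1,3) by (metis span_eq span_superset subset_trans)
  have "independent (B \<union> f ` J) \<and> card (B \<union> f ` J) = card B + card J" if "J \<subseteq> I" for J
    using finite_subset[OF that \<open>finite I\<close>] that
  proof (induction J)
    case empty then show ?case using B by simp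
  next
    case (insert j J)
    have "f j \<notin> span (B \<union> f ` J)"
    proof
      assume "f j \<in> span (B \<union> f ` J)"
      then obtain k c where k: "k \<in> span B" "f j = k + (\<Sum>i\<in>J. c i *s f i)"
        using span_Un_image insert.hyps by blast
      define c' where "c' i = (if i = j then 1 else if i \<in> J then - c i else 0)" for i
      have "(\<Sum>i\<in>I. c' i *s f i) = (\<Sum>i\<in>insert j J. c' i *s f i)"
        using insert.prems \<open>finite I\<close> by (intro sum.mono_neutral_right) (auto simp: c'_def)
      also have "\<dots> = f j + (\<Sum>i\<in>J. c' i *s f i)" using insert.hyps by (simp add: c'_def)
      also have "(\<Sum>i\<in>J. c' i *s f i) = (\<Sum>i\<in>J. - (c i *s f i))"
        using insert.hyps by (intro sum.cong) (auto simp: c'_def)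
      also have "f j + \<dots> = k" using k(2) by (simp add: sum_negf)
      finally have "c' j = 0" using indep[of c' j] k(1) spB insert.prems by auto
      then show False by (simp add: c'_def)
    qed
    moreover from this have "f j \<notin> B \<union> f ` J" by (rule contra_subsetD[OF span_superset])
    moreover have "independent (B \<union> f ` J)" "card (B \<union> f ` J) = card B + card J"
      using insert by auto
    ultimately have "independent (insert (f j) (B \<union> f ` J))" 
      "card (insert (f j) (B \<union> f ` J)) = card B + card J + 1"
      using finB insert.hyps(1) by (simp_all add: independent_insertI)
    then show ?case using insert.hyps by simp
  qed
  from this[of I] have "independent (B \<union> f ` I)" "card (B \<union> f ` I) = card B + card I" by auto
  then show ?thesis
    using independent_card_le_dim_of_span(2)[of "B \<union> f ` I" V W] B(1,4) assms(2-5) by auto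
qed

lemma dim_mono_of_span:
  assumes "K \<subseteq> V" "V \<subseteq> span W" "finite W" shows "dim K \<le> dim V"
  using dim_add_card_le[of "{}" K V] assms by simp

text \<open>If \<open>f\<close> maps \<open>U\<close> to \<open>V\<close> and only elements of \<open>K'\<close> to \<open>K\<close>, then \<open>f\<close> induces an injection of \<open>U / K'\<close> into \<open>V / K\<close>.
  This form of the dimension formula avoids quotients and serves for all comparisons below.\<close>

lemma dim_le_preimage:
  assumes sub: "subspace K'" "subspace K" "K' \<subseteq> U" "K \<subseteq> V" "f ` U \<subseteq> V"
    and fin: "U \<subseteq> span W'" "finite W'" "V \<subseteq> span W" "finite W" and "subspace U"
    and lin: "\<And>x y. f (x + y) = f x + f y" "\<And>c x. f (scale c x) = scale c (f x)"
    and pre: "\<And>x. x \<in> U \<Longrightarrow> f x \<in> K \<Longrightarrow> x \<in> K'"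
  shows "dim K + dim U \<le> dim V + dim K'"
proof -
  obtain B' where B': "B' \<subseteq> K'" "independent B'" "K' \<subseteq> span B'" "card B' = dim K'"
    by (rule basis_exists[of "K'"])
  have "B' \<subseteq> U" using B'(1) sub(3) by (rule subset_trans)
  from maximal_independent_subset_extend[OF this B'(2)]
  obtain B where B: "B' \<subseteq> B" "B \<subseteq> U" "independent B" "U \<subseteq> span B"
    by metis
  have finB: "finite B" "finite B'"
    using independent_card_le_dim_of_span(1)[OF B(3,2) fin(1,2)] B(1) finite_subset by auto
  have dimU: "dim U = card B" using basis_card_eq_dim[OF B(2,4,3)] by simp
  have f0: "f 0 = 0" using lin(1)[of 0 0] by simp
  have fsum: "f (sum g A) = (\<Sum>i\<in>A. f (g i))" for g and A :: "'b set"
    by (induction A rule: infinite_finite_induct) (auto simp: f0 lin)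
  have "dim K + card (B - B') \<le> dim V"
  proof (rule dim_add_card_le[of _ K V f W])
    fix c i assume c: "(\<Sum>i\<in>B - B'. c i *s f i) \<in> span K" "i \<in> B - B'"
    define x where "x = (\<Sum>i\<in>B - B'. c i *s i)"
    have "f x \<in> K" using c(1) sub(2) by (simp add: x_def fsum lin span_eq_iff[THEN iffD2])
    moreover have "x \<in> U" unfolding x_def using B(2) \<open>subspace U\<close>
      by (intro subspace_sum subspace_scale) auto
    ultimately have "x \<in> span B'" using pre B' by blast
    then obtain u where u: "x = (\<Sum>v\<in>B'. u v *s v)" using span_finite[OF finB(2)] by auto
    define c' where "c' v = (if v \<in> B' then - u v else c v)" for v
    have "(\<Sum>v\<in>B. c' v *s v) = (\<Sum>v\<in>B'. c' v *s v) + (\<Sum>v\<in>B - B'. c' v *s v)"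
      using sum.subset_diff[OF B(1) finB(1), of "\<lambda>v. c' v *s v"] by (simp add: add.commute)
    also have "(\<Sum>v\<in>B'. c' v *s v) = - x" unfolding u by (simp add: c'_def sum_negf)
    also have "(\<Sum>v\<in>B - B'. c' v *s v) = x" unfolding x_def by (intro sum.cong) (auto simp: c'_def)
    finally have "c' i = 0" using independentD[OF B(3) finB(1), of c' i] c(2) by simp
    then show "c i = 0" using c(2) by (simp add: c'_def)
  next
    show "f ` (B - B') \<subseteq> V" using B(2) sub(5) by blast
  qed (use sub(4) fin finB in simp_all)
  moreover have "card B = card B' + card (B - B')"
    using B(1) finB by (metis card_Diff_subset card_mono le_add_diff_inverse)
  ultimately show ?thesis using dimU B'(4) by simp
qed

lemma dim_le_kernel_add_card:
  assumes "finite I" "subspace V" "V \<subseteq> span W" "finite W"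
    and add: "\<And>i x y. \<phi> i (x + y) = \<phi> i x + \<phi> i y" and scale: "\<And>i c x. \<phi> i (scale c x) = c * \<phi> i x"
  shows "dim V \<le> dim {x\<in>V. \<forall>i\<in>I. \<phi> i x = 0} + card I"
  using assms(1)
proof (induction I)
  case (insert j I)
  let ?V0 = "{x\<in>V. \<forall>i\<in>I. \<phi> i x = 0}" and ?V1 = "{x\<in>V. \<forall>i\<in>insert j I. \<phi> i x = 0}"
  have "dim ?V0 \<le> dim ?V1 + 1"
  proof (cases "?V1 = ?V0")
    case False
    then obtain f where f: "f \<in> ?V0" "\<phi> j f \<noteq> 0" by auto
    obtain B where B: "B \<subseteq> ?V1" "independent B" "?V1 \<subseteq> span B" "card B = dim ?V1"
      by (rule basis_exists[of "?V1"])
    have finB: "finite B" 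
      using independent_card_le_dim_of_span(1)[OF B(2) _ assms(3,4)] B(1) by blast
    have "?V0 \<subseteq> span (insert f B)"
    proof
      fix x assume x: "x \<in> ?V0"
      define k where "k = \<phi> j x / \<phi> j f"
      have d: "\<phi> i (x - k *s f) = \<phi> i x - k * \<phi> i f" for i
        using add[of i "x - k *s f" "k *s f"] by (simp add: scale)
      have "x - k *s f \<in> ?V1"
        using x f d \<open>subspace V\<close> by (auto simp: k_def intro: subspace_diff subspace_scale)
      then have "x - k *s f \<in> span B" using B by blast
      then show "x \<in> span (insert f B)" using span_breakdown_eq by blast
    qed
    then have "dim ?V0 \<le> card (insert f B)" using finB by (intro dim_le_card) auto
    also have "\<dots> \<le> dim ?V1 + 1" using B(4) finB card_insert_le_m1[of "card B + 1" B f] by (simp add: card_insert_if)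
    finally show ?thesis .
  qed simp
  then show ?case using insert by simp
qed simp

text \<open>If the common kernel is as small as possible, then the kernel of the functionals other than \<open>\<phi> i\<close> is
  strictly larger, so \<open>\<phi> i\<close> takes a nonzero value on it.\<close>

lemma dual_family_exists:
  assumes "finite I" "subspace V" "V \<subseteq> span W" "finite W"
    and add: "\<And>i x y. \<phi> i (x + y) = \<phi> i x + \<phi> i y" and scale: "\<And>i c x. \<phi> i (scale c x) = c * \<phi> i x"
    and dim: "dim {x\<in>V. \<forall>i\<in>I. \<phi> i x = 0} + card I \<le> dim V" and "i \<in> I"
  shows "\<exists>x\<in>V. \<phi> i x = 1 \<and> (\<forall>j\<in>I - {i}. \<phi> j x = 0)"
proof -
  let ?K = "{x\<in>V. \<forall>j\<in>I - {i}. \<phi> j x = 0}"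
  have "\<exists>x\<in>?K. \<phi> i x \<noteq> 0"
  proof (rule ccontr)
    assume "\<not> ?thesis"
    then have "?K = {x\<in>V. \<forall>i\<in>I. \<phi> i x = 0}" using \<open>i \<in> I\<close> by blast
    moreover have "dim V \<le> dim ?K + card (I - {i})"
      using assms by (intro dim_le_kernel_add_card) auto
    moreover have "card (I - {i}) < card I" using assms by (intro card_Diff1_less) auto
    ultimately show False using dim by simp
  qed
  then obtain x where x: "x \<in> ?K" "\<phi> i x \<noteq> 0" by blast
  then show ?thesis using \<open>subspace V\<close>
    by (intro bexI[of _ "(1 / \<phi> i x) *s x"]) (auto simp: scale intro: subspace_scale)
qed

end

text \<open>The pairs \<open>(n, a)\<close> index the monomials \<open>x\<^sup>a y\<^sup>n\<^sup>-\<^sup>a\<close> of degree less than \<open>M\<close> in two variables, and, for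
  \<open>M = d + 1\<close>, the monomials of degree \<open>d\<close> in three variables.\<close>

definition jet_index :: "nat \<Rightarrow> (nat \<times> nat) set" where
  "jet_index M = (SIGMA n:{..<M}. {..n})"

lemma finite_jet_index [simp]: "finite (jet_index M)"
  by (simp add: jet_index_def)

lemma card_jet_index: "card (jet_index M) = M * (M + 1) div 2"
proof -
  have "card (jet_index M) = (\<Sum>n<M. n + 1)" by (simp add: jet_index_def)
  also have "\<dots> = M * (M + 1) div 2" by (induction M) auto
  finally show ?thesis .
qed

definition forms :: "nat \<Rightarrow> 3 cpoly set" where "forms d = {F. homogeneous d F}"

definition exponent :: "nat \<Rightarrow> nat \<times> nat \<Rightarrow> 3 \<Rightarrow>\<^sub>0 nat" where
  "exponent d = (\<lambda>(n, a). single 1 (d - n) + single 2 a + single 3 (n - a))"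

lemma lookup_exponent:
  "lookup (exponent d (n, a)) i = (if i = 1 then d - n else if i = 2 then a else n - a)"
  using exhaust_3[of i] by (auto simp: exponent_def lookup_add lookup_single when_def)

lemma exponent_eqI:
  assumes "(\<Sum>i\<in>UNIV. lookup \<alpha> i) = d"
  shows "\<alpha> = exponent d (lookup \<alpha> 2 + lookup \<alpha> 3, lookup \<alpha> 2)"
proof (rule poly_mapping_eqI)
  fix i :: 3
  show "lookup \<alpha> i = lookup (exponent d (lookup \<alpha> 2 + lookup \<alpha> 3, lookup \<alpha> 2)) i"
    using exhaust_3[of i] assms by (auto simp: lookup_exponent sum_3)
qed

lemma inj_on_exponent: "inj_on (exponent d) (jet_index (Suc d))"
proof (rule inj_onI, clarify)
  fix n a n' a' assume a: "(n, a) \<in> jet_index (Suc d)" "(n', a') \<in> jet_index (Suc d)"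
    "exponent d (n, a) = exponent d (n', a')"
  then have "lookup (exponent d (n, a)) i = lookup (exponent d (n', a')) i" for i by simp
  from this[of 1] this[of 2] show "n = n' \<and> a = a'" using a(1,2) by (auto simp: lookup_exponent jet_index_def)
qed

lemma exponents_eq: "{\<alpha>::3 \<Rightarrow>\<^sub>0 nat. (\<Sum>i\<in>UNIV. lookup \<alpha> i) = d} = exponent d ` jet_index (Suc d)"
proof (intro equalityI subsetI)
  fix \<alpha> :: "3 \<Rightarrow>\<^sub>0 nat" assume "\<alpha> \<in> {\<alpha>. (\<Sum>i\<in>UNIV. lookup \<alpha> i) = d}"
  then have "(\<Sum>i\<in>UNIV. lookup \<alpha> i) = d" by simp
  from exponent_eqI[OF this] this show "\<alpha> \<in> exponent d ` jet_index (Suc d)"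
    by (auto simp: jet_index_def sum_3)
next
  fix \<alpha> assume "\<alpha> \<in> exponent d ` jet_index (Suc d)"
  then show "\<alpha> \<in> {\<alpha>. (\<Sum>i\<in>UNIV. lookup \<alpha> i) = d}"
    by (auto simp: jet_index_def sum_3 lookup_exponent)
qed

definition form_basis :: "nat \<Rightarrow> 3 cpoly set" where
  "form_basis d = (\<lambda>\<alpha>. single \<alpha> 1) ` {\<alpha>. (\<Sum>i\<in>UNIV. lookup \<alpha> i) = d}"

lemma finite_form_basis [simp]: "finite (form_basis d)"
  by (simp add: form_basis_def exponents_eq)

lemma form_basis_subset: "form_basis d \<subseteq> forms d"
  by (auto simp: form_basis_def forms_def homogeneous_def)

lemma subspace_forms: "cpoly.subspace (forms d)"
  by (auto simp: cpoly.subspace_def forms_def intro: homogeneous_add homogeneous_scale)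

lemma forms_subset_span: "forms d \<subseteq> cpoly.span (form_basis d)"
proof
  fix F assume "F \<in> forms d"
  then have F: "homogeneous d F" by (simp add: forms_def)
  have s: "single \<alpha> c = cpoly_scale c (single \<alpha> 1)" for \<alpha> and c :: complex
    by (simp add: cpoly_scale_conv_mult Cst_def mult_single)
  have "(\<Sum>\<alpha>\<in>keys F. cpoly_scale (lookup F \<alpha>) (single \<alpha> 1)) \<in> cpoly.span (form_basis d)"
    using F unfolding homogeneous_def
    by (intro cpoly.span_sum cpoly.span_scale cpoly.span_base) (auto simp: form_basis_def)
  then show "F \<in> cpoly.span (form_basis d)"
    using cpoly_as_sum[of F] by (simp add: s[symmetric])
qed

lemma independent_form_basis: "cpoly.independent (form_basis d)"
proof (rule cpoly.independent_if_scalars_zero)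
  fix f x assume f: "(\<Sum>x\<in>form_basis d. cpoly_scale (f x) x) = 0" and "x \<in> form_basis d"
  then obtain \<alpha> where \<alpha>: "x = single \<alpha> 1" by (auto simp: form_basis_def)
  have "0 = lookup (\<Sum>x\<in>form_basis d. cpoly_scale (f x) x) \<alpha>" using f by simp
  also have "\<dots> = (\<Sum>y\<in>form_basis d. if y = x then f y else 0)"
    unfolding lookup_sum
    by (intro sum.cong) (auto simp: \<alpha> form_basis_def lookup_single when_def split: if_splits)
  also have "\<dots> = f x" using \<open>x \<in> form_basis d\<close> by simp
  finally show "f x = 0" by simp
qed simp

lemma cpoly_dim_zero: "cpoly.dim ({0} :: 'v cpoly set) = 0"
  using cpoly.dim_le_card[of "{0}" "{}"] by simp

lemma dim_forms: "cpoly.dim (forms d) = (d + 1) * (d + 2) div 2"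
proof -
  have "inj (\<lambda>\<alpha>. single \<alpha> (1::complex))" by (rule injI) (metis lookup_single_eq lookup_single_not_eq one_neq_zero)
  then have "card (form_basis d) = card (jet_index (Suc d))"
    unfolding form_basis_def exponents_eq using inj_on_exponent
    by (metis card_image inj_on_subset subset_UNIV)
  moreover have "form_basis d \<subseteq> forms d"
    by (auto simp: form_basis_def forms_def homogeneous_def)
  ultimately show ?thesis
    using cpoly.dim_unique[OF _ forms_subset_span independent_form_basis]
    by (simp add: card_jet_index)
qed

lemma twice_dim_forms: "2 * cpoly.dim (forms d) = (d + 1) * (d + 2)"
  by (simp add: dim_forms)

section \<open>Points and lines of the plane\<close>

definition cdot :: "complex^3 \<Rightarrow> complex^3 \<Rightarrow> complex" where
  "cdot v w = (\<Sum>i\<in>UNIV. v $ i * w $ i)"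

definition cross :: "complex^3 \<Rightarrow> complex^3 \<Rightarrow> complex^3" where
  "cross a b = vector [a$2 * b$3 - a$3 * b$2, a$3 * b$1 - a$1 * b$3, a$1 * b$2 - a$2 * b$1]"

lemma cross_nth [simp]:
  "cross a b $ 1 = a$2 * b$3 - a$3 * b$2" "cross a b $ 2 = a$3 * b$1 - a$1 * b$3"
  "cross a b $ 3 = a$1 * b$2 - a$2 * b$1"
  by (simp_all add: cross_def)

lemma vec3_eq_iff: "v = w \<longleftrightarrow> v $ 1 = w $ 1 \<and> v $ 2 = w $ 2 \<and> v $ 3 = w $ 3" for v w :: "complex^3"
  by (simp add: vec_eq_iff forall_3)

lemma cdot_3: "cdot v w = v$1 * w$1 + v$2 * w$2 + v$3 * w$3"
  by (simp add: cdot_def sum_3)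

lemma cdot_commute: "cdot v w = cdot w v"
  by (simp add: cdot_3 mult.commute)

lemma cdot_scale [simp]: "cdot (c *s v) w = c * cdot v w" "cdot v (c *s w) = c * cdot v w"
  by (simp_all add: cdot_3 algebra_simps)

lemma cdot_add [simp]: "cdot (u + v) w = cdot u w + cdot v w" "cdot w (u + v) = cdot w u + cdot w v"
  by (simp_all add: cdot_3 algebra_simps)

lemma cdot_minus [simp]: "cdot (- v) w = - cdot v w" "cdot v (- w) = - cdot v w"
  by (simp_all add: cdot_3)

lemma cdot_diff: "cdot (u - v) w = cdot u w - cdot v w"
  by (simp add: cdot_3 algebra_simps)

lemma cdot_cross [simp]: "cdot a (cross a b) = 0" "cdot b (cross a b) = 0"
  by (simp_all add: cdot_3 algebra_simps)

lemma cross_scale [simp]: "cross (c *s a) b = c *s cross a b" "cross a (c *s b) = c *s cross a b"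
  by (simp_all add: vec3_eq_iff algebra_simps)

lemma cross_self [simp]: "cross a a = 0"
  by (simp add: vec3_eq_iff)

lemma cross_add: "cross (a + b) c = cross a c + cross b c" "cross c (a + b) = cross c a + cross c b"
  by (simp_all add: vec3_eq_iff algebra_simps)

lemma cross_swap: "cross b a = - cross a b"
  by (simp add: vec3_eq_iff)

lemma cross_zero [simp]: "cross 0 a = 0" "cross a 0 = 0"
  by (simp_all add: vec3_eq_iff)

lemma cdot_cross_rotate: "cdot a (cross b c) = cdot c (cross a b)"
  by (simp add: cdot_3 algebra_simps)

lemma cross_eq_0_imp_scale:
  assumes "cross a b = 0" "a \<noteq> 0"
  shows "\<exists>c. b = c *s a"
proof -
  have e: "a$2 * b$3 = a$3 * b$2" "a$3 * b$1 = a$1 * b$3" "a$1 * b$2 = a$2 * b$1"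
    using assms(1) by (simp_all add: vec3_eq_iff)
  from assms(2) consider "a$1 \<noteq> 0" | "a$2 \<noteq> 0" | "a$3 \<noteq> 0" by (auto simp: vec3_eq_iff)
  then show ?thesis
  proof cases
    case 1 then show ?thesis using e by (intro exI[of _ "b$1 / a$1"]) (auto simp: vec3_eq_iff field_simps)
  next
    case 2 then show ?thesis using e by (intro exI[of _ "b$2 / a$2"]) (auto simp: vec3_eq_iff field_simps)
  next
    case 3 then show ?thesis using e by (intro exI[of _ "b$3 / a$3"]) (auto simp: vec3_eq_iff field_simps)
  qed
qed

lemma orthogonal_imp_scale_cross:
  assumes "cdot a w = 0" "cdot b w = 0" "cross a b \<noteq> 0"
  shows "\<exists>c. w = c *s cross a b"
proof (rule cross_eq_0_imp_scale[OF _ assms(3)])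
  have "cross (cross a b) w = cdot a w *s b - cdot b w *s a"
    by (simp add: vec3_eq_iff cdot_3 algebra_simps)
  then show "cross (cross a b) w = 0" using assms by simp
qed

lemma orthogonal_cross_imp_combination:
  assumes "cdot v (cross a b) = 0" "cross a b \<noteq> 0"
  shows "\<exists>s t. v = s *s a + t *s b"
proof -
  obtain i where i: "cross a b $ i \<noteq> 0" using assms(2) by (auto simp: vec_eq_iff)
  let ?u = "axis i 1 :: complex^3"
  have u: "cdot ?u (cross a b) = cross a b $ i"
    by (simp add: cdot_def axis_def if_distrib[of "\<lambda>x. x * _"] cong: if_cong)
  have "cdot ?u (cross v b) *s a + cdot ?u (cross a v) *s b + cdot v (cross a b) *s ?u = cdot ?u (cross a b) *s v"
    by (simp add: vec3_eq_iff cdot_3 algebra_simps)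
  then have *: "(cross a b $ i) *s v = cdot ?u (cross v b) *s a + cdot ?u (cross a v) *s b"
    using assms(1) u by simp
  have "v = (1 / cross a b $ i) *s ((cross a b $ i) *s v)" using i by simp
  then show ?thesis unfolding * by (metis vector_add_ldistrib vector_smult_assoc)
qed

text \<open>A point on the line \<open>w\<close> differs from every point off this line.\<close>

lemma cross_nonzero_if_separated:
  assumes "cdot x w = 0" "x \<noteq> 0" "cdot p w \<noteq> 0"
  shows "cross x p \<noteq> 0" "cross p x \<noteq> 0"
proof -
  show "cross x p \<noteq> 0"
  proof
    assume "cross x p = 0"
    then obtain c where "p = c *s x" using cross_eq_0_imp_scale assms(2) by blast
    then show False using assms(1,3) by simp
  qed
  then show "cross p x \<noteq> 0" using cross_swap[of x p] by auto
qed

lemma exists_cdot_nonzero: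
  assumes "w \<noteq> 0" shows "\<exists>u. cdot u w \<noteq> 0"
proof -
  obtain i where "w $ i \<noteq> 0" using assms by (auto simp: vec_eq_iff)
  then show ?thesis 
    by (intro exI[of _ "axis i 1"]) (simp add: cdot_def axis_def if_distrib[of "\<lambda>x. x * _"] cong: if_cong)
qed

lemma exists_cross_eq:
  assumes "w \<noteq> 0" shows "\<exists>a b. cross a b = w"
proof -
  from assms consider "w$1 \<noteq> 0" | "w$2 \<noteq> 0" | "w$3 \<noteq> 0" by (auto simp: vec3_eq_iff)
  then show ?thesis
  proof cases
    case 1 then show ?thesis
      by (intro exI[of _ "vector [- w$2, w$1, 0]"] exI[of _ "vector [- w$3 / w$1, 0, 1]"]) (simp add: vec3_eq_iff)
  next
    case 2 then show ?thesis
      by (intro exI[of _ "vector [0, - w$3, w$2]"] exI[of _ "vector [1, - w$1 / w$2, 0]"]) (simp add: vec3_eq_iff)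
  next
    case 3 then show ?thesis
      by (intro exI[of _ "vector [w$3, 0, - w$1]"] exI[of _ "vector [0, 1, - w$2 / w$3]"]) (simp add: vec3_eq_iff)
  qed
qed

text \<open>The functions \<open>pt\<close> and \<open>rep\<close> pass from coordinate vectors to points of the plane and back.\<close>

definition pt :: "complex^3 \<Rightarrow> cp2" where
  "pt v = Abs_cp2 (vec.span {v})"

definition rep :: "cp2 \<Rightarrow> complex^3" where
  "rep x = (SOME v. v \<in> hcoords x)"

lemma Rep_pt: "v \<noteq> 0 \<Longrightarrow> Rep_cp2 (pt v) = range (\<lambda>c. c *s v)"
proof -
  assume "v \<noteq> 0"
  then have "vec.dim (vec.span {v}) = 1"
    by (simp add: vec.dim_eq_card_independent vec.dependent_single)
  then have "Rep_cp2 (pt v) = vec.span {v}"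
    unfolding pt_def by (intro Abs_cp2_inverse) (simp del: vec.dim_span)
  then show ?thesis by (simp add: vec.span_singleton)
qed

lemma hcoords_pt: "v \<noteq> 0 \<Longrightarrow> hcoords (pt v) = {c *s v | c. c \<noteq> 0}"
  by (auto simp: hcoords_def Rep_pt)

lemma pt_in_hcoords: "v \<noteq> 0 \<Longrightarrow> v \<in> hcoords (pt v)"
  by (auto simp: hcoords_pt intro: exI[of _ 1])

lemma pt_surj: "\<exists>v. v \<noteq> 0 \<and> x = pt v"
proof -
  have R: "vec.subspace (Rep_cp2 x)" "vec.dim (Rep_cp2 x) = 1" using Rep_cp2[of x] by auto
  obtain B where B: "B \<subseteq> Rep_cp2 x" "vec.independent B" "Rep_cp2 x \<subseteq> vec.span B" "card B = vec.dim (Rep_cp2 x)"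
    by (rule vec.basis_exists)
  then obtain v where v: "B = {v}" using R(2) by (metis card_1_singletonE)
  have "v \<noteq> 0" using B(2) v by (simp add: vec.dependent_single)
  moreover have "Rep_cp2 x = vec.span {v}" using B v R(1) by (metis vec.span_subspace)
  then have "x = pt v" by (metis Rep_cp2_inverse pt_def)
  ultimately show ?thesis by blast
qed

lemma rep_in_hcoords: "rep x \<in> hcoords x"
proof -
  obtain v where "v \<noteq> 0" "x = pt v" using pt_surj by blast
  then have "v \<in> hcoords x" using pt_in_hcoords by blast
  then show ?thesis unfolding rep_def by (rule someI)
qed

lemma rep_nonzero [simp]: "rep x \<noteq> 0"
  using rep_in_hcoords[of x] by (simp add: hcoords_def)

lemma pt_scale: "v \<noteq> 0 \<Longrightarrow> c \<noteq> 0 \<Longrightarrow> pt (c *s v) = pt v"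
proof -
  assume a: "v \<noteq> 0" "c \<noteq> 0"
  have "range (\<lambda>d. d *s (c *s v)) = range (\<lambda>d. d *s v)"
  proof (intro equalityI subsetI)
    fix x assume "x \<in> range (\<lambda>d. d *s v)"
    then obtain d where "x = d *s v" by blast
    then have "x = (d / c) *s (c *s v)" using a by simp
    then show "x \<in> range (\<lambda>d. d *s (c *s v))" by blast
  qed auto
  then have "Rep_cp2 (pt (c *s v)) = Rep_cp2 (pt v)" using a by (simp add: Rep_pt)
  then show ?thesis by (simp add: Rep_cp2_inject)
qed

lemma pt_rep [simp]: "pt (rep x) = x"
proof -
  obtain v where v: "v \<noteq> 0" "x = pt v" using pt_surj by blast
  then obtain c where "c \<noteq> 0" "rep x = c *s v" using rep_in_hcoords[of x] by (auto simp: hcoords_pt)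
  then show ?thesis using v pt_scale by simp
qed

lemma rep_pt: "v \<noteq> 0 \<Longrightarrow> \<exists>c. c \<noteq> 0 \<and> rep (pt v) = c *s v"
  using rep_in_hcoords[of "pt v"] by (auto simp: hcoords_pt)

lemma hcoords_eq: "hcoords x = {c *s rep x | c. c \<noteq> 0}"
  using hcoords_pt[of "rep x"] by simp

lemma pt_eq_iff:
  assumes "v \<noteq> 0" "w \<noteq> 0" shows "pt v = pt w \<longleftrightarrow> cross v w = 0"
proof
  assume "pt v = pt w"
  then have "w \<in> hcoords (pt v)" using assms pt_in_hcoords by simp
  then show "cross v w = 0" using assms by (auto simp: hcoords_pt)
next
  assume "cross v w = 0"
  then obtain c where "w = c *s v" using cross_eq_0_imp_scale assms by blast
  then show "pt v = pt w" using assms pt_scale[of v c] by auto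
qed

lemma incident_iff: "incident x l \<longleftrightarrow> cdot (rep x) (rep l) = 0"
proof -
  have "incident x l \<longleftrightarrow> (\<forall>v\<in>hcoords x. \<forall>w\<in>hcoords l. cdot v w = 0)"
    by (simp add: incident_def cdot_def)
  also have "\<dots> \<longleftrightarrow> cdot (rep x) (rep l) = 0"
    using rep_in_hcoords[of x] rep_in_hcoords[of l] by (auto simp: hcoords_eq[of x] hcoords_eq[of l])
  finally show ?thesis .
qed

lemma incident_pt: "v \<noteq> 0 \<Longrightarrow> w \<noteq> 0 \<Longrightarrow> incident (pt v) (pt w) \<longleftrightarrow> cdot v w = 0"
  using rep_pt[of v] rep_pt[of w] by (auto simp: incident_iff)

lemma ev_rep_pt: "homogeneous d F \<Longrightarrow> v \<noteq> 0 \<Longrightarrow> ev F (rep (pt v)) = 0 \<longleftrightarrow> ev F v = 0"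
  using rep_pt[of v] by (auto simp: homogeneous_eval)

definition lin_form :: "complex^3 \<Rightarrow> 3 cpoly" where
  "lin_form w = (\<Sum>i\<in>UNIV. Cst (w $ i) * Var i)"

lemma ev_lin_form [simp]: "ev (lin_form w) v = cdot v w"
  by (simp add: lin_form_def cdot_def mult.commute)

lemma homogeneous_lin_form: "homogeneous 1 (lin_form w)"
  by (rule homogeneousI) simp

lemma lin_form_eq_0_iff [simp]: "lin_form w = 0 \<longleftrightarrow> w = 0"
proof
  assume *: "lin_form w = 0"
  have "cdot u w = 0" for u using arg_cong[OF *, of "\<lambda>F. ev F u"] by simp
  then show "w = 0" using exists_cdot_nonzero[of w] by blast
qed (auto simp: lin_form_def Cst_def)

section \<open>Multiples of a form\<close>

definition multiples :: "3 cpoly \<Rightarrow> nat \<Rightarrow> 3 cpoly set" where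
  "multiples G d = {F \<in> forms d. G dvd F}"

lemma subspace_multiples: "cpoly.subspace (multiples G d)"
  using subspace_forms[of d] unfolding cpoly.subspace_def multiples_def
  by (auto simp: cpoly_scale_conv_mult)

lemma multiples_subset: "multiples G d \<subseteq> forms d"
  by (auto simp: multiples_def)

text \<open>The cofactor of a form in a form is itself a form.\<close>

lemma multiples_eq_image:
  assumes "homogeneous e G" "G \<noteq> 0"
  shows "multiples G (e + d) = (\<lambda>Q. G * Q) ` forms d"
proof (intro equalityI subsetI)
  fix F assume "F \<in> multiples G (e + d)"
  then obtain Q where Q: "F = G * Q" "homogeneous (e + d) (G * Q)" by (auto simp: multiples_def forms_def)
  have "homogeneous d Q"
  proof (cases "Q = 0")
    case False
    then obtain a b where "homogeneous a G" "homogeneous b Q" "a + b = e + d"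
      using homogeneous_factor[OF Q(2)] assms by auto
    then show ?thesis using homogeneous_unique[OF assms(1) \<open>homogeneous a G\<close>] assms by simp
  qed simp
  then show "F \<in> (\<lambda>Q. G * Q) ` forms d" using Q by (auto simp: forms_def)
qed (auto simp: multiples_def forms_def intro: homogeneous_mult assms)

lemma not_dvd_lower_degree:
  assumes "homogeneous e G" "G \<noteq> 0" "homogeneous d F" "F \<noteq> 0" "d < e"
  shows "\<not> G dvd F"
proof
  assume "G dvd F"
  then obtain Q where Q: "F = G * Q" by auto
  then obtain a b where "homogeneous a G" "a + b = d"
    using homogeneous_factor[of d G Q] assms by auto
  then show False using homogeneous_unique[OF assms(1) \<open>homogeneous a G\<close>] assms by simp
qed

lemma dim_multiples:
  assumes "homogeneous e G" "G \<noteq> 0"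
  shows "cpoly.dim (multiples G (e + d)) = cpoly.dim (forms d)"
proof (rule antisym)
  have "cpoly.dim {0::3 cpoly} + cpoly.dim (forms d) \<le> cpoly.dim (multiples G (e + d)) + cpoly.dim {0::3 cpoly}"
  proof (rule cpoly.dim_le_preimage[where f = "\<lambda>Q. G * Q"])
    show "(\<lambda>Q. G * Q) ` forms d \<subseteq> multiples G (e + d)" using multiples_eq_image[OF assms] by simp
    show "multiples G (e + d) \<subseteq> cpoly.span (form_basis (e + d))"
      using multiples_subset forms_subset_span by (rule subset_trans)
    show "{0} \<subseteq> multiples G (e + d)" "{0} \<subseteq> forms d" by (auto simp: multiples_def forms_def)
  qed (use subspace_forms forms_subset_span assms in \<open>auto simp: cpoly_scale_conv_mult algebra_simps\<close>)
  then show "cpoly.dim (forms d) \<le> cpoly.dim (multiples G (e + d))" by (simp add: cpoly_dim_zero)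
next
  have "multiples G (e + d) \<subseteq> cpoly.span ((\<lambda>Q. G * Q) ` form_basis d)"
  proof
    fix F assume "F \<in> multiples G (e + d)"
    then obtain Q where "F = G * Q" "Q \<in> forms d" unfolding multiples_eq_image[OF assms] by blast
    moreover from this obtain u where "Q = (\<Sum>b\<in>form_basis d. cpoly_scale (u b) b)"
      using forms_subset_span[of d] cpoly.span_finite[OF finite_form_basis] by blast
    ultimately have "F = (\<Sum>b\<in>form_basis d. cpoly_scale (u b) (G * b))"
      by (simp add: sum_distrib_left cpoly_scale_conv_mult mult_ac)
    also have "\<dots> \<in> cpoly.span ((\<lambda>Q. G * Q) ` form_basis d)"
      by (intro cpoly.span_sum cpoly.span_scale cpoly.span_base imageI)
    finally show "F \<in> cpoly.span ((\<lambda>Q. G * Q) ` form_basis d)" .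
  qed
  then have "cpoly.dim (multiples G (e + d)) \<le> card ((\<lambda>Q. G * Q) ` form_basis d)"
    by (rule cpoly.dim_le_card) simp
  also have "\<dots> \<le> card (form_basis d)" by (rule card_image_le) simp
  also have "\<dots> = cpoly.dim (forms d)"
    by (rule cpoly.basis_card_eq_dim[OF form_basis_subset forms_subset_span independent_form_basis])
  finally show "cpoly.dim (multiples G (e + d)) \<le> cpoly.dim (forms d)" .
qed

section \<open>Finiteness of the intersection of plane curves\<close>

text \<open>A product of lines, each of which passes through one of the other points but not through \<open>x\<close>, filled
  up to degree \<open>d\<close> by a power of a line that misses \<open>x\<close>.\<close>

lemma separating_form:
  assumes "finite X" "x \<in> X" "card X \<le> Suc d"
  shows "\<exists>F. homogeneous d F \<and> ev F (rep x) \<noteq> 0 \<and> (\<forall>y\<in>X - {x}. ev F (rep y) = 0)"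
proof -
  have "\<exists>w. cdot (rep y) w = 0 \<and> cdot (rep x) w \<noteq> 0" if "y \<noteq> x" for y
  proof -
    have "cross (rep x) (rep y) \<noteq> 0" using that pt_eq_iff[of "rep x" "rep y"] by auto
    then obtain u where "cdot u (cross (rep x) (rep y)) \<noteq> 0" using exists_cdot_nonzero by blast
    then show ?thesis using cdot_cross_rotate[of "rep x" "rep y" u] 
      by (intro exI[of _ "cross (rep y) u"]) simp
  qed
  then obtain w where w: "\<And>y. y \<noteq> x \<Longrightarrow> cdot (rep y) (w y) = 0" "\<And>y. y \<noteq> x \<Longrightarrow> cdot (rep x) (w y) \<noteq> 0"
    by metis
  obtain u where u: "cdot (rep x) u \<noteq> 0" using exists_cdot_nonzero[of "rep x"] cdot_commute by auto
  let ?F = "(\<Prod>y\<in>X - {x}. lin_form (w y)) * lin_form u ^ (d - card (X - {x}))"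
  have "homogeneous (\<Sum>y\<in>X - {x}. 1) (\<Prod>y\<in>X - {x}. lin_form (w y))"
    by (intro homogeneous_prod homogeneous_lin_form)
  from homogeneous_mult[OF this homogeneous_power[OF homogeneous_lin_form, of "d - card (X - {x})" u]]
  have "homogeneous (card (X - {x}) + (d - card (X - {x}))) ?F" by simp
  moreover have "card (X - {x}) \<le> d" using assms by simp
  ultimately have "homogeneous d ?F" by simp
  moreover have "ev ?F (rep x) \<noteq> 0" using assms u w by auto
  moreover have "ev ?F (rep y) = 0" if "y \<in> X - {x}" for y using assms w that by auto
  ultimately show ?thesis by blast
qed

text \<open>Suppose that there are \<open>e a + 1\<close> common zeros. In large degree \<open>t\<close>, the forms that vanish at them have
  codimension \<open>e a + 1\<close>, by separation of the points. But they contain the multiples of \<open>G\<close>, and modulo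
  these the multiples of \<open>A\<close>; as \<open>G\<close> is prime and does not divide \<open>A\<close>, multiplication by \<open>A\<close> is injective
  modulo \<open>G\<close>, which leaves codimension at most \<open>e a\<close>.\<close>

theorem finite_common_zeros:
  assumes G: "prime_elem G" "homogeneous e G" and A: "homogeneous a A" "\<not> G dvd A"
  shows "finite {x. ev G (rep x) = 0 \<and> ev A (rep x) = 0}"
proof (rule ccontr)
  assume "infinite {x. ev G (rep x) = 0 \<and> ev A (rep x) = 0}"
  from infinite_arbitrarily_large[OF this, of "e * a + 1"]
  obtain X where X: "finite X" "card X = e * a + 1" "X \<subseteq> {x. ev G (rep x) = 0 \<and> ev A (rep x) = 0}"
    by blast
  have G0: "G \<noteq> 0" using G by auto
  define n where "n = e * a"
  define t where "t = e + (a + n)"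
  define W where "W = {F \<in> forms t. \<forall>x\<in>X. ev F (rep x) = 0}"
  have subW: "cpoly.subspace W"
    using subspace_forms[of t] by (auto simp: cpoly.subspace_def W_def)
  have "\<exists>F. \<forall>x\<in>X. homogeneous t (F x) \<and> ev (F x) (rep x) \<noteq> 0 \<and> (\<forall>y\<in>X - {x}. ev (F x) (rep y) = 0)"
    using separating_form[OF X(1), of _ t] X(2) by (intro bchoice ballI) (auto simp: t_def n_def)
  then obtain F where F: "\<And>x. x \<in> X \<Longrightarrow> homogeneous t (F x)" "\<And>x. x \<in> X \<Longrightarrow> ev (F x) (rep x) \<noteq> 0"
    "\<And>x y. x \<in> X \<Longrightarrow> y \<in> X \<Longrightarrow> y \<noteq> x \<Longrightarrow> ev (F x) (rep y) = 0"
    by (metis Diff_iff singletonD)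
  have 1: "cpoly.dim W + card X \<le> cpoly.dim (forms t)"
  proof (rule cpoly.dim_add_card_le[where f = F and W = "form_basis t"])
    fix c x assume c: "(\<Sum>x\<in>X. cpoly_scale (c x) (F x)) \<in> cpoly.span W" and x: "x \<in> X"
    have "cpoly.span W = W" using subW by (simp add: cpoly.span_eq_iff)
    then have "(\<Sum>x\<in>X. cpoly_scale (c x) (F x)) \<in> W" using c by (simp only:)
    then have "0 = ev (\<Sum>x\<in>X. cpoly_scale (c x) (F x)) (rep x)" unfolding W_def using x by auto
    also have "\<dots> = (\<Sum>y\<in>X. if y = x then c y * ev (F y) (rep x) else 0)"
      using F x by (simp only: cpoly_eval_simps cpoly_eval_scale) (intro sum.cong, auto)
    also have "\<dots> = c x * ev (F x) (rep x)" using x X by simp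
    finally show "c x = 0" using F x by auto
  qed (use X(1) F(1) forms_subset_span[of t] in \<open>auto simp: W_def forms_def\<close>)
  have 2: "cpoly.dim (multiples G t) + cpoly.dim (forms (e + n)) \<le> cpoly.dim W + cpoly.dim (multiples G (e + n))"
  proof (rule cpoly.dim_le_preimage[where f = "\<lambda>Q. A * Q" and W' = "form_basis (e + n)" and W = "form_basis t"])
    show "multiples G t \<subseteq> W"
    proof
      fix F assume "F \<in> multiples G t"
      then show "F \<in> W" using X(3) eval_zero_of_dvd[of G F] by (auto simp: multiples_def W_def)
    qed
    show "(\<lambda>Q. A * Q) ` forms (e + n) \<subseteq> W" 
      using X homogeneous_mult[OF A(1)] by (auto simp: forms_def W_def t_def add.left_commute)
    show "W \<subseteq> cpoly.span (form_basis t)"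
      using forms_subset_span[of t] by (auto simp: W_def)
    fix x assume "x \<in> forms (e + n)" "A * x \<in> multiples G t"
    then show "x \<in> multiples G (e + n)"
      using prime_elem_dvd_multD[OF G(1), of A x] A(2) by (auto simp: multiples_def)
  qed (use subspace_forms subspace_multiples multiples_subset forms_subset_span in 
        \<open>auto simp: cpoly_scale_conv_mult algebra_simps\<close>)
  have 3: "cpoly.dim (multiples G t) = cpoly.dim (forms (a + n))" 
      "cpoly.dim (multiples G (e + n)) = cpoly.dim (forms n)"
    using dim_multiples[OF G(2) G0] by (auto simp: t_def)
  have "2 * cpoly.dim (forms (a + n)) + 2 * cpoly.dim (forms (e + n)) + 2 * (n + 1) \<le>
     2 * cpoly.dim (forms t) + 2 * cpoly.dim (forms n)"
    using 1 2 unfolding 3 by (simp add: X n_def)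
  then show False unfolding twice_dim_forms t_def n_def by (simp add: algebra_simps)
qed

section \<open>Points of a plane curve on the lines through a point\<close>

text \<open>By homogeneity \<open>F (a + t b) = t\<^sup>e F (b + t\<^sup>-\<^sup>1 a)\<close>: exchanging the two points reverses the coefficients.\<close>

lemma coeff_along_reverse:
  fixes F :: "3 cpoly"
  assumes "homogeneous e F"
  shows "coeff (along a b F) k = (if k \<le> e then coeff (along b a F) (e - k) else 0)"
proof -
  define p where "p = along a b F"
  define q where "q = along b a F"
  define N where "N = max (degree q) e"
  define r where "r = (\<Sum>k\<le>N. monom (coeff q k) (N - k))"
  have "poly (monom 1 N * p) t = poly (monom 1 e * r) t" if "t \<noteq> 0" for t
  proof -
    have "poly p t = cpoly_eval (\<lambda>i. t * (b i + (1 / t) * a i)) F"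
      unfolding p_def poly_along using that by (simp add: algebra_simps)
    also have "\<dots> = t ^ e * poly q (1 / t)"
      unfolding q_def poly_along by (rule cpoly_eval_homogeneous_scale[OF assms])
    also have "poly q (1 / t) = (\<Sum>k\<le>N. coeff q k * (1 / t) ^ k)"
      unfolding poly_altdef N_def by (intro sum.mono_neutral_left) (auto simp: coeff_eq_0)
    finally have "t ^ N * poly p t = t ^ e * (\<Sum>k\<le>N. coeff q k * (t ^ N * (1 / t) ^ k))"
      by (simp add: sum_distrib_left mult_ac)
    also have "(\<Sum>k\<le>N. coeff q k * (t ^ N * (1 / t) ^ k)) = poly r t"
      unfolding r_def poly_sum poly_monom using that
      by (intro sum.cong) (auto simp: power_diff power_one_over field_simps)
    finally show ?thesis by (simp add: poly_monom)
  qed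
  then have "poly (monom 1 N * p - monom 1 e * r) t = 0" if "t \<noteq> 0" for t using that by simp
  then have "UNIV - {0} \<subseteq> {t. poly (monom 1 N * p - monom 1 e * r) t = 0}" by auto
  then have "infinite {t. poly (monom 1 N * p - monom 1 e * r) t = 0}"
    using infinite_remove[OF infinite_UNIV_char_0, of "0::complex"] finite_subset by blast
  then have "monom 1 N * p - monom 1 e * r = 0" using poly_roots_finite by blast
  then have "monom 1 N * p = monom 1 e * r" by simp
  then have "coeff (monom 1 N * p) (N + k) = coeff (monom 1 e * r) (N + k)" by simp
  then have "coeff p k = coeff (monom 1 e * r) (N + k)" by (simp add: coeff_monom_mult)
  also have "\<dots> = coeff r (N + k - e)" by (simp add: coeff_monom_mult N_def)
  also have "\<dots> = (\<Sum>j\<le>N. if N - j = N + k - e then coeff q j else 0)"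
    by (simp add: r_def coeff_sum)
  also have "\<dots> = (\<Sum>j\<le>N. if j = e - k \<and> k \<le> e then coeff q j else 0)"
    by (intro sum.cong) (auto simp: N_def)
  also have "\<dots> = (if k \<le> e then coeff q (e - k) else 0)"
    by (auto simp: N_def)
  finally show ?thesis by (simp add: p_def q_def)
qed

lemma degree_along_le:
  fixes F :: "3 cpoly"
  shows "homogeneous e F \<Longrightarrow> degree (along a b F) \<le> e"
  by (rule degree_le) (simp add: coeff_along_reverse)

text \<open>Taylor's formula. It shows that the coefficients are polynomial functions of \<open>a\<close>.\<close>

lemma coeff_along: "fact k * coeff (along a b F) k = cpoly_eval a ((dir_deriv b ^^ k) F)"
proof -
  have "(pderiv ^^ k) (along a b F) = along a b ((dir_deriv b ^^ k) F)"
    by (induction k) (simp_all add: pderiv_along)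
  then have "poly ((pderiv ^^ k) (along a b F)) 0 = cpoly_eval a ((dir_deriv b ^^ k) F)"
    by (simp add: poly_along)
  moreover have "fact n * coeff ((pderiv ^^ k) p) n = fact (n + k) * coeff p (n + k)" for p :: "complex poly" and n
  proof (induction k arbitrary: n)
    case (Suc k)
    have "fact n * coeff ((pderiv ^^ Suc k) p) n = fact (Suc n) * coeff ((pderiv ^^ k) p) (Suc n)"
      by (simp add: coeff_pderiv mult_ac)
    also have "\<dots> = fact (Suc n + k) * coeff p (Suc n + k)" by (rule Suc)
    finally show ?case by simp
  qed simp
  from this[of 0] have "poly ((pderiv ^^ k) p) 0 = fact k * coeff p k" for p :: "complex poly"
    by (simp add: poly_0_coeff_0)
  ultimately show ?thesis by simp
qed

lemma card_roots_of_simple_roots: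
  fixes p :: "complex poly"
  assumes "\<And>t. poly p t = 0 \<Longrightarrow> poly (pderiv p) t \<noteq> 0"
  shows "finite {t. poly p t = 0}" "card {t. poly p t = 0} = degree p"
proof -
  have p: "p \<noteq> 0" using assms[of 0] by auto
  then show fin: "finite {t. poly p t = 0}" by (rule poly_roots_finite)
  have "rsquarefree p" using assms by (auto simp: rsquarefree_roots)
  then have "smult (lead_coeff p) (\<Prod>z|poly p z = 0. [:-z, 1:]) = p"
    by (rule complex_poly_decompose_rsquarefree)
  moreover have "degree (\<Prod>z|poly p z = 0. [:-z, 1:]) = (\<Sum>z|poly p z = 0. degree [:-z, 1:])"
    by (rule degree_prod_eq_sum_degree) auto
  ultimately show "card {t. poly p t = 0} = degree p"
    using p by (metis (no_types, lifting) card_eq_sum degree_pCons_eq_if degree_smult_eq leading_coeff_0_iff 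
        one_neq_zero pCons_eq_0_iff sum.cong One_nat_def degree_0)
qed

lemma poly_along_eq_ev: "poly (along (($) a) (($) b) F) t = ev F (a + t *s b)"
proof -
  have "($) (a + t *s b) = (\<lambda>i. a $ i + t * b $ i)" by (rule ext) simp
  then show ?thesis by (simp add: poly_along)
qed

lemma line_points_bij:
  assumes G: "homogeneous e G" and c: "cross u p \<noteq> 0"
  shows "bij_betw (\<lambda>t. pt (u + t *s p)) {t. poly (along (($) u) (($) p) G) t = 0}
    {x. x \<noteq> pt p \<and> cdot (rep x) (cross u p) = 0 \<and> ev G (rep x) = 0}"
proof -
  have p0: "p \<noteq> 0" using c by auto
  have nz: "u + t *s p \<noteq> 0" for t
  proof
    assume "u + t *s p = 0"
    then have "cross (u + t *s p) p = 0" by simp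
    then show False using c by (simp add: cross_add)
  qed
  note al = poly_along_eq_ev
  show ?thesis
  proof (intro bij_betw_imageI inj_onI equalityI subsetI)
    fix t t' assume "pt (u + t *s p) = pt (u + t' *s p)"
    then have "cross (u + t *s p) (u + t' *s p) = 0" using nz pt_eq_iff by blast
    moreover have "cross (u + t *s p) (u + t' *s p) = (t' - t) *s cross u p"
      by (simp add: vec3_eq_iff algebra_simps)
    ultimately show "t = t'" using c by (simp only: vec.scale_eq_0_iff) simp
  next
    fix x assume "x \<in> (\<lambda>t. pt (u + t *s p)) ` {t. poly (along (($) u) (($) p) G) t = 0}"
    then obtain t where t: "x = pt (u + t *s p)" "ev G (u + t *s p) = 0" by (auto simp: al)
    obtain k where k: "k \<noteq> 0" "rep x = k *s (u + t *s p)" using rep_pt[OF nz] t(1) by blast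
    have "x \<noteq> pt p" unfolding t(1) using pt_eq_iff[OF nz p0] c by (simp add: cross_add)
    moreover have "cdot (rep x) (cross u p) = 0" unfolding k(2) by simp
    moreover have "ev G (rep x) = 0" unfolding k(2) by (simp only: homogeneous_eval[OF G] t(2) mult_zero_right)
    ultimately show "x \<in> {x. x \<noteq> pt p \<and> cdot (rep x) (cross u p) = 0 \<and> ev G (rep x) = 0}" by blast
  next
    fix x assume "x \<in> {x. x \<noteq> pt p \<and> cdot (rep x) (cross u p) = 0 \<and> ev G (rep x) = 0}"
    then have x: "x \<noteq> pt p" "cdot (rep x) (cross u p) = 0" "ev G (rep x) = 0" by auto
    obtain s t where st: "rep x = s *s u + t *s p" using orthogonal_cross_imp_combination[OF x(2) c] by blast
    have "s \<noteq> 0"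
    proof
      assume "s = 0"
      then have "rep x = t *s p" using st by simp
      then have "cross (rep x) p = 0" by simp
      then show False using x(1) pt_eq_iff[of "rep x" p] p0 by simp
    qed
    then have r: "rep x = s *s (u + (t / s) *s p)" using st by (simp add: vector_add_ldistrib)
    have "s ^ e * ev G (u + (t / s) *s p) = 0" using x(3) unfolding r homogeneous_eval[OF G] .
    then have "ev G (u + (t / s) *s p) = 0" using \<open>s \<noteq> 0\<close> by simp
    moreover have "x = pt (u + (t / s) *s p)" using pt_rep[of x] pt_scale[OF nz \<open>s \<noteq> 0\<close>] r by metis
    ultimately show "x \<in> (\<lambda>t. pt (u + t *s p)) ` {t. poly (along (($) u) (($) p) G) t = 0}"
      by (auto simp: al)
  qed
qed

lemma line_points_card:
  assumes G: "homogeneous e G" and c: "cross u p \<noteq> 0"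
    and simple: "\<And>t. ev G (u + t *s p) = 0 \<Longrightarrow> ev (dir_deriv (($) p) G) (u + t *s p) \<noteq> 0"
  shows "finite {x. x \<noteq> pt p \<and> cdot (rep x) (cross u p) = 0 \<and> ev G (rep x) = 0}"
    "card {x. x \<noteq> pt p \<and> cdot (rep x) (cross u p) = 0 \<and> ev G (rep x) = 0} = degree (along (($) u) (($) p) G)"
proof -
  note al = poly_along_eq_ev
  have "poly (along (($) u) (($) p) G) t = 0 \<Longrightarrow> poly (pderiv (along (($) u) (($) p) G)) t \<noteq> 0" for t
    using simple by (simp add: pderiv_along al)
  note * = card_roots_of_simple_roots[OF this]
  show "finite {x. x \<noteq> pt p \<and> cdot (rep x) (cross u p) = 0 \<and> ev G (rep x) = 0}"
    using bij_betw_finite[OF line_points_bij[OF G c]] *(1) by blast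
  show "card {x. x \<noteq> pt p \<and> cdot (rep x) (cross u p) = 0 \<and> ev G (rep x) = 0} = degree (along (($) u) (($) p) G)"
    using bij_betw_same_card[OF line_points_bij[OF G c]] *(2) by simp
qed

lemma prime_form_degree_pos:
  fixes G :: "3 cpoly"
  assumes "prime_elem G" "homogeneous e G" shows "e > 0"
proof (rule ccontr)
  assume "\<not> e > 0"
  then have h: "homogeneous 0 G" using assms(2) by simp
  have "G = Cst (ev G 0)"
  proof (rule form_eqI)
    fix v show "ev G v = ev (Cst (ev G 0)) v" using homogeneous_eval[OF h, of 0 v] by simp
  qed
  have "G \<noteq> 0" "\<not> G dvd 1" using assms by (auto simp: prime_elem_def)
  have "ev G 0 \<noteq> 0" using \<open>G = Cst (ev G 0)\<close> \<open>G \<noteq> 0\<close> by (metis Cst_def single_zero)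
  then have "Cst (ev G 0) * Cst (1 / ev G 0) = 1" by (intro cpoly_eqI) simp
  then have "Cst (ev G 0) dvd (1 :: 3 cpoly)" by (metis dvd_triv_left)
  then show False using \<open>G = Cst (ev G 0)\<close> \<open>\<not> G dvd 1\<close> by metis
qed

text \<open>Let \<open>N\<close> be the degree in \<open>t\<close> of \<open>G (v + t p)\<close> for indeterminate \<open>v\<close>. Exchanging \<open>v\<close> and \<open>p\<close> shows that
  \<open>G\<close> has multiplicity at least \<open>e - N\<close> at \<open>p\<close>. A multiple zero of \<open>G (v + t p)\<close> is a common zero of \<open>G\<close> and its
  derivative in direction \<open>p\<close>. There are only finitely many of these, and a general line through \<open>p\<close>
  avoids those different from \<open>p\<close>; on such a line there are \<open>N\<close> simple zeros.\<close>

theorem lines_through_point_count: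
  assumes G: "prime_elem G" "homogeneous e G" and p: "p \<noteq> 0"
  shows "\<exists>N\<le>e. (\<forall>v k. k < e - N \<longrightarrow> coeff (along (($) p) v G) k = 0) \<and>
    (\<exists>Q. Q \<noteq> 0 \<and> (\<forall>v. ev Q v \<noteq> 0 \<longrightarrow>
      cross v p \<noteq> 0 \<and> finite {x. x \<noteq> pt p \<and> cdot (rep x) (cross v p) = 0 \<and> ev G (rep x) = 0} \<and>
      card {x. x \<noteq> pt p \<and> cdot (rep x) (cross v p) = 0 \<and> ev G (rep x) = 0} = N))"
proof -
  have G0: "G \<noteq> 0" using G by auto
  let ?D = "\<lambda>k. (dir_deriv (($) p) ^^ k) G"
  have coeff0: "coeff (along v (($) p) G) k = 0 \<longleftrightarrow> cpoly_eval v (?D k) = 0" for v k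
    using coeff_along[of k v "($) p" G] by (metis fact_nonzero mult_eq_0_iff)
  define N where "N = Max {k. k \<le> e \<and> ?D k \<noteq> 0}"
  have fin: "finite {k. k \<le> e \<and> ?D k \<noteq> 0}" by simp
  have "0 \<in> {k. k \<le> e \<and> ?D k \<noteq> 0}" using G0 by simp
  then have "N \<in> {k. k \<le> e \<and> ?D k \<noteq> 0}" unfolding N_def using fin by (intro Max_in) auto
  then have N: "N \<le> e" "?D N \<noteq> 0" by auto
  have above: "coeff (along v (($) p) G) k = 0" if "k > N" for v k
  proof (cases "k \<le> e")
    case True
    have "?D k = 0"
    proof (rule ccontr)
      assume "?D k \<noteq> 0"
      then have "k \<le> N" unfolding N_def using fin True by (intro Max_ge) auto
      then show False using that by simp
    qed
    then show ?thesis using coeff0[of v k] by simp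
  next
    case False
    then show ?thesis using coeff_along_reverse[OF G(2)] by simp
  qed
  have mult: "coeff (along (($) p) v G) k = 0" if "k < e - N" for v k
    using coeff_along_reverse[OF G(2), of "($) p" v k] above[of "e - k" v] that by simp
  \<comment> \<open>If \<open>N = 0\<close>, the derivative in direction \<open>p\<close> is zero, and there are no zeros to be avoided.\<close>
  define Sg where "Sg = (if N = 0 then {} else {x. ev G (rep x) = 0 \<and> ev (dir_deriv (($) p) G) (rep x) = 0} - {pt p})"
  have "finite Sg"
  proof (cases "N = 0")
    case False
    then obtain n where n: "N = Suc n" by (cases N) auto
    have DG: "dir_deriv (($) p) G \<noteq> 0"
    proof
      assume "dir_deriv (($) p) G = 0"
      then have "?D N = (dir_deriv (($) p) ^^ n) 0" unfolding n funpow_Suc_right by simp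
      also have "\<dots> = 0" by (induction n) auto
      finally show False using N by simp
    qed
    have "\<not> G dvd dir_deriv (($) p) G"
      using not_dvd_lower_degree[OF G(2) G0 homogeneous_dir_deriv[OF G(2)] DG] prime_form_degree_pos[OF G] by simp
    then have "finite {x. ev G (rep x) = 0 \<and> ev (dir_deriv (($) p) G) (rep x) = 0}"
      by (rule finite_common_zeros[OF G homogeneous_dir_deriv[OF G(2)]])
    then show ?thesis by (simp add: Sg_def)
  qed (simp add: Sg_def)
  obtain a b where ab: "cross a b = p" using exists_cross_eq[OF p] by blast
  have a0: "a \<noteq> 0" using ab p by auto
  have pa: "cdot p a = 0" using ab cdot_cross(1)[of a b] by (simp add: cdot_commute)
  define Q where "Q = ?D N * lin_form a * (\<Prod>x\<in>Sg. lin_form (cross p (rep x)))"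
  have "lin_form (cross p (rep x)) \<noteq> 0" if "x \<in> Sg" for x
    using that pt_eq_iff[of p "rep x"] p by (auto simp: Sg_def split: if_splits)
  then have "(\<Prod>x\<in>Sg. lin_form (cross p (rep x))) \<noteq> 0"
    using \<open>finite Sg\<close> by (intro cpoly_prod_nonzero)
  then have Q0: "Q \<noteq> 0" using N a0 by (simp add: Q_def)
  have main: "cross v p \<noteq> 0 \<and> finite {x. x \<noteq> pt p \<and> cdot (rep x) (cross v p) = 0 \<and> ev G (rep x) = 0} \<and>
      card {x. x \<noteq> pt p \<and> cdot (rep x) (cross v p) = 0 \<and> ev G (rep x) = 0} = N" if v: "ev Q v \<noteq> 0" for v
  proof -
    have v1: "ev (?D N) v \<noteq> 0" and v2: "cdot v a \<noteq> 0" 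
      and v3: "\<And>x. x \<in> Sg \<Longrightarrow> cdot v (cross p (rep x)) \<noteq> 0"
      using v \<open>finite Sg\<close> by (auto simp: Q_def)
    have vp: "cross v p \<noteq> 0"
    proof
      assume "cross v p = 0"
      then have "cross p v = 0" using cross_swap[of p v] by simp
      then obtain k where "v = k *s p" using cross_eq_0_imp_scale p by blast
      then show False using v2 pa by simp
    qed
    have deg: "degree (along (($) v) (($) p) G) = N"
    proof (rule antisym)
      show "degree (along (($) v) (($) p) G) \<le> N" by (rule degree_le) (simp add: above)
      show "N \<le> degree (along (($) v) (($) p) G)" using v1 coeff0 by (intro le_degree) auto
    qed
    have simple: "ev (dir_deriv (($) p) G) (v + t *s p) \<noteq> 0" if t: "ev G (v + t *s p) = 0" for t
    proof
      assume d: "ev (dir_deriv (($) p) G) (v + t *s p) = 0"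
      let ?y = "v + t *s p"
      have cr: "cross ?y p \<noteq> 0" using vp by (simp add: cross_add)
      then have y0: "?y \<noteq> 0" by auto
      have "N \<noteq> 0"
      proof
        assume "N = 0"
        then have "degree (along (($) v) (($) p) G) = 0" using deg by simp
        then obtain c where c: "along (($) v) (($) p) G = [:c:]" by (metis degree_eq_zeroE)
        have "poly (along (($) v) (($) p) G) t = 0" using t by (simp add: poly_along_eq_ev)
        then have "c = 0" using c by simp
        then have "coeff (along (($) v) (($) p) G) 0 = 0" using c by simp
        then show False using coeff0 v1 \<open>N = 0\<close> by simp
      qed
      moreover have "pt ?y \<noteq> pt p" using pt_eq_iff[OF y0 p] cr by simp
      ultimately have "pt ?y \<in> Sg"
        using t d ev_rep_pt[OF G(2) y0] ev_rep_pt[OF homogeneous_dir_deriv[OF G(2)] y0] by (simp add: Sg_def)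
      from v3[OF this] obtain c where "cdot v (cross p (c *s ?y)) \<noteq> 0" using rep_pt[OF y0] by auto
      then show False by (simp add: cross_add)
    qed
    show ?thesis using line_points_card[OF G(2) vp simple] deg vp by simp
  qed
  show ?thesis using N(1) mult Q0 main by blast
qed


section \<open>Points of a plane curve on a general line\<close>

text \<open>The gradient of \<open>G\<close> maps the curve \<open>G = 0\<close> to the dual plane, where its image satisfies an equation:
  the forms of degree \<open>t\<close> in the gradient form a space whose dimension grows quadratically with \<open>t\<close>, whereas
  the dimension of the forms of degree \<open>t (e - 1)\<close> modulo multiples of \<open>G\<close> grows linearly.\<close>

theorem dual_curve_equation:
  assumes G: "prime_elem G" "homogeneous e G"
  shows "\<exists>t F. homogeneous t F \<and> F \<noteq> 0 \<and> G dvd poly_subst Cst (\<lambda>i. cpoly_pderiv i G) F"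
proof (rule ccontr)
  assume no: "\<not> ?thesis"
  have G0: "G \<noteq> 0" using G by auto
  have e: "e > 0" using prime_form_degree_pos[OF G] .
  let ?f = "poly_subst Cst (\<lambda>i. cpoly_pderiv i G)"
  \<comment> \<open>It suffices that \<open>(t + 1) (t + 2)\<close> exceeds \<open>2 e (e - 1) t + e (3 - e)\<close>.\<close>
  define t where "t = 2 * e ^ 2"
  define D where "D = t * (e - 1)"
  have hom: "homogeneous D (?f F)" if F: "homogeneous t F" for F
  proof (rule homogeneousI)
    fix c v
    have "ev (?f F) (c *s v) = cpoly_eval (\<lambda>i. c ^ (e - 1) * ev (cpoly_pderiv i G) v) F"
      by (simp add: cpoly_eval_subst homogeneous_eval[OF homogeneous_pderiv[OF G(2)]])
    also have "\<dots> = (c ^ (e - 1)) ^ t * cpoly_eval (\<lambda>i. ev (cpoly_pderiv i G) v) F"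
      by (rule cpoly_eval_homogeneous_scale[OF F])
    finally show "ev (?f F) (c *s v) = c ^ D * ev (?f F) v"
      by (simp add: cpoly_eval_subst D_def power_mult[symmetric] mult.commute)
  qed
  have main: "cpoly.dim (multiples G D) + cpoly.dim (forms t) \<le> cpoly.dim (forms D) + cpoly.dim {0::3 cpoly}"
  proof (rule cpoly.dim_le_preimage[where f = ?f and W' = "form_basis t" and W = "form_basis D"])
    show "?f ` forms t \<subseteq> forms D" using hom by (auto simp: forms_def)
    show "{0} \<subseteq> forms t" by (simp add: forms_def)
    show "?f (x + y) = ?f x + ?f y" for x y by (rule poly_subst_add[OF is_ring_hom_Cst])
    show "?f (cpoly_scale c x) = cpoly_scale c (?f x)" for c x
      by (simp add: cpoly_scale_conv_mult poly_subst_mult[OF is_ring_hom_Cst] poly_subst_Cst[OF is_ring_hom_Cst])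
    fix F assume "F \<in> forms t" "?f F \<in> multiples G D"
    then show "F \<in> {0}" using no by (auto simp: multiples_def forms_def)
  qed (use subspace_forms subspace_multiples multiples_subset forms_subset_span in auto)
  show False
  proof (cases "e = 1")
    case True
    then have "cpoly.dim (forms t) \<le> cpoly.dim (forms 0)" using main by (simp add: D_def cpoly_dim_zero)
    moreover have "cpoly.dim (forms t) = 6" "cpoly.dim (forms 0) = 1"
      using twice_dim_forms[of t] twice_dim_forms[of 0] by (simp_all add: t_def True)
    ultimately show False by simp
  next
    case False
    then obtain k where k: "e = k + 2" using e False by (intro that[of "e - 2"]) simp
    define n where "n = D - e"
    have De: "D = 2 * (k + 2) ^ 2 * (k + 1)" by (simp add: D_def t_def k)
    have "e \<le> D" unfolding De k by (simp add: power2_eq_square algebra_simps)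
    then have D: "D = e + n" by (simp add: n_def)
    have "2 * cpoly.dim (forms n) + 2 * cpoly.dim (forms t) \<le> 2 * cpoly.dim (forms D)"
      using main dim_multiples[OF G(2) G0, of n] by (simp add: D cpoly_dim_zero)
    then have "(n + 1) * (n + 2) + (t + 1) * (t + 2) \<le> (D + 1) * (D + 2)"
      by (simp only: twice_dim_forms)
    then have "int ((n + 1) * (n + 2) + (t + 1) * (t + 2)) \<le> int ((D + 1) * (D + 2))" by linarith
    moreover have "int n = 2 * (int k + 2) ^ 2 * (int k + 1) - (int k + 2)"
    proof -
      have "int D = 2 * (int k + 2) ^ 2 * (int k + 1)" unfolding De by (simp add: algebra_simps)
      then show ?thesis using D k by simp
    qed
    ultimately have "56 + (int k * 73 + (int k * (int k * 31) + int k * (int k * (int k * 4)))) \<le> 0"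
      unfolding De t_def k by (simp add: power2_eq_square algebra_simps)
    moreover have "0 \<le> int k * 73" "0 \<le> int k * (int k * 31)" "0 \<le> int k * (int k * (int k * 4))" by simp_all
    ultimately show False by linarith
  qed
qed

text \<open>A line that meets the curve \<open>G = 0\<close> with multiplicity at a point either passes through one of the
  finitely many singular points or is tangent there. The tangent lines satisfy the equation of the dual
  curve, so a general line has \<open>e\<close> simple intersection points.\<close>

theorem general_line_count:
  assumes G: "prime_elem G" "homogeneous e G"
  shows "\<exists>Q. Q \<noteq> 0 \<and> (\<forall>w. ev Q w \<noteq> 0 \<longrightarrow>
      finite {x. cdot (rep x) w = 0 \<and> ev G (rep x) = 0} \<and>
      card {x. cdot (rep x) w = 0 \<and> ev G (rep x) = 0} = e)"
proof -
  have G0: "G \<noteq> 0" using G by auto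
  have e: "e > 0" using prime_form_degree_pos[OF G] .
  let ?g = "\<lambda>i. cpoly_pderiv i G"
  obtain t F where F: "homogeneous t F" "F \<noteq> 0" "G dvd poly_subst Cst ?g F"
    using dual_curve_equation[OF G] by blast
  have "\<exists>i. ?g i \<noteq> 0"
  proof (rule ccontr)
    assume "\<nexists>i. ?g i \<noteq> 0"
    then have "ev (dir_deriv (($) v) G) v = 0" for v by (simp add: ev_dir_deriv)
    then have "ev G v = 0" for v using euler[OF G(2)] e by simp
    then show False using G0 form_eq_zeroI by blast
  qed
  then obtain i where i: "?g i \<noteq> 0" by blast
  define Sg where "Sg = {x. ev G (rep x) = 0 \<and> ev (?g i) (rep x) = 0}"
  have "\<not> G dvd ?g i"
    using not_dvd_lower_degree[OF G(2) G0 homogeneous_pderiv[OF G(2)] i] e by simp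
  then have "finite Sg"
    unfolding Sg_def by (rule finite_common_zeros[OF G homogeneous_pderiv[OF G(2)]])
  define Q where "Q = F * (\<Prod>x\<in>Sg. lin_form (rep x))"
  have "(\<Prod>x\<in>Sg. lin_form (rep x)) \<noteq> 0"
    using \<open>finite Sg\<close> by (intro cpoly_prod_nonzero) auto
  then have Q0: "Q * lin_form (axis 1 1) \<noteq> 0" using F by (simp add: Q_def)
  have main: "finite {x. cdot (rep x) w = 0 \<and> ev G (rep x) = 0} \<and>
      card {x. cdot (rep x) w = 0 \<and> ev G (rep x) = 0} = e" if w: "ev Q w \<noteq> 0" "w \<noteq> 0" for w
  proof -
    have w1: "ev F w \<noteq> 0" and w2: "\<And>x. x \<in> Sg \<Longrightarrow> cdot w (rep x) \<noteq> 0"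
      using w \<open>finite Sg\<close> by (auto simp: Q_def)
    have not_tangent: "\<not> (\<forall>i. ev (?g i) v = c * w $ i)" 
      if v: "v \<noteq> 0" "cdot v w = 0" "ev G v = 0" for v c
    proof
      assume grad: "\<forall>i. ev (?g i) v = c * w $ i"
      show False
      proof (cases "c = 0")
        case True
        then have "pt v \<in> Sg" using grad v(3) 
            ev_rep_pt[OF G(2) v(1)] ev_rep_pt[OF homogeneous_pderiv[OF G(2)] v(1)] by (simp add: Sg_def)
        from w2[OF this] obtain k where "cdot w (k *s v) \<noteq> 0" using rep_pt[OF v(1)] by auto
        then show False using v(2) by (simp add: cdot_commute)
      next
        case False
        have "0 = ev (poly_subst Cst ?g F) v" using eval_zero_of_dvd[OF F(3) v(3)] by simp
        also have "\<dots> = cpoly_eval (\<lambda>i. c * w $ i) F" using grad by (simp add: cpoly_eval_subst)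
        also have "\<dots> = c ^ t * ev F w" by (rule cpoly_eval_homogeneous_scale[OF F(1)])
        finally show False using False w1 by simp
      qed
    qed
    have not_tangent': "cdot v w = 0 \<Longrightarrow> ev G v = 0 \<Longrightarrow> cdot u w = 0 \<Longrightarrow> cross v u \<noteq> 0 \<Longrightarrow> 
        ev (dir_deriv (($) u) G) v \<noteq> 0" for u v
    proof
      assume a: "cdot v w = 0" "ev G v = 0" "cdot u w = 0" "cross v u \<noteq> 0" "ev (dir_deriv (($) u) G) v = 0"
      define gr where "gr = (\<chi> i. ev (?g i) v)"
      have "cdot u gr = 0" using a(5) by (simp add: ev_dir_deriv cdot_def gr_def)
      moreover have "cdot v gr = 0" using euler[OF G(2), of v] a(2) by (simp add: ev_dir_deriv cdot_def gr_def)
      ultimately obtain c where c: "gr = c *s cross v u" using orthogonal_imp_scale_cross a(4) by blast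
      obtain d where d: "w = d *s cross v u" using orthogonal_imp_scale_cross a by blast
      then have "d \<noteq> 0" using \<open>w \<noteq> 0\<close> by auto
      then have "gr = (c / d) *s w" using c d by simp
      then have "\<forall>i. ev (?g i) v = (c / d) * w $ i" by (metis gr_def vec_lambda_beta vector_smult_component)
      moreover have "v \<noteq> 0" using a(4) by auto
      ultimately show False using not_tangent a(1,2) by blast
    qed
    obtain a b where ab: "cross a b = w" using exists_cross_eq \<open>w \<noteq> 0\<close> by blast
    have aw: "cdot a w = 0" "cdot b w = 0" using ab by auto
    have "\<exists>s. ev G (a + s *s b) \<noteq> 0"
    proof (rule ccontr)
      assume no: "\<nexists>s. ev G (a + s *s b) \<noteq> 0"
      have "poly (along (($) a) (($) b) G) s = 0" for s
        using no by (simp add: poly_along_eq_ev del: vector_smult_lid)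
      then have "along (($) a) (($) b) G = 0" using poly_all_0_iff_0 by blast
      then have "along (($) a) (($) b) (dir_deriv (($) b) G) = 0" using pderiv_along[of "($) a" "($) b" G] by simp
      then have "poly (along (($) a) (($) b) (dir_deriv (($) b) G)) 0 = 0" by simp
      then have "ev (dir_deriv (($) b) G) a = 0" by (simp add: poly_along)
      moreover have "ev G (a + 0 *s b) = 0" using no by blast
      then have "ev G a = 0" by simp
      ultimately show False using not_tangent'[of a b] aw ab \<open>w \<noteq> 0\<close> by blast
    qed
    then obtain s where s: "ev G (a + s *s b) \<noteq> 0" by blast
    define p where "p = a + s *s b"
    have "cross b p = (-1) *s cross a b" by (simp add: p_def vec3_eq_iff algebra_simps)
    then have cr: "cross b p = (-1) *s w" by (simp only: ab)
    have c0: "cross b p \<noteq> 0" using \<open>w \<noteq> 0\<close> by (simp add: cr)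
    then have p0: "p \<noteq> 0" by auto
    have pw: "cdot p w = 0" using aw by (simp add: p_def)
    have simple: "ev (dir_deriv (($) p) G) (b + t *s p) \<noteq> 0" if "ev G (b + t *s p) = 0" for t
    proof (rule not_tangent'[OF _ that pw])
      show "cdot (b + t *s p) w = 0" using aw pw by simp
      show "cross (b + t *s p) p \<noteq> 0" using c0 by (simp add: cross_add)
    qed
    have "coeff (along (($) b) (($) p) G) e = coeff (along (($) p) (($) b) G) 0"
      using coeff_along_reverse[OF G(2), of "($) b" "($) p" e] by simp
    also have "\<dots> = poly (along (($) p) (($) b) G) 0" by (simp add: poly_0_coeff_0)
    also have "\<dots> = ev G p" by (simp add: poly_along)
    finally have "coeff (along (($) b) (($) p) G) e \<noteq> 0" using s by (simp add: p_def)
    then have deg: "degree (along (($) b) (($) p) G) = e"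
      using degree_along_le[OF G(2)] le_degree by (metis antisym)
    have "x \<noteq> pt p" if "ev G (rep x) = 0" for x
      using that ev_rep_pt[OF G(2) p0] s by (auto simp: p_def)
    then have "{x. cdot (rep x) w = 0 \<and> ev G (rep x) = 0} = 
        {x. x \<noteq> pt p \<and> cdot (rep x) (cross b p) = 0 \<and> ev G (rep x) = 0}"
      unfolding cr by auto
    then show ?thesis using line_points_card[OF G(2) c0 simple] deg by simp
  qed
  show ?thesis
  proof (intro exI[of _ "Q * lin_form (axis 1 1)"] conjI allI impI)
    fix w assume "ev (Q * lin_form (axis 1 1)) w \<noteq> 0"
    then have "ev Q w \<noteq> 0" "w \<noteq> 0" by (auto simp: cdot_3)
    from main[OF this] show "finite {x. cdot (rep x) w = 0 \<and> ev G (rep x) = 0}"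
      "card {x. cdot (rep x) w = 0 \<and> ev G (rep x) = 0} = e" by auto
  qed (rule Q0)
qed

section \<open>Local expansions and multiplicities\<close>

text \<open>The expansion of \<open>F (P + s (B + x A))\<close> as a polynomial in \<open>s\<close> whose coefficients are polynomials in \<open>x\<close>. The
  coefficient of \<open>s\<^sup>n\<close> is the homogeneous part of degree \<open>n\<close> of the Taylor expansion at \<open>P\<close> in the two
  coordinates given by \<open>A\<close> and \<open>B\<close>, dehomogenized with respect to \<open>B\<close>; so its degree is at most \<open>n\<close>. In this way
  leading forms of products are read off from the lowest coefficients of products of polynomials.\<close>

definition local_expansion :: "complex^3 \<Rightarrow> complex^3 \<Rightarrow> complex^3 \<Rightarrow> 3 cpoly \<Rightarrow> complex poly poly" where
  "local_expansion P A B = poly_subst (\<lambda>c. [:[:c:]:]) (\<lambda>i. [:[:P $ i:], [:B $ i, A $ i:]:])"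

lemma is_ring_hom_const2: "is_ring_hom (\<lambda>c::complex. [:[:c:]:])"
  by (intro is_ring_hom_comp[OF is_ring_hom_const_poly] is_ring_hom_const_poly)

lemma is_ring_hom_local_expansion: "is_ring_hom (local_expansion P A B)"
  unfolding local_expansion_def by (intro is_ring_hom_poly_subst is_ring_hom_const2)

lemma local_expansion_Cst: "local_expansion P A B (Cst c) = [:[:c:]:]"
  unfolding local_expansion_def by (rule poly_subst_Cst[OF is_ring_hom_const2])

lemma local_expansion_scale: "local_expansion P A B (cpoly_scale c F) = smult [:c:] (local_expansion P A B F)"
  by (simp add: cpoly_scale_conv_mult hom_mult[OF is_ring_hom_local_expansion] local_expansion_Cst)

text \<open>The form \<open>F\<close> in the coordinates of the basis \<open>P, A, B\<close>.\<close>

definition coordinate_form :: "complex^3 \<Rightarrow> complex^3 \<Rightarrow> complex^3 \<Rightarrow> 3 cpoly \<Rightarrow> 3 cpoly" where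
  "coordinate_form P A B = poly_subst Cst (\<lambda>i. Cst (P $ i) * Var 1 + Cst (A $ i) * Var 2 + Cst (B $ i) * Var 3)"

lemma ev_coordinate_form: "ev (coordinate_form P A B F) v = ev F (v $ 1 *s P + v $ 2 *s A + v $ 3 *s B)"
proof -
  have "($) (v $ 1 *s P + v $ 2 *s A + v $ 3 *s B) = (\<lambda>i. P $ i * v $ 1 + A $ i * v $ 2 + B $ i * v $ 3)"
    by (rule ext) (simp add: mult.commute)
  then show ?thesis by (simp add: coordinate_form_def cpoly_eval_subst)
qed

lemma homogeneous_coordinate_form: "homogeneous d F \<Longrightarrow> homogeneous d (coordinate_form P A B F)"
proof (rule homogeneousI)
  fix c and v :: "complex^3" assume F: "homogeneous d F"
  have "(c *s v) $ 1 *s P + (c *s v) $ 2 *s A + (c *s v) $ 3 *s B = c *s (v $ 1 *s P + v $ 2 *s A + v $ 3 *s B)"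
    by (simp add: vec_eq_iff algebra_simps)
  then show "ev (coordinate_form P A B F) (c *s v) = c ^ d * ev (coordinate_form P A B F) v"
    unfolding ev_coordinate_form by (simp only: homogeneous_eval[OF F])
qed

lemma prod_UNIV_3: "prod f (UNIV :: 3 set) = f 1 * f 2 * f 3"
  unfolding UNIV_3 by (simp add: mult.assoc)

lemma local_expansion_conv_coordinate_form:
  "local_expansion P A B F = poly_subst (\<lambda>c. [:[:c:]:]) 
     (\<lambda>i. if i = 1 then 1 else if i = 2 then [:0, [:0, 1:]:] else [:0, 1:]) (coordinate_form P A B F)"
  (is "_ = ?h (coordinate_form P A B F)")
proof -
  have h: "is_ring_hom ?h" by (intro is_ring_hom_poly_subst is_ring_hom_const2)
  have "?h (coordinate_form P A B F) = local_expansion P A B F"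
    unfolding coordinate_form_def poly_subst_hom[OF h] local_expansion_def
    by (rule poly_subst_cong)
       (simp_all add: hom_add[OF h] hom_mult[OF h] poly_subst_Cst[OF is_ring_hom_const2] 
         poly_subst_Var[OF is_ring_hom_const2] one_pCons)
  then show ?thesis by simp
qed

lemma coeff_local_expansion:
  assumes F: "homogeneous d F"
  shows "coeff (coeff (local_expansion P A B F) n) a = 
    (if (n, a) \<in> jet_index (Suc d) then lookup (coordinate_form P A B F) (exponent d (n, a)) else 0)"
proof -
  let ?K = "coordinate_form P A B F"
  let ?y = "\<lambda>i::3. if i = 1 then 1 else if i = 2 then [:0, [:0, 1:]:] else [:0, 1:] :: complex poly poly"
  have mv: "monomial_value ?y (exponent d (k, b)) = monom (monom 1 b) k" if "b \<le> k" for k b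
  proof -
    have "monomial_value ?y (exponent d (k, b)) = [:0, [:0, 1:]:] ^ b * [:0, 1:] ^ (k - b)"
      by (subst monomial_value_superset[of UNIV]) (simp_all add: prod_UNIV_3 lookup_exponent)
    also have "\<dots> = monom (monom 1 1) 1 ^ b * monom 1 1 ^ (k - b)"
      by (simp add: monom_altdef)
    also have "\<dots> = monom (monom 1 b) k"
      using that by (simp add: monom_power mult_monom)
    finally show ?thesis .
  qed
  have "keys ?K \<subseteq> exponent d ` jet_index (Suc d)"
    using homogeneous_coordinate_form[OF F, of P A B] 
    unfolding exponents_eq[symmetric] homogeneous_def by auto
  then have "local_expansion P A B F = (\<Sum>\<alpha>\<in>exponent d ` jet_index (Suc d). [:[:lookup ?K \<alpha>:]:] * monomial_value ?y \<alpha>)"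
    unfolding local_expansion_conv_coordinate_form
    by (intro poly_subst_superset[OF is_ring_hom_const2]) auto
  also have "\<dots> = (\<Sum>i\<in>jet_index (Suc d). [:[:lookup ?K (exponent d i):]:] * monomial_value ?y (exponent d i))"
    by (simp add: sum.reindex[OF inj_on_exponent])
  also have "\<dots> = (\<Sum>(k, b)\<in>jet_index (Suc d). monom (monom (lookup ?K (exponent d (k, b))) b) k)"
    by (intro sum.cong) (auto simp: jet_index_def mv smult_monom)
  finally have "coeff (coeff (local_expansion P A B F) n) a = 
      (\<Sum>(k, b)\<in>jet_index (Suc d). if (k, b) = (n, a) then lookup ?K (exponent d (k, b)) else 0)"
    by (simp add: coeff_sum case_prod_beta) (intro sum.cong, auto)
  also have "\<dots> = (if (n, a) \<in> jet_index (Suc d) then lookup ?K (exponent d (n, a)) else 0)"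
    unfolding case_prod_beta prod.collapse by (subst sum.delta) auto
  finally show ?thesis .
qed

lemma coeff_local_expansion_zero: 
  "homogeneous d F \<Longrightarrow> n < a \<Longrightarrow> coeff (coeff (local_expansion P A B F) n) a = 0"
  by (simp add: coeff_local_expansion jet_index_def)

lemma coeff_local_expansion_along:
  "poly (coeff (local_expansion P A B F) n) x = coeff (along (($) P) (($) (B + x *s A)) F) n"
proof -
  have map: "poly (map_poly (\<lambda>p. poly p x) q) s = poly (poly q [:s:]) x" for q :: "complex poly poly" and s
    by (induction q) (simp_all add: map_poly_pCons)
  have "poly (map_poly (\<lambda>p. poly p x) (local_expansion P A B F)) s = poly (along (($) P) (($) (B + x *s A)) F) s" for s
  proof -
    have h: "is_ring_hom (\<lambda>q. poly (poly q [:s:]) x)" by (simp add: is_ring_hom_def)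
    show ?thesis
      unfolding map local_expansion_def poly_subst_hom[OF h] poly_along cpoly_eval_conv_subst
      by (rule poly_subst_cong) (simp_all add: algebra_simps)
  qed
  then have "map_poly (\<lambda>p. poly p x) (local_expansion P A B F) = along (($) P) (($) (B + x *s A)) F"
    by (simp add: poly_eq_poly_eq_iff[symmetric] fun_eq_iff)
  then show ?thesis by (metis (no_types, lifting) coeff_map_poly poly_0)
qed

lemma local_expansion_vanish_if_along:
  assumes "\<And>v k. k < M \<Longrightarrow> coeff (along (($) P) (($) v) F) k = 0" "n < M"
  shows "coeff (local_expansion P A B F) n = 0"
proof -
  have "poly (coeff (local_expansion P A B F) n) x = 0" for x
    unfolding coeff_local_expansion_along using assms by simp
  then show ?thesis using poly_all_0_iff_0 by blast
qed

text \<open>Membership in the powers of the ideal of the point \<open>v\<close> of affine space, which makes the Leibniz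
  rule applicable to iterated derivatives.\<close>

inductive vanishes_to_order :: "complex^3 \<Rightarrow> nat \<Rightarrow> 3 cpoly \<Rightarrow> bool" for v where
  order_0: "vanishes_to_order v 0 F"
| order_Suc: "ev f v = 0 \<Longrightarrow> vanishes_to_order v M g \<Longrightarrow> vanishes_to_order v (Suc M) (f * g)"
| order_zero: "vanishes_to_order v M 0"
| order_add: "vanishes_to_order v M F \<Longrightarrow> vanishes_to_order v M G \<Longrightarrow> vanishes_to_order v M (F + G)"

lemma vanishes_to_order_mult: "vanishes_to_order v M F \<Longrightarrow> vanishes_to_order v M (h * F)"
proof (induction rule: vanishes_to_order.induct)
  case (order_Suc f M g)
  then show ?case using vanishes_to_order.order_Suc[of v f M "h * g"] by (simp add: mult_ac)
next
  case (order_add M F G)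
  then show ?case by (simp add: distrib_left vanishes_to_order.order_add)
qed (auto intro: vanishes_to_order.intros)

lemma vanishes_to_order_pderiv: "vanishes_to_order v M F \<Longrightarrow> vanishes_to_order v (M - 1) (cpoly_pderiv i F)"
proof (induction rule: vanishes_to_order.induct)
  case (order_Suc f M g)
  have "vanishes_to_order v M (f * cpoly_pderiv i g)"
  proof (cases M)
    case (Suc k)
    then show ?thesis using order_Suc by (auto intro: vanishes_to_order.order_Suc)
  qed (simp add: vanishes_to_order.order_0)
  then show ?case using vanishes_to_order_mult[OF order_Suc.hyps(2)] 
    by (simp add: cpoly_pderiv_mult vanishes_to_order.order_add)
qed (auto simp: cpoly_pderiv_add intro: vanishes_to_order.intros)

lemma vanishes_to_order_ev: "vanishes_to_order v M F \<Longrightarrow> M > 0 \<Longrightarrow> ev F v = 0"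
  by (induction rule: vanishes_to_order.induct) auto

lemma vanishes_to_order_partials:
  "vanishes_to_order v M F \<Longrightarrow> vanishes_to_order v (M - length vs) (foldr cpoly_pderiv vs F)"
proof (induction vs)
  case (Cons i vs)
  then show ?case using vanishes_to_order_pderiv[of v "M - length vs" _ i] by simp
qed simp

lemma vanishes_to_order_sum: "(\<And>i. i \<in> I \<Longrightarrow> vanishes_to_order v M (f i)) \<Longrightarrow> vanishes_to_order v M (sum f I)"
  by (induction I rule: infinite_finite_induct) (auto intro: vanishes_to_order.intros)

lemma vanishes_to_order_power_mult: 
  "ev f v = 0 \<Longrightarrow> vanishes_to_order v M g \<Longrightarrow> vanishes_to_order v (k + M) (f ^ k * g)"
  by (induction k) (auto simp: mult.assoc intro: vanishes_to_order.intros)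

lemma vanishes_to_order_mono: "vanishes_to_order v M F \<Longrightarrow> k \<le> M \<Longrightarrow> vanishes_to_order v k F"
proof (induction arbitrary: k rule: vanishes_to_order.induct)
  case (order_Suc f M g)
  then show ?case by (cases k) (auto intro: vanishes_to_order.intros)
qed (auto intro: vanishes_to_order.intros)

text \<open>In the coordinates of the basis \<open>P, A, B\<close> only monomials of degree at least \<open>M\<close> in the last two
  coordinates occur, and these two coordinates vanish at \<open>P\<close>.\<close>

theorem mult_ge_if_local_expansion:
  assumes F: "homogeneous d F" and det: "cdot P (cross A B) \<noteq> 0"
    and van: "\<And>n. n < M \<Longrightarrow> coeff (local_expansion P A B F) n = 0"
  shows "mult_ge M F (pt P)"
proof -
  define D where "D = cdot P (cross A B)"
  let ?K = "coordinate_form P A B F"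
  define l where "l i = lin_form ((1 / D) *s (if i = 1 then cross A B else if i = 2 then cross B P else cross P A))" for i :: 3
  have eq: "D *s v = cdot v (cross A B) *s P + cdot v (cross B P) *s A + cdot v (cross P A) *s B" for v
    by (simp add: D_def vec3_eq_iff cdot_3 algebra_simps)
  have l: "v = ev (l 1) v *s P + ev (l 2) v *s A + ev (l 3) v *s B" for v
  proof -
    have "v = (1 / D) *s (D *s v)" using det by (simp add: D_def)
    then show ?thesis unfolding eq by (simp add: l_def vector_add_ldistrib)
  qed
  have F_eq: "F = poly_subst Cst l ?K"
  proof (rule form_eqI)
    fix v
    have "ev (poly_subst Cst l ?K) v = cpoly_eval (\<lambda>i. P $ i * ev (l 1) v + A $ i * ev (l 2) v + B $ i * ev (l 3) v) F"
      by (simp add: coordinate_form_def cpoly_eval_subst)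
    also have "(\<lambda>i. P $ i * ev (l 1) v + A $ i * ev (l 2) v + B $ i * ev (l 3) v) = ($) v"
      by (rule ext) (subst (4) l, simp add: mult.commute)
    finally show "ev F v = ev (poly_subst Cst l ?K) v" by simp
  qed
  have order: "vanishes_to_order v M F" if v: "v = c *s P" for v c
  proof -
    have l0: "ev (l 2) v = 0" "ev (l 3) v = 0" unfolding v by (simp_all add: l_def)
    have "vanishes_to_order v M (Cst (lookup ?K \<alpha>) * monomial_value l \<alpha>)" if \<alpha>: "\<alpha> \<in> keys ?K" for \<alpha>
    proof -
      have "(\<Sum>i\<in>UNIV. lookup \<alpha> i) = d" 
        using homogeneous_coordinate_form[OF F] \<alpha> by (auto simp: homogeneous_def)
      then have ex: "\<alpha> = exponent d (lookup \<alpha> 2 + lookup \<alpha> 3, lookup \<alpha> 2)" 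
        and j: "(lookup \<alpha> 2 + lookup \<alpha> 3, lookup \<alpha> 2) \<in> jet_index (Suc d)"
        by (auto intro!: exponent_eqI simp: jet_index_def sum_3)
      have "M \<le> lookup \<alpha> 2 + lookup \<alpha> 3"
      proof (rule ccontr)
        assume "\<not> M \<le> lookup \<alpha> 2 + lookup \<alpha> 3"
        then have "coeff (coeff (local_expansion P A B F) (lookup \<alpha> 2 + lookup \<alpha> 3)) (lookup \<alpha> 2) = 0"
          using van by simp
        then have "lookup ?K \<alpha> = 0" using j ex by (simp add: coeff_local_expansion[OF F])
        then show False using \<alpha> by (simp add: in_keys_iff)
      qed
      moreover have "vanishes_to_order v (lookup \<alpha> 2 + (lookup \<alpha> 3 + 0)) (l 2 ^ lookup \<alpha> 2 * (l 3 ^ lookup \<alpha> 3 * 1))"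
        by (intro vanishes_to_order_power_mult l0 vanishes_to_order.order_0)
      then have "vanishes_to_order v (lookup \<alpha> 2 + lookup \<alpha> 3) ((Cst (lookup ?K \<alpha>) * l 1 ^ lookup \<alpha> 1) * (l 2 ^ lookup \<alpha> 2 * l 3 ^ lookup \<alpha> 3))"
        by (simp only: add_0_right mult_1_right vanishes_to_order_mult)
      moreover have "monomial_value l \<alpha> = l 1 ^ lookup \<alpha> 1 * (l 2 ^ lookup \<alpha> 2 * l 3 ^ lookup \<alpha> 3)"
        by (subst monomial_value_superset[of UNIV]) (simp_all add: prod_UNIV_3 mult.assoc)
      ultimately show ?thesis using vanishes_to_order_mono by (simp add: mult.assoc)
    qed
    then have "vanishes_to_order v M (poly_subst Cst l ?K)"
      unfolding poly_subst_def by (rule vanishes_to_order_sum)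
    then show ?thesis using F_eq by simp
  qed
  have "P \<noteq> 0" using det by (auto simp: cdot_3)
  show ?thesis unfolding mult_ge_def
  proof (intro ballI allI impI)
    fix v and vs :: "3 list" assume "v \<in> hcoords (pt P)" "length vs < M"
    then obtain c where "v = c *s P" using hcoords_pt[OF \<open>P \<noteq> 0\<close>] by auto
    from vanishes_to_order_ev[OF vanishes_to_order_partials[OF order[OF this], of vs]]
    show "ev (foldr cpoly_pderiv vs F) v = 0" using \<open>length vs < M\<close> by simp
  qed
qed

section \<open>Interpolation of jets\<close>

text \<open>Arbitrary leading monomials of order at most \<open>M\<close> are attained at each of the points, by forms that
  vanish to order greater than \<open>M\<close> at all others. The terms of higher order are not prescribed: leading
  monomials are compatible with products, complete jets are not.\<close>

definition interpolates :: "(nat \<Rightarrow> 3 cpoly \<Rightarrow> complex poly poly) \<Rightarrow> nat set \<Rightarrow> nat \<Rightarrow> nat \<Rightarrow> bool" where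
  "interpolates J R d M \<longleftrightarrow> (\<forall>j\<in>R. \<forall>n a. (n, a) \<in> jet_index (Suc M) \<longrightarrow> (\<exists>F. homogeneous d F \<and>
     (\<forall>k<n. coeff (J j F) k = 0) \<and> coeff (J j F) n = monom 1 a \<and>
     (\<forall>i\<in>R - {j}. \<forall>k\<le>M. coeff (J i F) k = 0)))"

lemma coeff_mult_low:
  fixes f g :: "'a::comm_ring_1 poly"
  assumes "\<And>k. k < m \<Longrightarrow> coeff f k = 0" "\<And>k. k < n \<Longrightarrow> coeff g k = 0"
  shows "k < m + n \<Longrightarrow> coeff (f * g) k = 0" "coeff (f * g) (m + n) = coeff f m * coeff g n"
proof -
  have z: "coeff f i * coeff g (k - i) = 0" if "k \<le> m + n" "i \<le> k" "\<not> (k = m + n \<and> i = m)" for k i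
  proof -
    have "i < m \<or> k - i < n" using that by auto
    then show ?thesis using assms by auto
  qed
  show "k < m + n \<Longrightarrow> coeff (f * g) k = 0"
    unfolding coeff_mult by (intro sum.neutral ballI z) auto
  have "coeff (f * g) (m + n) = (\<Sum>i\<le>m + n. if i = m then coeff f m * coeff g n else 0)"
    unfolding coeff_mult using z[of "m + n"] by (intro sum.cong) auto
  then show "coeff (f * g) (m + n) = coeff f m * coeff g n" by simp
qed

lemma interpolates_add:
  assumes J: "\<And>j. is_ring_hom (J j)"
    and 1: "interpolates J R d M" and 2: "interpolates J R d' M'"
  shows "interpolates J R (d + d') (M + M')"
  unfolding interpolates_def
proof (intro ballI allI impI)
  fix j n a assume j: "j \<in> R" and na: "(n, a) \<in> jet_index (Suc (M + M'))"
  \<comment> \<open>Split \<open>n\<close> and \<open>a\<close> greedily, so that \<open>b \<le> k \<le> M\<close> and \<open>a - b \<le> n - k \<le> M'\<close>.\<close>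
  define k where "k = min n M"
  define b where "b = min a k"
  have "(k, b) \<in> jet_index (Suc M)" by (auto simp: jet_index_def k_def b_def)
  then obtain F where F: "homogeneous d F" "\<And>l. l < k \<Longrightarrow> coeff (J j F) l = 0" "coeff (J j F) k = monom 1 b"
    "\<And>i l. i \<in> R - {j} \<Longrightarrow> l \<le> M \<Longrightarrow> coeff (J i F) l = 0"
    using 1 j unfolding interpolates_def by blast
  have "(n - k, a - b) \<in> jet_index (Suc M')" using na by (auto simp: jet_index_def k_def b_def)
  then obtain G where G: "homogeneous d' G" "\<And>l. l < n - k \<Longrightarrow> coeff (J j G) l = 0" 
    "coeff (J j G) (n - k) = monom 1 (a - b)"
    "\<And>i l. i \<in> R - {j} \<Longrightarrow> l \<le> M' \<Longrightarrow> coeff (J i G) l = 0"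
    using 2 j unfolding interpolates_def by blast
  have kn: "k + (n - k) = n" "b + (a - b) = a" by (auto simp: k_def b_def)
  show "\<exists>F. homogeneous (d + d') F \<and> (\<forall>k<n. coeff (J j F) k = 0) \<and> coeff (J j F) n = monom 1 a \<and>
     (\<forall>i\<in>R - {j}. \<forall>k\<le>M + M'. coeff (J i F) k = 0)"
  proof (intro exI[of _ "F * G"] conjI allI impI ballI)
    show "homogeneous (d + d') (F * G)" using F(1) G(1) by (rule homogeneous_mult)
    show "coeff (J j (F * G)) l = 0" if "l < n" for l
      unfolding hom_mult[OF J] using that kn by (intro coeff_mult_low(1)[OF F(2) G(2)]) auto
    have "coeff (J j F * J j G) (k + (n - k)) = monom 1 (b + (a - b))"
      unfolding coeff_mult_low(2)[where f = "J j F" and g = "J j G" and m = k and n = "n - k", OF F(2) G(2), simplified]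
        F(3) G(3) by (simp add: mult_monom)
    then show "coeff (J j (F * G)) n = monom 1 a"
      unfolding hom_mult[OF J] kn .
    fix i l assume i: "i \<in> R - {j}" "l \<le> M + M'"
    have 1: "coeff (J i F) l = 0" if "l < Suc M" for l using F(4)[OF i(1)] that by simp
    have 2: "coeff (J i G) l = 0" if "l < Suc M'" for l using G(4)[OF i(1)] that by simp
    show "coeff (J i (F * G)) l = 0"
      unfolding hom_mult[OF J] using i(2) by (intro coeff_mult_low(1)[OF 1 2]) auto
  qed
qed

lemma interpolates_multiple:
  assumes "\<And>j. is_ring_hom (J j)" "interpolates J R d M"
  shows "interpolates J R (Suc k * d) (Suc k * M)"
proof (induction k)
  case (Suc k)
  then show ?case using interpolates_add[OF assms(1) assms(2) Suc] by simp
qed (use assms in simp)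

text \<open>The vectors \<open>P j, A j, B j\<close> form a basis, and \<open>J j F\<close> is the expansion of \<open>F\<close> at the \<open>j\<close>-th point.\<close>

context
  fixes P A B :: "nat \<Rightarrow> complex^3" and R :: "nat set" and J :: "nat \<Rightarrow> 3 cpoly \<Rightarrow> complex poly poly"
  defines "J \<equiv> \<lambda>j. local_expansion (P j) (A j) (B j)"
  assumes det: "\<And>j. cdot (P j) (cross (A j) (B j)) \<noteq> 0" and finR: "finite R"
begin

lemma J_hom: "is_ring_hom (J j)"
  unfolding J_def by (rule is_ring_hom_local_expansion)

lemma J_add: "J j (F + G) = J j F + J j G"
  by (rule hom_add[OF J_hom])

lemma J_scale: "J j (cpoly_scale c F) = smult [:c:] (J j F)"
  unfolding J_def by (rule local_expansion_scale)

lemma coeff_J_eq_0I: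
  assumes "homogeneous d F" "\<And>a. a \<le> n \<Longrightarrow> coeff (coeff (J j F) n) a = 0"
  shows "coeff (J j F) n = 0"
proof (rule poly_eqI)
  fix a show "coeff (coeff (J j F) n) a = coeff 0 a"
    using assms(2)[of a] coeff_local_expansion_zero[OF assms(1), of n a "P j" "A j" "B j"]
    by (cases "a \<le> n") (auto simp: J_def)
qed

definition linsys_at :: "nat \<Rightarrow> (nat \<Rightarrow> nat) \<Rightarrow> 3 cpoly set" where
  "linsys_at d M = {F \<in> forms d. \<forall>j\<in>R. \<forall>n<M j. coeff (J j F) n = 0}"

lemma subspace_linsys_at: "cpoly.subspace (linsys_at d M)"
  using subspace_forms[of d] unfolding cpoly.subspace_def linsys_at_def
  by (auto simp: J_add J_scale hom_zero[OF J_hom])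

lemma linsys_at_span: "linsys_at d M \<subseteq> cpoly.span (form_basis d)"
  using forms_subset_span[of d] by (auto simp: linsys_at_def)

lemma linsys_at_eq_kernel:
  "linsys_at d M = {F \<in> forms d. \<forall>i\<in>(SIGMA j:R. jet_index (M j)). 
     (case i of (j, n, a) \<Rightarrow> coeff (coeff (J j F) n) a) = 0}"
proof -
  have "(\<forall>j\<in>R. \<forall>n<M j. coeff (J j F) n = 0) \<longleftrightarrow> (\<forall>i\<in>(SIGMA j:R. jet_index (M j)). 
     (case i of (j, n, a) \<Rightarrow> coeff (coeff (J j F) n) a) = 0)" if F: "F \<in> forms d" for F
  proof
    assume *: "\<forall>i\<in>(SIGMA j:R. jet_index (M j)). (case i of (j, n, a) \<Rightarrow> coeff (coeff (J j F) n) a) = 0"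
    show "\<forall>j\<in>R. \<forall>n<M j. coeff (J j F) n = 0"
    proof (intro ballI allI impI)
      fix j n assume "j \<in> R" "n < M j"
      then have "coeff (coeff (J j F) n) a = 0" if "a \<le> n" for a
        using bspec[OF *, of "(j, n, a)"] that by (simp add: jet_index_def)
      then show "coeff (J j F) n = 0" using F by (intro coeff_J_eq_0I[of d]) (auto simp: forms_def)
    qed
  qed (auto simp: jet_index_def)
  then show ?thesis unfolding linsys_at_def by blast
qed

lemma card_jets: "card (SIGMA j:R. jet_index (M j)) = (\<Sum>j\<in>R. M j * (M j + 1) div 2)"
  using finR by (simp add: card_jet_index)

lemma dim_linsys_at_ge:
  "cpoly.dim (forms d) \<le> cpoly.dim (linsys_at d M) + (\<Sum>j\<in>R. M j * (M j + 1) div 2)"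
  unfolding linsys_at_eq_kernel card_jets[symmetric]
  by (rule cpoly.dim_le_kernel_add_card[OF _ subspace_forms forms_subset_span])
     (use finR in \<open>auto simp: J_add J_scale split: prod.split\<close>)

text \<open>The Taylor coefficients of order at most \<open>M\<close> are then independent functionals.\<close>

lemma interpolates_if_dim:
  assumes "cpoly.dim (linsys_at d (\<lambda>_. Suc M)) + (\<Sum>j\<in>R. Suc M * (Suc M + 1) div 2) \<le> cpoly.dim (forms d)"
  shows "interpolates J R d M"
  unfolding interpolates_def
proof (intro ballI allI impI)
  fix j n a assume j: "j \<in> R" and na: "(n, a) \<in> jet_index (Suc M)"
  let ?I = "SIGMA j:R. jet_index (Suc M)"
  let ?\<phi> = "\<lambda>i F. case i of (j, n, a) \<Rightarrow> coeff (coeff (J j F) n) a"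
  have "\<exists>F\<in>forms d. ?\<phi> (j, n, a) F = 1 \<and> (\<forall>i\<in>?I - {(j, n, a)}. ?\<phi> i F = 0)"
  proof (rule cpoly.dual_family_exists[OF _ subspace_forms forms_subset_span])
    show "cpoly.dim {F \<in> forms d. \<forall>i\<in>?I. ?\<phi> i F = 0} + card ?I \<le> cpoly.dim (forms d)"
      using assms unfolding linsys_at_eq_kernel card_jets .
  qed (use finR j na in \<open>auto simp: J_add J_scale split: prod.split\<close>)
  then obtain F where F0: "F \<in> forms d" "?\<phi> (j, n, a) F = 1" "\<forall>i\<in>?I - {(j, n, a)}. ?\<phi> i F = 0"
    by blast
  then have F: "F \<in> forms d" "coeff (coeff (J j F) n) a = 1" 
    "\<And>i. i \<in> ?I - {(j, n, a)} \<Longrightarrow> ?\<phi> i F = 0"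
    by (simp, simp, blast)
  have hF: "homogeneous d F" using F(1) by (simp add: forms_def)
  have z: "coeff (J i F) k = 0" if "i \<in> R" "k \<le> M" "(i, k) \<noteq> (j, n)" for i k
  proof (rule coeff_J_eq_0I[OF hF])
    fix b assume "b \<le> k"
    then show "coeff (coeff (J i F) k) b = 0" using F(3)[of "(i, k, b)"] that by (auto simp: jet_index_def)
  qed
  show "\<exists>F. homogeneous d F \<and> (\<forall>k<n. coeff (J j F) k = 0) \<and> coeff (J j F) n = monom 1 a \<and>
     (\<forall>i\<in>R - {j}. \<forall>k\<le>M. coeff (J i F) k = 0)"
  proof (intro exI[of _ F] conjI allI impI ballI)
    show "homogeneous d F" by (rule hF)
    show "coeff (J j F) k = 0" if "k < n" for k using z[of j k] j na that by (simp add: jet_index_def)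
    show "coeff (J i F) k = 0" if "i \<in> R - {j}" "k \<le> M" for i k using z[of i k] that by auto
    show "coeff (J j F) n = monom 1 a"
    proof (rule poly_eqI)
      fix b
      show "coeff (coeff (J j F) n) b = coeff (monom 1 a) b"
      proof (cases "b \<le> n")
        case True
        then show ?thesis using F(2) F(3)[of "(j, n, b)"] j na by (auto simp: jet_index_def)
      next
        case False
        then show ?thesis using coeff_local_expansion_zero[OF hF, of n b "P j" "A j" "B j"] na
          by (auto simp: J_def jet_index_def)
      qed
    qed
  qed
qed

text \<open>The interpolating forms are independent modulo the linear system: in a combination that vanishes
  to order greater than \<open>M\<close>, the terms of lowest order at each point have distinct leading monomials.\<close>

lemma dim_linsys_at_if_interpolates:
  assumes "interpolates J R d M"
  shows "cpoly.dim (linsys_at d (\<lambda>_. Suc M)) + (\<Sum>j\<in>R. Suc M * (Suc M + 1) div 2) \<le> cpoly.dim (forms d)"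
proof -
  let ?I = "SIGMA j:R. jet_index (Suc M)"
  have "\<exists>F. \<forall>i\<in>?I. case i of (j, n, a) \<Rightarrow> homogeneous d (F i) \<and>
     (\<forall>k<n. coeff (J j (F i)) k = 0) \<and> coeff (J j (F i)) n = monom 1 a \<and>
     (\<forall>i'\<in>R - {j}. \<forall>k\<le>M. coeff (J i' (F i)) k = 0)"
    using assms unfolding interpolates_def by (intro bchoice ballI) (auto split: prod.split)
  then obtain F where F0: "\<forall>i\<in>?I. case i of (j, n, a) \<Rightarrow> homogeneous d (F i) \<and>
     (\<forall>k<n. coeff (J j (F i)) k = 0) \<and> coeff (J j (F i)) n = monom 1 a \<and>
     (\<forall>i'\<in>R - {j}. \<forall>k\<le>M. coeff (J i' (F i)) k = 0)"
    by (rule exE)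
  have F: "homogeneous d (F (j, n, a)) \<and>
     (\<forall>k<n. coeff (J j (F (j, n, a))) k = 0) \<and> coeff (J j (F (j, n, a))) n = monom 1 a \<and>
     (\<forall>i'\<in>R - {j}. \<forall>k\<le>M. coeff (J i' (F (j, n, a))) k = 0)" if "(j, n, a) \<in> ?I" for j n a
    using bspec[OF F0 that] by simp
  have finI: "finite ?I" using finR by simp
  have "cpoly.dim (linsys_at d (\<lambda>_. Suc M)) + card ?I \<le> cpoly.dim (forms d)"
  proof (rule cpoly.dim_add_card_le[where f = F and W = "form_basis d"])
    show "F ` ?I \<subseteq> forms d" using F by (auto simp: forms_def)
    fix c i assume sum: "(\<Sum>i\<in>?I. cpoly_scale (c i) (F i)) \<in> cpoly.span (linsys_at d (\<lambda>_. Suc M))" and i: "i \<in> ?I"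
    obtain j n a where jna: "i = (j, n, a)" by (cases i) auto
    have j: "j \<in> R" and na: "n \<le> M" "a \<le> n" using i by (auto simp: jna jet_index_def)
    have "cpoly.span (linsys_at d (\<lambda>_. Suc M)) = linsys_at d (\<lambda>_. Suc M)"
      using subspace_linsys_at by (simp add: cpoly.span_eq_iff)
    then have mem: "(\<Sum>i\<in>?I. cpoly_scale (c i) (F i)) \<in> linsys_at d (\<lambda>_. Suc M)" using sum by (simp only:)
    have "\<forall>a\<le>n. c (j, n, a) = 0" if "n \<le> M" for n
      using that
    proof (induction n rule: less_induct)
      case (less n)
      show ?case
      proof (intro allI impI)
        fix a assume "a \<le> n"
        then have jnaI: "(j, n, a) \<in> ?I" using j less.prems by (simp add: jet_index_def)
        have "coeff (J j (\<Sum>i\<in>?I. cpoly_scale (c i) (F i))) n = 0"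
          using mem j less.prems by (auto simp: linsys_at_def)
        then have "0 = coeff (\<Sum>i\<in>?I. smult (c i) (coeff (J j (F i)) n)) a"
          by (simp add: hom_sum[OF J_hom] J_scale coeff_sum)
        also have "\<dots> = (\<Sum>i\<in>?I. c i * coeff (coeff (J j (F i)) n) a)"
          by (simp only: coeff_sum coeff_smult)
        also have "\<dots> = (\<Sum>i\<in>?I. if i = (j, n, a) then c i else 0)"
        proof (rule sum.cong[OF refl])
          fix i assume iI: "i \<in> ?I"
          obtain j' n' a' where i: "i = (j', n', a')" by (cases i) auto
          have iI': "j' \<in> R" "n' \<le> M" "a' \<le> n'" using iI by (auto simp: i jet_index_def)
          have F': "\<And>k. k < n' \<Longrightarrow> coeff (J j' (F i)) k = 0" "coeff (J j' (F i)) n' = monom 1 a'"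
            "\<And>i' k. i' \<in> R - {j'} \<Longrightarrow> k \<le> M \<Longrightarrow> coeff (J i' (F i)) k = 0"
            using F[of j' n' a'] iI unfolding i by auto
          consider "j' \<noteq> j" | "j' = j" "n' < n" | "j' = j" "n' > n" | "j' = j" "n' = n" by linarith
          then show "c i * coeff (coeff (J j (F i)) n) a = (if i = (j, n, a) then c i else 0)"
          proof cases
            case 1 then show ?thesis using F'(3)[of j n] j less.prems by (simp add: i)
          next
            case 2 then show ?thesis using less.IH[of n'] iI' by (simp add: i)
          next
            case 3 then show ?thesis using F'(1)[of n] by (simp add: i)
          next
            case 4 then show ?thesis using F'(2) by (auto simp: i)
          qed
        qed
        also have "\<dots> = c (j, n, a)" using finI jnaI by simp
        finally show "c (j, n, a) = 0" by simp
      qed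
    qed
    then show "c i = 0" using na by (simp add: jna)
  qed (use finI forms_subset_span in \<open>auto simp: linsys_at_def\<close>)
  then show ?thesis using card_jets[of "\<lambda>_. Suc M"] by simp
qed

text \<open>Multiplication by \<open>G\<close> embeds the forms of degree \<open>K d - e\<close> with multiplicities \<open>K m + 1 - \<mu> j\<close> into those of
  degree \<open>K d\<close> with multiplicity \<open>K m + 1\<close>. Comparing their dimensions for all large \<open>K\<close> proves the claim.\<close>

theorem sum_multiplicities_le:
  assumes int: "interpolates J R d m" and "d > 0"
    and G: "homogeneous e G" "G \<noteq> 0" and mu: "\<And>j. j \<in> R \<Longrightarrow> \<mu> j \<le> e"
    and van: "\<And>j n. j \<in> R \<Longrightarrow> n < \<mu> j \<Longrightarrow> coeff (J j G) n = 0"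
    and "m > 0"
  shows "m * (\<Sum>j\<in>R. \<mu> j) \<le> d * e"
proof -
  have step: "2 * int K * (int m * (\<Sum>j\<in>R. int (\<mu> j)) - int d * int e) \<le>
      int e * (3 - int e) - (\<Sum>j\<in>R. int (\<mu> j) * (3 - int (\<mu> j)))" if K: "K > e" for K
  proof -
    obtain k where k: "K = Suc k" using K by (cases K) auto
    have i: "interpolates J R (K * d) (K * m)" unfolding k by (rule interpolates_multiple[OF J_hom int])
    have Kd: "K * d > e" "K * m > e" using K \<open>d > 0\<close> \<open>m > 0\<close> 
      by (metis mult.right_neutral mult_le_mono2 Suc_leI One_nat_def less_le_trans)+
    define N where "N j = Suc (K * m) - \<mu> j" for j
    define D where "D = K * d - e"
    have D: "K * d = e + D" using Kd by (simp add: D_def)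
    have "cpoly.dim {0::3 cpoly} + cpoly.dim (linsys_at D N) \<le> 
        cpoly.dim (linsys_at (K * d) (\<lambda>_. Suc (K * m))) + cpoly.dim {0::3 cpoly}"
    proof (rule cpoly.dim_le_preimage[where f = "\<lambda>Q. G * Q"])
      show "(\<lambda>Q. G * Q) ` linsys_at D N \<subseteq> linsys_at (K * d) (\<lambda>_. Suc (K * m))"
      proof (clarsimp simp: linsys_at_def forms_def, intro conjI ballI allI impI)
        fix Q assume Q: "homogeneous D Q" "\<forall>j\<in>R. \<forall>n<N j. coeff (J j Q) n = 0"
        show "homogeneous (K * d) (G * Q)" unfolding D using G(1) Q(1) by (rule homogeneous_mult)
        fix j n assume j: "j \<in> R" and n: "n < Suc (K * m)"
        have "\<mu> j \<le> Suc (K * m)" using mu[OF j] Kd by simp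
        then have "n < \<mu> j + N j" using n by (simp add: N_def)
        then show "coeff (J j (G * Q)) n = 0" 
          unfolding hom_mult[OF J_hom] using Q(2) van[OF j] j by (intro coeff_mult_low(1)) auto
      qed
      show "{0} \<subseteq> linsys_at (K * d) (\<lambda>_. Suc (K * m))" "{0} \<subseteq> linsys_at D N"
        using cpoly.subspace_0[OF subspace_linsys_at] by auto
      show "linsys_at D N \<subseteq> cpoly.span (form_basis D)" 
        "linsys_at (K * d) (\<lambda>_. Suc (K * m)) \<subseteq> cpoly.span (form_basis (K * d))"
        by (rule linsys_at_span)+
    qed (use subspace_linsys_at G(2) in \<open>auto simp: cpoly_scale_conv_mult algebra_simps\<close>)
    then have 1: "cpoly.dim (linsys_at D N) \<le> cpoly.dim (linsys_at (K * d) (\<lambda>_. Suc (K * m)))" by simp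
    have even: "2 * (\<Sum>j\<in>R. (f j * (f j + 1)) div 2) = (\<Sum>j\<in>R. f j * (f j + 1))" for f :: "nat \<Rightarrow> nat"
      by (simp add: sum_distrib_left)
    have "2 * cpoly.dim (forms D) + 2 * (\<Sum>j\<in>R. Suc (K * m) * (Suc (K * m) + 1) div 2) \<le> 
        2 * cpoly.dim (forms (K * d)) + 2 * (\<Sum>j\<in>R. N j * (N j + 1) div 2)"
      using dim_linsys_at_ge[of D N] 1 dim_linsys_at_if_interpolates[OF i] by linarith
    then have "(D + 1) * (D + 2) + (\<Sum>j\<in>R. Suc (K * m) * (Suc (K * m) + 1)) \<le>
        (K * d + 1) * (K * d + 2) + (\<Sum>j\<in>R. N j * (N j + 1))"
      unfolding even twice_dim_forms .
    then have "int ((D + 1) * (D + 2) + (\<Sum>j\<in>R. Suc (K * m) * (Suc (K * m) + 1))) \<le>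
        int ((K * d + 1) * (K * d + 2) + (\<Sum>j\<in>R. N j * (N j + 1)))" by linarith
    then have "(\<Sum>j\<in>R. int (Suc (K * m) * (Suc (K * m) + 1))) - (\<Sum>j\<in>R. int (N j * (N j + 1))) \<le>
        int ((K * d + 1) * (K * d + 2)) - int ((D + 1) * (D + 2))" 
      unfolding of_nat_add[of "(D + 1) * (D + 2)"] of_nat_add[of "(K * d + 1) * (K * d + 2)"] of_nat_sum 
      by linarith
    moreover have "(\<Sum>j\<in>R. int (Suc (K * m) * (Suc (K * m) + 1))) - (\<Sum>j\<in>R. int (N j * (N j + 1))) =
        (\<Sum>j\<in>R. 2 * int K * int m * int (\<mu> j) + int (\<mu> j) * (3 - int (\<mu> j)))"
      unfolding sum_subtractf[symmetric]
    proof (rule sum.cong[OF refl])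
      fix j assume "j \<in> R"
      then have Nj: "int (N j) = int K * int m + 1 - int (\<mu> j)"
        using mu[of j] Kd by (simp add: N_def of_nat_diff)
      have "int (N j * (N j + 1)) = int (N j) * (int (N j) + 1)" by (simp add: algebra_simps)
      then have "int (N j * (N j + 1)) = 
          (int K * int m + 1 - int (\<mu> j)) * (int K * int m + 1 - int (\<mu> j) + 1)"
        by (simp only: Nj)
      then show "int (Suc (K * m) * (Suc (K * m) + 1)) - int (N j * (N j + 1)) =
          2 * int K * int m * int (\<mu> j) + int (\<mu> j) * (3 - int (\<mu> j))"
        by (simp add: algebra_simps)
    qed
    moreover have "int ((K * d + 1) * (K * d + 2)) - int ((D + 1) * (D + 2)) = 
        2 * int K * int d * int e + int e * (3 - int e)"
    proof -
      have "int D = int K * int d - int e" using D by (metis add_diff_cancel_left' of_nat_add of_nat_mult)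
      moreover have "int ((D + 1) * (D + 2)) = (int D + 1) * (int D + 2)" by (simp add: algebra_simps)
      ultimately have "int ((D + 1) * (D + 2)) = (int K * int d - int e + 1) * (int K * int d - int e + 2)" 
        by (simp only:)
      then show ?thesis by (simp add: algebra_simps)
    qed
    ultimately have le: "(\<Sum>j\<in>R. 2 * int K * int m * int (\<mu> j) + int (\<mu> j) * (3 - int (\<mu> j))) \<le>
        2 * int K * int d * int e + int e * (3 - int e)"
      by (simp only:)
    have "(\<Sum>j\<in>R. 2 * int K * int m * int (\<mu> j) + int (\<mu> j) * (3 - int (\<mu> j))) =
        2 * int K * int m * (\<Sum>j\<in>R. int (\<mu> j)) + (\<Sum>j\<in>R. int (\<mu> j) * (3 - int (\<mu> j)))"
      by (simp only: sum.distrib sum_distrib_left)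
    moreover have "2 * int K * (int m * (\<Sum>j\<in>R. int (\<mu> j)) - int d * int e) = 
        2 * int K * int m * (\<Sum>j\<in>R. int (\<mu> j)) - 2 * int K * int d * int e"
      by (simp only: right_diff_distrib mult.assoc)
    ultimately show ?thesis using le by linarith
  qed
  show ?thesis
  proof (rule ccontr)
    assume "\<not> m * (\<Sum>j\<in>R. \<mu> j) \<le> d * e"
    then have "d * e + 1 \<le> m * (\<Sum>j\<in>R. \<mu> j)" by simp
    then have "int (d * e + 1) \<le> int (m * (\<Sum>j\<in>R. \<mu> j))" by (simp only: of_nat_le_iff)
    then have ge: "1 \<le> int m * (\<Sum>j\<in>R. int (\<mu> j)) - int d * int e" by simp
    define C where "C = int e * (3 - int e) - (\<Sum>j\<in>R. int (\<mu> j) * (3 - int (\<mu> j)))"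
    define K where "K = e + 1 + nat \<bar>C\<bar>"
    have "2 * int K * 1 \<le> 2 * int K * (int m * (\<Sum>j\<in>R. int (\<mu> j)) - int d * int e)"
      using ge by (intro mult_left_mono) auto
    also have "\<dots> \<le> C" unfolding C_def by (rule step) (simp add: K_def)
    finally show False by (simp add: K_def)
  qed
qed

end

section \<open>Closed subsets of products of planes\<close>

lemma two_power_eq_1: "(2::complex) ^ m = 1 \<longleftrightarrow> m = 0"
  using two_power_eq[of m 0] by simp

lemma multihomogeneousI:
  assumes "finite K"
    and "\<And>c x. cpoly_eval (\<lambda>(k, i). c k * x k i) f = (\<Prod>k\<in>K. c k ^ b k) * cpoly_eval (\<lambda>(k, i). x k i) f"
  shows "multihomogeneous K b f"
proof -
  have key: "(2::complex) ^ (\<Sum>i\<in>UNIV. lookup \<alpha> (k, i)) = (if k \<in> K then 2 ^ b k else 1)" if \<alpha>: "\<alpha> \<in> keys f" for \<alpha> k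
  proof -
    define c :: "nat \<Rightarrow> complex" where "c j = (if j = k then 2 else 1)" for j
    have "monomial_value (\<lambda>(j, i). c j) \<alpha> = (\<Prod>k\<in>K. c k ^ b k)"
    proof (rule keys_scaling[OF _ \<alpha>])
      fix x :: "nat \<times> 3 \<Rightarrow> complex"
      have "(\<lambda>v. (case v of (j, i) \<Rightarrow> c j) * x v) = (\<lambda>(k, i). c k * curry x k i)" by auto
      then show "cpoly_eval (\<lambda>v. (case v of (j, i) \<Rightarrow> c j) * x v) f = (\<Prod>k\<in>K. c k ^ b k) * cpoly_eval x f"
        using assms(2)[of c "curry x"] by simp
    qed
    also have "\<dots> = (\<Prod>j\<in>K. if j = k then 2 ^ b k else 1)" by (intro prod.cong) (auto simp: c_def)
    also have "\<dots> = (if k \<in> K then 2 ^ b k else 1)" using assms(1) by simp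
    also have "monomial_value (\<lambda>(j, i). c j) \<alpha> = (\<Prod>v\<in>keys \<alpha> \<union> {k} \<times> UNIV. (case v of (j, i) \<Rightarrow> c j) ^ lookup \<alpha> v)"
      by (rule monomial_value_superset) auto
    also have "\<dots> = (\<Prod>v\<in>{k} \<times> UNIV. (case v of (j, i) \<Rightarrow> c j) ^ lookup \<alpha> v)"
      by (rule prod.mono_neutral_right) (auto simp: c_def split: if_splits)
    also have "\<dots> = (\<Prod>i\<in>UNIV. 2 ^ lookup \<alpha> (k, i))"
    proof -
      have "{k} \<times> (UNIV :: 3 set) = Pair k ` UNIV" by auto
      then show ?thesis by (simp add: prod.reindex inj_on_def c_def)
    qed
    also have "\<dots> = 2 ^ (\<Sum>i\<in>UNIV. lookup \<alpha> (k, i))" by (simp add: power_sum)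
    finally show ?thesis .
  qed
  show ?thesis unfolding multihomogeneous_def
  proof (intro ballI conjI allI impI)
    fix \<alpha> k assume "\<alpha> \<in> keys f" "k \<in> K"
    then show "(\<Sum>i\<in>UNIV. lookup \<alpha> (k, i)) = b k" using key[of \<alpha> k] by (simp add: two_power_eq)
  next
    fix \<alpha> k i assume "\<alpha> \<in> keys f" "k \<notin> K"
    then have "(\<Sum>i\<in>UNIV. lookup \<alpha> (k, i)) = 0" using key[of \<alpha> k] by (simp add: two_power_eq_1)
    then show "lookup \<alpha> (k, i) = 0" by simp
  qed
qed

text \<open>Scaling of the coordinates in the factors. Values depend on the coordinates with index in \<open>K\<close> only.\<close>

lemma multihomogeneous_eval:
  assumes f: "multihomogeneous K b f" and "finite K" and x: "\<And>k i. k \<in> K \<Longrightarrow> x k i = c k * z k i"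
  shows "cpoly_eval (\<lambda>(k, i). x k i) f = (\<Prod>k\<in>K. c k ^ b k) * cpoly_eval (\<lambda>(k, i). z k i) f"
proof -
  have "monomial_value (\<lambda>(k, i). x k i) \<alpha> = (\<Prod>k\<in>K. c k ^ b k) * monomial_value (\<lambda>(k, i). z k i) \<alpha>"
    if \<alpha>: "\<alpha> \<in> keys f" for \<alpha>
  proof -
    have 1: "\<And>k. k \<in> K \<Longrightarrow> (\<Sum>i\<in>UNIV. lookup \<alpha> (k, i)) = b k" 
      and 2: "\<And>k i. k \<notin> K \<Longrightarrow> lookup \<alpha> (k, i) = 0" using f \<alpha> by (auto simp: multihomogeneous_def)
    have sub: "keys \<alpha> \<subseteq> K \<times> UNIV" using 2 by (auto simp: in_keys_iff)
    have mv: "monomial_value (\<lambda>(k, i). y k i) \<alpha> = (\<Prod>k\<in>K. \<Prod>i\<in>UNIV. y k i ^ lookup \<alpha> (k, i))" 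
      for y :: "nat \<Rightarrow> 3 \<Rightarrow> complex"
      using \<open>finite K\<close>
      by (subst monomial_value_superset[OF _ sub]) 
         (auto simp: prod.cartesian_product intro!: prod.cong)
    have "monomial_value (\<lambda>(k, i). x k i) \<alpha> = (\<Prod>k\<in>K. (\<Prod>i\<in>UNIV. c k ^ lookup \<alpha> (k, i)) * (\<Prod>i\<in>UNIV. z k i ^ lookup \<alpha> (k, i)))"
      unfolding mv by (intro prod.cong) (auto simp: x power_mult_distrib prod.distrib)
    also have "\<dots> = (\<Prod>k\<in>K. c k ^ b k * (\<Prod>i\<in>UNIV. z k i ^ lookup \<alpha> (k, i)))"
      by (intro prod.cong) (simp_all add: power_sum[symmetric] 1)
    finally show ?thesis by (simp add: mv prod.distrib)
  qed
  then show ?thesis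
    by (simp add: cpoly_eval_conv_subst poly_subst_def sum_distrib_left mult_ac)
qed

lemma vanishes_at_iff:
  assumes f: "multihomogeneous K b f" and K: "finite K" 
    and z: "\<And>k. k \<in> K \<Longrightarrow> z k \<noteq> 0 \<and> y k = pt (z k)"
  shows "vanishes_at K f y \<longleftrightarrow> cpoly_eval (\<lambda>(k, i). z k $ i) f = 0"
proof
  assume "vanishes_at K f y"
  moreover have "\<forall>k\<in>K. z k \<in> hcoords (y k)" using z pt_in_hcoords by auto
  ultimately show "cpoly_eval (\<lambda>(k, i). z k $ i) f = 0" by (auto simp: vanishes_at_def)
next
  assume 0: "cpoly_eval (\<lambda>(k, i). z k $ i) f = 0"
  show "vanishes_at K f y" unfolding vanishes_at_def
  proof (intro allI impI)
    fix x assume x: "\<forall>k\<in>K. x k \<in> hcoords (y k)"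
    have "\<exists>c. \<forall>k\<in>K. x k = c k *s z k"
      using x z by (intro bchoice ballI) (auto simp: hcoords_pt)
    then obtain c where "\<And>k. k \<in> K \<Longrightarrow> x k = c k *s z k" by blast
    then have "cpoly_eval (\<lambda>(k, i). x k $ i) f = (\<Prod>k\<in>K. c k ^ b k) * cpoly_eval (\<lambda>(k, i). z k $ i) f"
      by (intro multihomogeneous_eval[OF f K, where x = "\<lambda>k i. x k $ i" and z = "\<lambda>k i. z k $ i"]) simp
    then show "cpoly_eval (\<lambda>(k, i). x k $ i) f = 0" using 0 by simp
  qed
qed

lemma vanishes_at_iff_rep:
  "multihomogeneous K b f \<Longrightarrow> finite K \<Longrightarrow> vanishes_at K f y \<longleftrightarrow> cpoly_eval (\<lambda>(k, i). rep (y k) $ i) f = 0"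
  by (rule vanishes_at_iff) auto

text \<open>A form on the plane as an equation for the \<open>k\<close>-th factor.\<close>

definition at_factor :: "nat \<Rightarrow> 3 cpoly \<Rightarrow> (nat \<times> 3) cpoly" where
  "at_factor k F = poly_subst Cst (\<lambda>i. Var (k, i)) F"

lemma eval_at_factor: "cpoly_eval x (at_factor k F) = cpoly_eval (\<lambda>i. x (k, i)) F"
  by (simp add: at_factor_def cpoly_eval_subst)

lemma multihomogeneous_at_factor:
  assumes "finite K" "k \<in> K" "homogeneous d F"
  shows "multihomogeneous K (\<lambda>j. if j = k then d else 0) (at_factor k F)"
proof (rule multihomogeneousI[OF assms(1)])
  fix c :: "nat \<Rightarrow> complex" and x
  have "(\<Prod>j\<in>K. c j ^ (if j = k then d else 0)) = (\<Prod>j\<in>K. if j = k then c k ^ d else 1)"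
    by (intro prod.cong) auto
  also have "\<dots> = c k ^ d" using assms by simp
  finally show "cpoly_eval (\<lambda>(j, i). c j * x j i) (at_factor k F) = 
      (\<Prod>j\<in>K. c j ^ (if j = k then d else 0)) * cpoly_eval (\<lambda>(j, i). x j i) (at_factor k F)"
    by (simp add: eval_at_factor cpoly_eval_homogeneous_scale[OF assms(3)])
qed

text \<open>The set \<open>\<Phi>\<close> consists of pairs of a factor and an equation for it.\<close>

lemma zariski_closed_Collect:
  assumes K: "finite K" and C: "zariski_closed K C" 
    and \<Phi>: "\<And>k F. (k, F) \<in> \<Phi> \<Longrightarrow> k \<in> K \<and> (\<exists>d. homogeneous d F)"
  shows "zariski_closed K {y \<in> C. \<forall>(k, F)\<in>\<Phi>. ev F (rep (y k)) = 0}"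
proof -
  obtain S where S: "\<forall>f\<in>S. \<exists>b. multihomogeneous K b f" "C = {y \<in> multiproj K. \<forall>f\<in>S. vanishes_at K f y}"
    using C unfolding zariski_closed_def by blast
  have hom: "\<exists>b. multihomogeneous K b (at_factor k F)" if "(k, F) \<in> \<Phi>" for k F
    using \<Phi>[OF that] multihomogeneous_at_factor[OF K] by blast
  have van: "vanishes_at K (at_factor k F) y \<longleftrightarrow> ev F (rep (y k)) = 0" if "(k, F) \<in> \<Phi>" for k F y
    using hom[OF that] vanishes_at_iff_rep[OF _ K] by (auto simp: eval_at_factor)
  show ?thesis unfolding zariski_closed_def
  proof (intro exI[of _ "S \<union> (\<lambda>(k, F). at_factor k F) ` \<Phi>"] conjI ballI)
    fix f assume "f \<in> S \<union> (\<lambda>(k, F). at_factor k F) ` \<Phi>"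
    then show "\<exists>b. multihomogeneous K b f" using S(1) hom by auto
  next
    show "{y \<in> C. \<forall>(k, F)\<in>\<Phi>. ev F (rep (y k)) = 0} = 
        {y \<in> multiproj K. \<forall>f\<in>S \<union> (\<lambda>(k, F). at_factor k F) ` \<Phi>. vanishes_at K f y}"
      using van unfolding S(2) by (auto; fastforce)
  qed
qed

lemma zariski_closed_form:
  "finite K \<Longrightarrow> zariski_closed K C \<Longrightarrow> k \<in> K \<Longrightarrow> homogeneous d F \<Longrightarrow> 
    zariski_closed K {y \<in> C. ev F (rep (y k)) = 0}"
  using zariski_closed_Collect[of K C "{(k, F)}"] by auto

lemma zariski_closed_multiproj: "zariski_closed K (multiproj K)"
  unfolding zariski_closed_def by (intro exI[of _ "{}"]) auto

lemma eq_point_iff: "x = q \<longleftrightarrow> (\<forall>u. ev (lin_form (cross (rep q) u)) (rep x) = 0)"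
proof
  assume *: "\<forall>u. ev (lin_form (cross (rep q) u)) (rep x) = 0"
  have "cdot u (cross (rep x) (rep q)) = 0" for u
    using *[rule_format, of u] by (simp add: cdot_cross_rotate)
  then have "cross (rep x) (rep q) = 0" using exists_cdot_nonzero by blast
  then show "x = q" using pt_eq_iff[of "rep x" "rep q"] by simp
qed simp

lemma zariski_closed_factor_eq:
  assumes "finite K" "zariski_closed K C" "k \<in> K"
  shows "zariski_closed K {y \<in> C. y k = q}"
proof -
  have "{y \<in> C. y k = q} = {y \<in> C. \<forall>(k, F)\<in>range (\<lambda>u. (k, lin_form (cross (rep q) u))). ev F (rep (y k)) = 0}"
    by (auto simp: eq_point_iff[of _ q])
  also have "zariski_closed K \<dots>"
    using assms homogeneous_lin_form by (intro zariski_closed_Collect) auto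
  finally show ?thesis .
qed

lemma irreducible_closed_singleton:
  assumes "finite K" "y \<in> multiproj K"
  shows "irreducible_closed K {y}"
proof -
  have "{y} = {z \<in> multiproj K. \<forall>(k, F)\<in>(\<Union>k\<in>K. range (\<lambda>u. (k, lin_form (cross (rep (y k)) u)))). ev F (rep (z k)) = 0}"
  proof (intro equalityI subsetI)
    fix z assume z: "z \<in> {z \<in> multiproj K. \<forall>(k, F)\<in>(\<Union>k\<in>K. range (\<lambda>u. (k, lin_form (cross (rep (y k)) u)))). ev F (rep (z k)) = 0}"
    have "z k = y k" if "k \<in> K" for k
      unfolding eq_point_iff[of "z k" "y k"] using z that by auto
    then have "z = y" using z assms(2) by (auto simp: multiproj_def intro: PiE_ext)
    then show "z \<in> {y}" by simp
  qed (use assms(2) in auto)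
  also have "zariski_closed K \<dots>"
    using homogeneous_lin_form by (intro zariski_closed_Collect[OF assms(1) zariski_closed_multiproj]) auto
  finally show ?thesis unfolding irreducible_closed_def by auto
qed

lemma multihomogeneous_mult:
  assumes "finite K" "multihomogeneous K b f" "multihomogeneous K b' g"
  shows "multihomogeneous K (\<lambda>k. b k + b' k) (f * g)"
proof (rule multihomogeneousI[OF assms(1)])
  fix c x
  show "cpoly_eval (\<lambda>(k, i). c k * x k i) (f * g) = 
      (\<Prod>k\<in>K. c k ^ (b k + b' k)) * cpoly_eval (\<lambda>(k, i). x k i) (f * g)"
    using multihomogeneous_eval[OF assms(2,1), of "\<lambda>k i. c k * x k i" c x]
      multihomogeneous_eval[OF assms(3,1), of "\<lambda>k i. c k * x k i" c x]
    by (simp add: power_add prod.distrib mult_ac)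
qed

lemma zariski_closed_Un:
  assumes K: "finite K" and "zariski_closed K X" "zariski_closed K Y"
  shows "zariski_closed K (X \<union> Y)"
proof -
  obtain S where S: "\<forall>f\<in>S. \<exists>b. multihomogeneous K b f" "X = {y \<in> multiproj K. \<forall>f\<in>S. vanishes_at K f y}"
    using assms(2) unfolding zariski_closed_def by blast
  obtain T where T: "\<forall>f\<in>T. \<exists>b. multihomogeneous K b f" "Y = {y \<in> multiproj K. \<forall>f\<in>T. vanishes_at K f y}"
    using assms(3) unfolding zariski_closed_def by blast
  have hom: "\<exists>b. multihomogeneous K b (f * g)" if "f \<in> S" "g \<in> T" for f g
    using S(1) T(1) that multihomogeneous_mult[OF K] by blast
  have van: "vanishes_at K (f * g) y \<longleftrightarrow> vanishes_at K f y \<or> vanishes_at K g y" if fg: "f \<in> S" "g \<in> T" for f g y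
  proof -
    obtain b b' b'' where h: "multihomogeneous K b f" "multihomogeneous K b' g" "multihomogeneous K b'' (f * g)"
      using S(1) T(1) hom fg by blast
    show ?thesis unfolding vanishes_at_iff_rep[OF h(1) K] vanishes_at_iff_rep[OF h(2) K] 
        vanishes_at_iff_rep[OF h(3) K] by simp
  qed
  have "X \<union> Y = {y \<in> multiproj K. \<forall>f\<in>S. \<forall>g\<in>T. vanishes_at K f y \<or> vanishes_at K g y}"
    unfolding S(2) T(2) by blast
  also have "\<dots> = {y \<in> multiproj K. \<forall>h\<in>{f * g | f g. f \<in> S \<and> g \<in> T}. vanishes_at K h y}"
    using van by (simp; blast)
  finally show ?thesis unfolding zariski_closed_def
    using hom by (intro exI[of _ "{f * g | f g. f \<in> S \<and> g \<in> T}"]) auto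
qed

lemma zariski_closed_empty: "finite K \<Longrightarrow> zariski_closed K {}"
  unfolding zariski_closed_def
proof (intro exI[of _ "{1}"] conjI ballI)
  assume K: "finite K"
  have h: "multihomogeneous K (\<lambda>_. 0) 1" by (rule multihomogeneousI[OF K]) simp
  then show "\<exists>b. multihomogeneous K b f" if "f \<in> {1}" for f using that by blast
  show "{} = {y \<in> multiproj K. \<forall>f\<in>{1}. vanishes_at K f y}"
    using vanishes_at_iff_rep[OF h K] by simp
qed

lemma irreducible_closed_finite_cover:
  assumes K: "finite K" and Z: "irreducible_closed K Z" and I: "finite I" 
    and "\<And>i. i \<in> I \<Longrightarrow> zariski_closed K (A i)" "Z \<subseteq> (\<Union>i\<in>I. A i)"
  shows "\<exists>i\<in>I. Z \<subseteq> A i"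
  using I assms(4,5)
proof (induction I)
  case empty
  then show ?case using Z by (auto simp: irreducible_closed_def)
next
  case (insert i I)
  have "zariski_closed K (\<Union>i\<in>J. A i)" if "J \<subseteq> I" for J
    using finite_subset[OF that insert.hyps(1)] that insert.prems(1) 
    by (induction J) (auto intro: zariski_closed_empty[OF K] zariski_closed_Un[OF K])
  then have "zariski_closed K (\<Union>i\<in>I. A i)" by blast
  then have "Z \<subseteq> A i \<or> Z \<subseteq> (\<Union>i\<in>I. A i)"
    using Z insert.prems unfolding irreducible_closed_def by (metis UN_insert insertI1)
  then show ?case using insert by auto
qed


section \<open>Irreducibility of rational curves\<close>

text \<open>An equation of a closed set pulls back along the polynomial map \<open>\<gamma>\<close> to a polynomial, and two
  polynomials that do not vanish identically on the linear space \<open>L\<close> have a common nonzero point in \<open>L\<close>.\<close>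

lemma irreducible_closed_image_of_line:
  assumes K: "finite K" and Z: "zariski_closed K Z"
    and im: "Z = (\<lambda>x. \<lambda>k\<in>K. pt (\<gamma> x k)) ` (L - {0})"
    and L: "\<And>x y t. x \<in> L \<Longrightarrow> y \<in> L \<Longrightarrow> x + t *s (y - x) \<in> L" "L - {0} \<noteq> {}"
    and \<gamma>: "\<And>x k. x \<in> L \<Longrightarrow> x \<noteq> 0 \<Longrightarrow> k \<in> K \<Longrightarrow> \<gamma> x k \<noteq> 0"
    and g: "\<And>x k i. ev (g k i) x = \<gamma> x k $ i"
  shows "irreducible_closed K Z"
  unfolding irreducible_closed_def
proof (intro conjI allI impI)
  show "zariski_closed K Z" by fact
  show "Z \<noteq> {}" using L(2) unfolding im by blast
  fix X Y assume XY: "zariski_closed K X \<and> zariski_closed K Y \<and> Z \<subseteq> X \<union> Y"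
  obtain S where S: "\<forall>f\<in>S. \<exists>b. multihomogeneous K b f" "X = {y \<in> multiproj K. \<forall>f\<in>S. vanishes_at K f y}"
    using XY unfolding zariski_closed_def by blast
  obtain T where T: "\<forall>f\<in>T. \<exists>b. multihomogeneous K b f" "Y = {y \<in> multiproj K. \<forall>f\<in>T. vanishes_at K f y}"
    using XY unfolding zariski_closed_def by blast
  let ?\<sigma> = "\<lambda>x. \<lambda>k\<in>K. pt (\<gamma> x k)"
  define pb where "pb f = poly_subst Cst (\<lambda>(k, i). g k i) f" for f
  have pb: "ev (pb f) x = cpoly_eval (\<lambda>(k, i). \<gamma> x k $ i) f" for f x
  proof -
    have "(\<lambda>v. cpoly_eval (($) x) (case v of (k, i) \<Rightarrow> g k i)) = (\<lambda>(k, i). \<gamma> x k $ i)"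
      by (auto simp: g)
    then show ?thesis by (simp add: pb_def cpoly_eval_subst)
  qed
  have van: "vanishes_at K f (?\<sigma> x) \<longleftrightarrow> ev (pb f) x = 0" 
    if "x \<in> L - {0}" "\<exists>b. multihomogeneous K b f" for f x
    using that vanishes_at_iff[OF _ K, of _ f "\<gamma> x" "?\<sigma> x"] \<gamma> by (auto simp: pb)
  have mp: "?\<sigma> x \<in> multiproj K" for x by (simp add: multiproj_def)
  show "Z \<subseteq> X \<or> Z \<subseteq> Y"
  proof (rule ccontr)
    assume "\<not> (Z \<subseteq> X \<or> Z \<subseteq> Y)"
    then obtain x1 x2 where x: "x1 \<in> L - {0}" "?\<sigma> x1 \<notin> X" "x2 \<in> L - {0}" "?\<sigma> x2 \<notin> Y" unfolding im by blast
    then obtain f h where fh: "f \<in> S" "\<not> vanishes_at K f (?\<sigma> x1)" "h \<in> T" "\<not> vanishes_at K h (?\<sigma> x2)"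
      using mp unfolding S(2) T(2) by auto
    have f1: "ev (pb f) x1 \<noteq> 0" using van[OF x(1)] S(1) fh by blast
    have h2: "ev (pb h) x2 \<noteq> 0" using van[OF x(3)] T(1) fh by blast
    obtain u where "cdot u x1 \<noteq> 0" using exists_cdot_nonzero x(1) by blast
    then have u: "ev (lin_form u) x1 \<noteq> 0" by (simp add: cdot_commute)
    have "ev (pb f * lin_form u) x1 \<noteq> 0" using f1 u by simp
    from cpoly_common_nonzero[OF this h2] obtain t where 
      t: "cpoly_eval (\<lambda>v. x1 $ v + t * (x2 $ v - x1 $ v)) (pb f * lin_form u) \<noteq> 0"
         "cpoly_eval (\<lambda>v. x1 $ v + t * (x2 $ v - x1 $ v)) (pb h) \<noteq> 0" by blast
    define x where "x = x1 + t *s (x2 - x1)"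
    have "(\<lambda>v. x1 $ v + t * (x2 $ v - x1 $ v)) = ($) x" by (rule ext) (simp add: x_def algebra_simps)
    then have nz: "ev (pb f) x \<noteq> 0" "cdot x u \<noteq> 0" "ev (pb h) x \<noteq> 0" using t by auto
    have "x \<noteq> 0" using nz(2) by (auto simp: cdot_3)
    moreover have "x \<in> L" unfolding x_def using x by (intro L(1)) auto
    ultimately have "x \<in> L - {0}" by simp
    then have "?\<sigma> x \<in> X \<union> Y" using XY im by blast
    then show False using van[OF \<open>x \<in> L - {0}\<close>] nz S T fh by blast
  qed
qed

section \<open>General points and degrees\<close>

definition hom_part :: "nat \<Rightarrow> 3 cpoly \<Rightarrow> 3 cpoly" where
  "hom_part n F = (\<Sum>\<alpha>\<in>{\<alpha>\<in>keys F. (\<Sum>i\<in>UNIV. lookup \<alpha> i) = n}. single \<alpha> (lookup F \<alpha>))"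

lemma homogeneous_hom_part: "homogeneous n (hom_part n F)"
  unfolding hom_part_def by (rule homogeneous_sum) (auto simp: homogeneous_def)

lemma sum_hom_parts: "\<exists>N. F = (\<Sum>n\<le>N. hom_part n F)"
proof -
  define N where "N = (\<Sum>\<alpha>\<in>keys F. \<Sum>i\<in>UNIV. lookup \<alpha> i)"
  have "(\<Sum>i\<in>UNIV. lookup \<alpha> i) \<le> N" if "\<alpha> \<in> keys F" for \<alpha>
    unfolding N_def using that by (intro member_le_sum) auto
  then have "(\<Sum>n\<le>N. hom_part n F) = (\<Sum>\<alpha>\<in>keys F. single \<alpha> (lookup F \<alpha>))"
    unfolding hom_part_def by (intro sum.group) auto
  then show ?thesis using cpoly_as_sum[of F] by metis
qed

text \<open>On the line through \<open>v\<close> and the origin, \<open>F\<close> restricts to a polynomial whose coefficients are the values at \<open>v\<close>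
  of the homogeneous parts.\<close>

lemma ev_nonzero_of_hom_part:
  assumes "ev (hom_part n F) v \<noteq> 0"
  shows "\<exists>c. c \<noteq> 0 \<and> ev F (c *s v) \<noteq> 0"
proof -
  obtain N where N: "F = (\<Sum>n\<le>N. hom_part n F)" using sum_hom_parts by blast
  have F: "ev F (c *s v) = (\<Sum>k\<le>N. c ^ k * ev (hom_part k F) v)" for c
    by (subst N) (simp add: homogeneous_eval[OF homogeneous_hom_part])
  define p where "p = (\<Sum>k\<le>N. monom (ev (hom_part k F) v) k)"
  have p: "poly p c = ev F (c *s v)" for c
    by (simp add: p_def F poly_sum poly_monom mult.commute)
  have "n \<le> N"
  proof (rule ccontr)
    assume "\<not> n \<le> N"
    have e: "{\<alpha>\<in>keys F. (\<Sum>i\<in>UNIV. lookup \<alpha> i) = n} = {}"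
    proof -
      have "keys F \<subseteq> (\<Union>k\<le>N. keys (hom_part k F))" 
        by (subst (1) N) (rule keys_sum)
      also have "\<dots> \<subseteq> {\<alpha>. (\<Sum>i\<in>UNIV. lookup \<alpha> i) \<le> N}"
        using homogeneous_hom_part[of _ F] by (fastforce simp: homogeneous_def)
      finally show ?thesis using \<open>\<not> n \<le> N\<close> by auto
    qed
    have "hom_part n F = 0" unfolding hom_part_def e by simp
    then show False using assms by simp
  qed
  have "coeff p n = ev (hom_part n F) v"
    using \<open>n \<le> N\<close> by (simp add: p_def coeff_sum)
  then have "p \<noteq> 0" using assms by auto
  then have "[:0, 1:] * p \<noteq> 0" by simp
  then obtain c where "poly ([:0, 1:] * p) c \<noteq> 0" using poly_all_0_iff_0 by blast
  then show ?thesis using p by auto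
qed

text \<open>A property of points holds generally if it is implied by the nonvanishing of one nonzero polynomial at
  some coordinate vector of the point. The polynomial may be inhomogeneous; the exceptional set is
  the set of common zeros of its homogeneous parts.\<close>

lemma for_general_1I:
  assumes "Q \<noteq> 0" "\<And>w. w \<noteq> 0 \<Longrightarrow> ev Q w \<noteq> 0 \<Longrightarrow> Pr (pt w)"
  shows "for_general 1 (\<lambda>h. Pr (h 1))"
  unfolding for_general_def
proof (intro exI conjI ballI)
  let ?\<Phi> = "range (\<lambda>n. (1::nat, hom_part n Q))"
  let ?Z = "{h \<in> multiproj {1..1}. \<forall>(k, F)\<in>?\<Phi>. ev F (rep (h k)) = 0}"
  show "zariski_closed {1..1} ?Z"
    using homogeneous_hom_part by (intro zariski_closed_Collect zariski_closed_multiproj) auto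
  have "\<exists>n. hom_part n Q \<noteq> 0"
    using sum_hom_parts[of Q] assms(1) by (metis sum.neutral)
  then obtain n where n: "hom_part n Q \<noteq> 0" by blast
  have "axis 1 1 \<noteq> (0 :: complex^3)" by (simp add: axis_eq_0_iff)
  then have "hom_part n Q * lin_form (axis 1 1) \<noteq> 0" using n by simp
  then obtain v where "ev (hom_part n Q * lin_form (axis 1 1)) v \<noteq> 0" using form_eq_zeroI by blast
  then have v: "ev (hom_part n Q) v \<noteq> 0" "v \<noteq> 0" by (auto simp: cdot_3)
  have "(\<lambda>k\<in>{1..1}. pt v) \<in> multiproj {1..1}" by (simp add: multiproj_def)
  moreover have "(\<lambda>k\<in>{1..1}. pt v) \<notin> ?Z"
    using v ev_rep_pt[OF homogeneous_hom_part v(2)] by auto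
  ultimately show "?Z \<noteq> multiproj {1..1}" by blast
  fix h assume "h \<in> multiproj {1..1} - ?Z"
  then obtain k where k: "ev (hom_part k Q) (rep (h 1)) \<noteq> 0" by auto
  then obtain c where c: "c \<noteq> 0" "ev Q (c *s rep (h 1)) \<noteq> 0" using ev_nonzero_of_hom_part by blast
  have "Pr (pt (c *s rep (h 1)))" using c by (intro assms(2)) auto
  then show "Pr (h 1)" using c(1) by (simp add: pt_scale)
qed

text \<open>The variety of tuples of points is irreducible.\<close>

lemma for_general_inter:
  assumes "for_general n P" "for_general n Q"
  shows "\<exists>h\<in>multiproj {1..n}. P h \<and> Q h"
proof -
  have nonzero: "\<exists>f. f \<noteq> 0 \<and> (\<forall>x. (\<forall>k\<in>{1..n}. x k \<noteq> 0) \<longrightarrow> cpoly_eval (\<lambda>(k, i). x k $ i) f \<noteq> 0 \<longrightarrow> P (\<lambda>k\<in>{1..n}. pt (x k)))"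
    if gen: "for_general n P" for P
  proof -
    obtain Z where Z: "zariski_closed {1..n} Z" "Z \<noteq> multiproj {1..n}" "\<forall>p\<in>multiproj {1..n} - Z. P p"
      using gen unfolding for_general_def by blast
    obtain S where S: "\<forall>f\<in>S. \<exists>b. multihomogeneous {1..n} b f" "Z = {y \<in> multiproj {1..n}. \<forall>f\<in>S. vanishes_at {1..n} f y}"
      using Z(1) unfolding zariski_closed_def by blast
    obtain f y where f: "f \<in> S" "\<not> vanishes_at {1..n} f y" using Z(2) S(2) by blast
    have "f \<noteq> 0" using f(2) by (auto simp: vanishes_at_def)
    moreover have "P (\<lambda>k\<in>{1..n}. pt (x k))" 
      if x: "\<forall>k\<in>{1..n}. x k \<noteq> 0" "cpoly_eval (\<lambda>(k, i). x k $ i) f \<noteq> 0" for x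
    proof -
      have "x k \<in> hcoords ((\<lambda>k\<in>{1..n}. pt (x k)) k)" if "k \<in> {1..n}" for k
        using x(1) that pt_in_hcoords by simp
      then have "\<not> vanishes_at {1..n} f (\<lambda>k\<in>{1..n}. pt (x k))" 
        using x(2) unfolding vanishes_at_def by blast
      then show ?thesis using Z(3) S(2) f(1) by (auto simp: multiproj_def)
    qed
    ultimately show ?thesis by blast
  qed
  obtain f where f: "f \<noteq> 0" "\<forall>x. (\<forall>k\<in>{1..n}. x k \<noteq> 0) \<longrightarrow> cpoly_eval (\<lambda>(k, i). x k $ i) f \<noteq> 0 \<longrightarrow> P (\<lambda>k\<in>{1..n}. pt (x k))"
    using nonzero[OF assms(1)] by (elim exE conjE) (rule that)
  obtain g where g: "g \<noteq> 0" "\<forall>x. (\<forall>k\<in>{1..n}. x k \<noteq> 0) \<longrightarrow> cpoly_eval (\<lambda>(k, i). x k $ i) g \<noteq> 0 \<longrightarrow> Q (\<lambda>k\<in>{1..n}. pt (x k))"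
    using nonzero[OF assms(2)] by (elim exE conjE) (rule that)
  have Var0: "Var v \<noteq> (0 :: (nat \<times> 3) cpoly)" for v 
    using cpoly_eval_Var[of "\<lambda>_. 1" v] by (metis cpoly_eval_simps(2) zero_neq_one)
  have "(\<Prod>k\<in>{1..n}. Var (k, 1)) \<noteq> (0 :: (nat \<times> 3) cpoly)"
    by (intro cpoly_prod_nonzero Var0) simp
  \<comment> \<open>The variables ensure that the coordinate vectors of a nonzero of the product are nonzero.\<close>
  then have "f * g * (\<Prod>k\<in>{1..n}. Var (k, 1)) \<noteq> 0"
    using f(1) g(1) by simp
  then obtain z where z: "cpoly_eval z (f * g * (\<Prod>k\<in>{1..n}. Var (k, 1))) \<noteq> 0" using cpoly_eq_zeroI by blast
  define x where "x k = (\<chi> i. z (k, i))" for k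
  have zx: "(\<lambda>(k, i). x k $ i) = z" by (auto simp: x_def)
  have x0: "\<forall>k\<in>{1..n}. x k \<noteq> 0"
  proof
    fix k assume "k \<in> {1..n}"
    then have "x k $ 1 \<noteq> 0" using z by (auto simp: x_def)
    then show "x k \<noteq> 0" by auto
  qed
  have "P (\<lambda>k\<in>{1..n}. pt (x k))" 
    using f(2)[rule_format, of x] x0 z unfolding zx by simp
  moreover have "Q (\<lambda>k\<in>{1..n}. pt (x k))"
    using g(2)[rule_format, of x] x0 z unfolding zx by simp
  ultimately show ?thesis by (intro bexI[of _ "\<lambda>k\<in>{1..n}. pt (x k)"]) (auto simp: multiproj_def)
qed

text \<open>By the previous lemma, the general number of points is unique, as required in the definition
  of \<open>line_degree\<close>.\<close>

lemma line_degreeI: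
  assumes "Q \<noteq> 0" 
    "\<And>w. w \<noteq> 0 \<Longrightarrow> ev Q w \<noteq> 0 \<Longrightarrow> finite {y \<in> C. incident (y k) (pt w)} \<and> card {y \<in> C. incident (y k) (pt w)} = N"
  shows "line_degree C k = N"
  unfolding line_degree_def
proof (rule the_equality)
  show *: "for_general 1 (\<lambda>h. finite {y \<in> C. incident (y k) (h 1)} \<and> card {y \<in> C. incident (y k) (h 1)} = N)"
    using assms by (intro for_general_1I[of Q "\<lambda>l. finite {y \<in> C. incident (y k) l} \<and> card {y \<in> C. incident (y k) l} = N"])
  fix M assume "for_general 1 (\<lambda>h. finite {y \<in> C. incident (y k) (h 1)} \<and> card {y \<in> C. incident (y k) (h 1)} = M)"
  from for_general_inter[OF * this] show "M = N" by auto
qed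

section \<open>The blow up\<close>

text \<open>The point of the blow up over the point with coordinates \<open>x\<close>, if this is not one of the centres.\<close>

definition lift_point :: "nat \<Rightarrow> (nat \<Rightarrow> complex^3) \<Rightarrow> complex^3 \<Rightarrow> nat \<Rightarrow> cp2" where
  "lift_point r P x = (\<lambda>k\<in>{0..r}. pt (if k = 0 then x else cross x (P k)))"

text \<open>The point of the \<open>j\<close>-th exceptional divisor given by the line through \<open>P j\<close> and \<open>x\<close>.\<close>

definition exceptional_point :: "nat \<Rightarrow> (nat \<Rightarrow> complex^3) \<Rightarrow> nat \<Rightarrow> complex^3 \<Rightarrow> nat \<Rightarrow> cp2" where
  "exceptional_point r P j x = (\<lambda>k\<in>{0..r}. pt (if k = 0 then P j else if k = j then cross (P j) x else cross (P j) (P k)))"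

lemma cross_nth_cdot: "cross x p $ i = cdot x (cross p (axis i 1))"
  using exhaust_3[of i] by (auto simp: cdot_3 axis_def)

locale blown_up_plane =
  fixes r :: nat and p :: "nat \<Rightarrow> cp2"
  assumes distinct: "inj_on p {1..r}"
begin

definition P :: "nat \<Rightarrow> complex^3" where "P j = rep (p j)"

abbreviation "K \<equiv> {0..r}"
abbreviation "\<sigma> \<equiv> lift_point r P"
abbreviation "\<tau> \<equiv> exceptional_point r P"

lemma P_nonzero [simp]: "P j \<noteq> 0" and pt_P [simp]: "pt (P j) = p j"
  by (simp_all add: P_def)

definition off_centres :: "complex^3 \<Rightarrow> bool" where
  "off_centres x \<longleftrightarrow> x \<noteq> 0 \<and> (\<forall>j\<in>{1..r}. cross x (P j) \<noteq> 0)"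

lemma off_centres_iff: "x \<noteq> 0 \<Longrightarrow> off_centres x \<longleftrightarrow> (\<forall>j\<in>{1..r}. pt x \<noteq> p j)"
  using pt_eq_iff[of x "P _"] by (auto simp: off_centres_def)

lemma off_centres_rep: "off_centres (rep x) \<longleftrightarrow> (\<forall>j\<in>{1..r}. x \<noteq> p j)"
  using off_centres_iff[of "rep x"] by simp

lemma cross_centres: "j \<in> {1..r} \<Longrightarrow> k \<in> {1..r} \<Longrightarrow> j \<noteq> k \<Longrightarrow> cross (P j) (P k) \<noteq> 0"
  using pt_eq_iff[of "P j" "P k"] inj_onD[OF distinct, of j k] by auto

lemma lift_in_multiproj: "\<sigma> x \<in> multiproj K"
  by (simp add: lift_point_def multiproj_def)

lemma exceptional_in_multiproj: "\<tau> j x \<in> multiproj K"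
  by (simp add: exceptional_point_def multiproj_def)

lemma lift_0 [simp]: "\<sigma> x 0 = pt x" and lift_j: "j \<in> {1..r} \<Longrightarrow> \<sigma> x j = pt (cross x (P j))"
  by (simp_all add: lift_point_def)

lemma lift_inj: "x \<noteq> 0 \<Longrightarrow> x' \<noteq> 0 \<Longrightarrow> cross x x' \<noteq> 0 \<Longrightarrow> \<sigma> x \<noteq> \<sigma> x'"
  using lift_0[of x] lift_0[of x'] pt_eq_iff[of x x'] by metis

lemma blowup_incidence:
  assumes "y \<in> blowup r p" "j \<in> {1..r}"
  shows "cdot (rep (y 0)) (rep (y j)) = 0" "cdot (P j) (rep (y j)) = 0"
  using assms unfolding blowup_def by (auto simp: incident_iff P_def)

lemma blowup_line_eq:
  assumes y: "y \<in> blowup r p" "j \<in> {1..r}" and c: "cross (rep (y 0)) (P j) \<noteq> 0"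
  shows "y j = pt (cross (rep (y 0)) (P j))"
proof -
  obtain c where c': "rep (y j) = c *s cross (rep (y 0)) (P j)"
    using orthogonal_imp_scale_cross[OF blowup_incidence[OF y] c] by blast
  then have "c \<noteq> 0" by (metis rep_nonzero vec.scale_zero_left)
  then show ?thesis using pt_scale[OF c] c' pt_rep[of "y j"] by metis
qed

lemma blowup_eq_lift:
  assumes y: "y \<in> blowup r p" and off: "off_centres (rep (y 0))"
  shows "y = \<sigma> (rep (y 0))"
proof (rule PiE_ext[of y K "\<lambda>_. UNIV"])
  show "y \<in> K \<rightarrow>\<^sub>E UNIV" using y by (simp add: blowup_def multiproj_def)
  show "\<sigma> (rep (y 0)) \<in> K \<rightarrow>\<^sub>E UNIV" using lift_in_multiproj by (simp add: multiproj_def)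
  fix k assume k: "k \<in> K"
  show "y k = \<sigma> (rep (y 0)) k"
  proof (cases "k = 0")
    case False
    then have k: "k \<in> {1..r}" using k by simp
    then show ?thesis using blowup_line_eq[OF y k] off by (simp add: lift_j off_centres_def)
  qed simp
qed

lemma blowup_eq_exceptional:
  assumes y: "y \<in> blowup r p" "y 0 = p j" and j: "j \<in> {1..r}" and w: "cdot (P j) w \<noteq> 0"
  shows "\<exists>x. cdot x w = 0 \<and> x \<noteq> 0 \<and> y = \<tau> j x"
proof -
  define n where "n = rep (y j)"
  have n: "cdot (P j) n = 0" "n \<noteq> 0" using blowup_incidence(2)[OF y(1) j] by (auto simp: n_def)
  define x where "x = (1 / cdot (P j) w) *s cross n w"
  have "cross (P j) (cross n w) = cdot (P j) w *s n - cdot (P j) n *s w"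
    by (simp add: vec3_eq_iff cdot_3 algebra_simps)
  then have xn: "cross (P j) x = n" using n w by (simp add: x_def)
  have x0: "x \<noteq> 0" using xn n by auto
  have "y = \<tau> j x"
  proof (rule PiE_ext[of y K "\<lambda>_. UNIV"])
    show "y \<in> K \<rightarrow>\<^sub>E UNIV" using y by (simp add: blowup_def multiproj_def)
    show "\<tau> j x \<in> K \<rightarrow>\<^sub>E UNIV" using exceptional_in_multiproj by (simp add: multiproj_def)
    fix k assume k: "k \<in> K"
    consider "k = 0" | "k = j" "k \<noteq> 0" | "k \<noteq> 0" "k \<noteq> j" by blast
    then show "y k = \<tau> j x k"
    proof cases
      case 1 then show ?thesis using y by (simp add: exceptional_point_def)
    next
      case 2 then show ?thesis using k by (simp add: exceptional_point_def xn n_def)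
    next
      case 3
      then have k': "k \<in> {1..r}" using k by simp
      then show ?thesis using blowup_line_eq[OF y(1) k'] y(2) cross_centres[OF j k'] 3 k
        by (simp add: exceptional_point_def P_def)
    qed
  qed
  moreover have "cdot x w = 0" by (simp add: x_def cdot_commute[of _ w])
  ultimately show ?thesis using x0 by blast
qed

lemma exists_line_avoiding_centres: "\<exists>w. w \<noteq> 0 \<and> (\<forall>j\<in>{1..r}. cdot (P j) w \<noteq> 0)"
proof -
  have a: "axis 1 1 \<noteq> (0 :: complex^3)" by (simp add: axis_eq_0_iff)
  have "(\<Prod>j\<in>{1..r}. lin_form (P j)) \<noteq> 0" by (intro cpoly_prod_nonzero) auto
  then have "(\<Prod>j\<in>{1..r}. lin_form (P j)) * lin_form (axis 1 1) \<noteq> 0" using a by simp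
  then obtain w where "ev ((\<Prod>j\<in>{1..r}. lin_form (P j)) * lin_form (axis 1 1)) w \<noteq> 0" using form_eq_zeroI by blast
  then show ?thesis by (intro exI[of _ w]) (auto simp: cdot_commute[of w] cdot_3[of "axis 1 1"])
qed

lemma exists_line_through_centre: "j \<in> {1..r} \<Longrightarrow> \<exists>u. u \<noteq> 0 \<and> cdot (P j) u = 0"
proof -
  obtain a b where ab: "cross a b = P j" using exists_cross_eq P_nonzero by blast
  then have "a \<noteq> 0" using P_nonzero[of j] by (metis cross_zero(1))
  moreover have "cdot (P j) a = 0" using ab cdot_cross(1)[of a b] by (simp add: cdot_commute)
  ultimately show ?thesis by blast
qed

lemma exists_point_off:
  assumes "w \<noteq> 0" shows "\<exists>x. off_centres x \<and> cdot x w \<noteq> 0"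
proof -
  obtain u where u: "\<And>j. j \<in> {1..r} \<Longrightarrow> u j \<noteq> 0 \<and> cdot (P j) (u j) = 0"
    using exists_line_through_centre by metis
  have "(\<Prod>j\<in>{1..r}. lin_form (u j)) \<noteq> 0" using u by (intro cpoly_prod_nonzero) auto
  then have "(\<Prod>j\<in>{1..r}. lin_form (u j)) * lin_form w \<noteq> 0" using assms by simp
  then obtain x where "ev ((\<Prod>j\<in>{1..r}. lin_form (u j)) * lin_form w) x \<noteq> 0" using form_eq_zeroI by blast
  then have x: "\<And>j. j \<in> {1..r} \<Longrightarrow> cdot x (u j) \<noteq> 0" "cdot x w \<noteq> 0" by auto
  have x0: "x \<noteq> 0" using x(2) by (auto simp: cdot_3)
  have "cross x (P j) \<noteq> 0" if j: "j \<in> {1..r}" for j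
  proof
    assume "cross x (P j) = 0"
    then have "cross (P j) x = 0" using cross_swap[of x "P j"] by simp
    then obtain c where "x = c *s P j" using cross_eq_0_imp_scale P_nonzero by blast
    then show False using x(1)[OF j] u[OF j] by simp
  qed
  then show ?thesis using x x0 by (auto simp: off_centres_def)
qed

text \<open>The pull back of an equation along \<open>\<sigma>\<close>, that is, its restriction to the complement of the exceptional
  divisors.\<close>

definition pullback :: "(nat \<times> 3) cpoly \<Rightarrow> 3 cpoly" where
  "pullback f = poly_subst Cst (\<lambda>(k, i). if k = 0 then Var i else lin_form (cross (P k) (axis i 1))) f"

lemma ev_pullback: "ev (pullback f) x = cpoly_eval (\<lambda>(k, i). (if k = 0 then x else cross x (P k)) $ i) f"
proof -
  have "(\<lambda>v. cpoly_eval (($) x) (case v of (k, i) \<Rightarrow> if k = 0 then Var i else lin_form (cross (P k) (axis i 1)))) =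
    (\<lambda>(k, i). (if k = 0 then x else cross x (P k)) $ i)"
    by (auto simp: cross_nth_cdot)
  then show ?thesis by (simp add: pullback_def cpoly_eval_subst)
qed

lemma homogeneous_pullback:
  assumes f: "multihomogeneous K b f" shows "homogeneous (sum b K) (pullback f)"
proof (rule homogeneousI)
  fix c v
  have "cpoly_eval (\<lambda>(k, i). (if k = 0 then c *s v else cross (c *s v) (P k)) $ i) f =
      (\<Prod>k\<in>K. c ^ b k) * cpoly_eval (\<lambda>(k, i). (if k = 0 then v else cross v (P k)) $ i) f"
    by (rule multihomogeneous_eval[OF f, where c = "\<lambda>_. c"]) auto
  then show "ev (pullback f) (c *s v) = c ^ sum b K * ev (pullback f) v"
    by (simp only: ev_pullback power_sum)
qed

lemma vanishes_at_lift:
  assumes "multihomogeneous K b f" "off_centres x"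
  shows "vanishes_at K f (\<sigma> x) \<longleftrightarrow> ev (pullback f) x = 0"
  unfolding ev_pullback using assms(2)
  by (intro vanishes_at_iff[OF assms(1)]) (auto simp: lift_point_def off_centres_def)

lemma lift_line_irreducible:
  assumes C: "zariski_closed K Z" and w: "\<And>j. j \<in> {1..r} \<Longrightarrow> cdot (P j) w \<noteq> 0" "w \<noteq> 0"
    and Z: "Z = \<sigma> ` ({x. cdot x w = 0} - {0})"
  shows "irreducible_closed K Z"
proof (rule irreducible_closed_image_of_line[OF _ C])
  show "Z = (\<lambda>x. \<lambda>k\<in>K. pt (if k = 0 then x else cross x (P k))) ` ({x. cdot x w = 0} - {0})"
    unfolding Z lift_point_def ..
  show "ev (if k = 0 then Var i else lin_form (cross (P k) (axis i 1))) x = (if k = 0 then x else cross x (P k)) $ i" for x k i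
    by (simp add: cross_nth_cdot)
  obtain a b where "cross a b = w" using exists_cross_eq w(2) by blast
  then have "a \<in> {x. cdot x w = 0} - {0}" using w(2) by auto
  then show "{x. cdot x w = 0} - {0} \<noteq> {}" by blast
  fix x y t assume "x \<in> {x. cdot x w = 0}" "y \<in> {x. cdot x w = 0}"
  then show "x + t *s (y - x) \<in> {x. cdot x w = 0}"
    by (simp add: cdot_diff)
next
  fix x k assume x: "x \<in> {x. cdot x w = 0}" "x \<noteq> 0" "k \<in> K"
  have "cross x (P k) \<noteq> 0" if "k \<noteq> 0"
    using x w(1)[of k] that by (intro cross_nonzero_if_separated(1)) auto
  then show "(if k = 0 then x else cross x (P k)) \<noteq> 0" using x by simp
qed simp

lemma exceptional_irreducible:
  assumes C: "zariski_closed K Z" and j: "j \<in> {1..r}" and w: "cdot (P j) w \<noteq> 0"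
    and Z: "Z = \<tau> j ` ({x. cdot x w = 0} - {0})"
  shows "irreducible_closed K Z"
proof (rule irreducible_closed_image_of_line[OF _ C])
  let ?g = "\<lambda>x k. if k = 0 then P j else if k = j then cross (P j) x else cross (P j) (P k)"
  show "Z = (\<lambda>x. \<lambda>k\<in>K. pt (?g x k)) ` ({x. cdot x w = 0} - {0})"
    unfolding Z exceptional_point_def ..
  show "ev (if k = 0 then Cst (P j $ i) else if k = j then lin_form (cross (axis i 1) (P j)) else Cst (cross (P j) (P k) $ i)) x = 
      ?g x k $ i" for x k i
    using exhaust_3[of i] by (auto simp: cdot_3 axis_def)
  have "w \<noteq> 0" using w by (auto simp: cdot_3)
  then obtain a b where "cross a b = w" using exists_cross_eq by blast
  then have "a \<in> {x. cdot x w = 0} - {0}" using \<open>w \<noteq> 0\<close> by auto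
  then show "{x. cdot x w = 0} - {0} \<noteq> {}" by blast
  fix x y t assume "x \<in> {x. cdot x w = 0}" "y \<in> {x. cdot x w = 0}"
  then show "x + t *s (y - x) \<in> {x. cdot x w = 0}"
    by (simp add: cdot_diff)
next
  fix x k assume x: "x \<in> {x. cdot x w = 0}" "x \<noteq> 0" "k \<in> K"
  have "cross (P j) x \<noteq> 0" using x(1,2) w by (intro cross_nonzero_if_separated(2)) auto
  then show "(if k = 0 then P j else if k = j then cross (P j) x else cross (P j) (P k)) \<noteq> 0"
    using x(3) cross_centres[OF j, of k] by simp
qed simp

end

section \<open>Plane equations of curves on the blow up\<close>

context blown_up_plane
begin

text \<open>A point of a closed irreducible set with at least two points starts a chain, so the set
  must be all of \<open>C\<close>.\<close>

lemma no_chain_below_curve: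
  assumes "irreducible_curve K C" "irreducible_closed K Z" "Z \<subseteq> C" "y \<in> Z" "y' \<in> Z" "y \<noteq> y'"
  shows "Z = C"
proof (rule ccontr)
  assume "Z \<noteq> C"
  have "y \<in> multiproj K"
    using assms(2,4) unfolding irreducible_closed_def zariski_closed_def by blast
  then have "irreducible_closed K {y}" by (intro irreducible_closed_singleton) auto
  moreover have "{y} \<subset> Z" "Z \<subset> C" using assms \<open>Z \<noteq> C\<close> by auto
  ultimately show False using assms(1,2) unfolding irreducible_curve_def by blast
qed

lemma curve_not_singleton:
  assumes "irreducible_curve K C" shows "\<not> C \<subseteq> {y}"
proof
  assume "C \<subseteq> {y}"
  obtain Z where "irreducible_closed K Z" "Z \<subset> C" using assms unfolding irreducible_curve_def by blast
  then show False using \<open>C \<subseteq> {y}\<close> unfolding irreducible_closed_def by blast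
qed

definition nonexceptional_curve :: "(nat \<Rightarrow> cp2) set \<Rightarrow> bool" where
  "nonexceptional_curve C \<longleftrightarrow> irreducible_curve K C \<and> C \<subseteq> blowup r p \<and> (\<forall>j\<in>{1..r}. \<not> (\<forall>y\<in>C. y 0 = p j))"

definition plane_vanishing :: "(nat \<Rightarrow> cp2) set \<Rightarrow> 3 cpoly \<Rightarrow> bool" where
  "plane_vanishing C F \<longleftrightarrow> (\<forall>y\<in>C. ev F (rep (y 0)) = 0)"

context
  fixes C assumes C: "nonexceptional_curve C"
begin

lemma is_irreducible_curve: "irreducible_curve K C" and curve_in_blowup: "C \<subseteq> blowup r p"
  and not_exc: "\<And>j. j \<in> {1..r} \<Longrightarrow> \<exists>y\<in>C. y 0 \<noteq> p j"
  using C unfolding nonexceptional_curve_def by auto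

lemma curve_irreducible: "irreducible_closed K C" and curve_closed: "zariski_closed K C"
  using is_irreducible_curve unfolding irreducible_curve_def irreducible_closed_def by auto

lemma plane_vanishing_mult:
  assumes "homogeneous a A" "homogeneous b B" "plane_vanishing C (A * B)"
  shows "plane_vanishing C A \<or> plane_vanishing C B"
proof -
  have "zariski_closed K {y\<in>C. ev A (rep (y 0)) = 0}" "zariski_closed K {y\<in>C. ev B (rep (y 0)) = 0}"
    using zariski_closed_form[OF _ curve_closed, of 0] assms by auto
  moreover have "C \<subseteq> {y\<in>C. ev A (rep (y 0)) = 0} \<union> {y\<in>C. ev B (rep (y 0)) = 0}"
    using assms(3) by (auto simp: plane_vanishing_def)
  ultimately have "C \<subseteq> {y\<in>C. ev A (rep (y 0)) = 0} \<or> C \<subseteq> {y\<in>C. ev B (rep (y 0)) = 0}"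
    using curve_irreducible unfolding irreducible_closed_def by blast
  then show ?thesis by (auto simp: plane_vanishing_def)
qed

lemma curve_equations:
  "\<exists>S. (\<forall>f\<in>S. \<exists>b. multihomogeneous K b f) \<and>
     C = {y \<in> multiproj K. \<forall>f\<in>S. vanishes_at K f y}"
  using curve_closed unfolding zariski_closed_def .

text \<open>The pull back of an equation of \<open>C\<close> vanishes at the image of \<open>C\<close> except possibly at the centres; there, one
  of the additional linear factors vanishes.\<close>

lemma plane_vanishing_pullback:
  assumes f: "multihomogeneous K b f" "\<And>y. y \<in> C \<Longrightarrow> vanishes_at K f y"
    and u: "\<And>j. j \<in> {1..r} \<Longrightarrow> cdot (P j) (u j) = 0"
  shows "plane_vanishing C (pullback f * (\<Prod>j\<in>{1..r}. lin_form (u j)))"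
    "homogeneous (sum b K + r) (pullback f * (\<Prod>j\<in>{1..r}. lin_form (u j)))"
proof -
  show "plane_vanishing C (pullback f * (\<Prod>j\<in>{1..r}. lin_form (u j)))"
    unfolding plane_vanishing_def
  proof
    fix y assume y: "y \<in> C"
    show "ev (pullback f * (\<Prod>j\<in>{1..r}. lin_form (u j))) (rep (y 0)) = 0"
    proof (cases "off_centres (rep (y 0))")
      case True
      then have "y = \<sigma> (rep (y 0))" using blowup_eq_lift y curve_in_blowup by blast
      then have "ev (pullback f) (rep (y 0)) = 0" using vanishes_at_lift[OF f(1) True] f(2)[OF y] by simp
      then show ?thesis by simp
    next
      case False
      then obtain j where j: "j \<in> {1..r}" "y 0 = p j" by (auto simp: off_centres_rep)
      then have "cdot (rep (y 0)) (u j) = 0" using u by (simp add: P_def)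
      then have "(\<Prod>j\<in>{1..r}. cdot (rep (y 0)) (u j)) = 0" using j(1) by (intro prod_zero) auto
      then show ?thesis by simp
    qed
  qed
  have "homogeneous (\<Sum>j\<in>{1..r}. 1) (\<Prod>j\<in>{1..r}. lin_form (u j))"
    by (intro homogeneous_prod homogeneous_lin_form)
  then show "homogeneous (sum b K + r) (pullback f * (\<Prod>j\<in>{1..r}. lin_form (u j)))"
    using homogeneous_pullback[OF f(1)] by (intro homogeneous_mult) simp_all
qed

text \<open>Otherwise all equations of \<open>C\<close> vanish identically outside the exceptional divisors. Then \<open>C\<close> contains
  the inverse image of a line that misses the centres, and a point of it, as a chain of
  irreducible closed sets below \<open>C\<close>.\<close>

lemma plane_equation_exists: "\<exists>F d. F \<noteq> 0 \<and> homogeneous d F \<and> plane_vanishing C F"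
proof (rule ccontr)
  assume no: "\<not> ?thesis"
  obtain S where S: "\<forall>f\<in>S. \<exists>b. multihomogeneous K b f" 
    "C = {y \<in> multiproj K. \<forall>f\<in>S. vanishes_at K f y}" using curve_equations by (elim exE conjE) (rule that)
  obtain u where u: "\<And>j. j \<in> {1..r} \<Longrightarrow> u j \<noteq> 0 \<and> cdot (P j) (u j) = 0"
    using exists_line_through_centre by metis
  have u0: "(\<Prod>j\<in>{1..r}. lin_form (u j)) \<noteq> 0" using u by (intro cpoly_prod_nonzero) auto
  have lift: "\<sigma> x \<in> C" if x: "off_centres x" for x
  proof -
    have "vanishes_at K f (\<sigma> x)" if f: "f \<in> S" for f
    proof -
      obtain b where b: "multihomogeneous K b f" using bspec[OF S(1) f] by (rule exE)
      have v: "vanishes_at K f y" if "y \<in> C" for y using that f unfolding S(2) by simp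
      have "pullback f * (\<Prod>j\<in>{1..r}. lin_form (u j)) = 0"
        using plane_vanishing_pullback[OF b v, of u] u no by blast
      then have "pullback f = 0" using u0 by simp
      then show ?thesis using vanishes_at_lift[OF b x] by simp
    qed
    then show ?thesis using lift_in_multiproj unfolding S(2) by simp
  qed
  obtain w where w: "w \<noteq> 0" "\<And>j. j \<in> {1..r} \<Longrightarrow> cdot (P j) w \<noteq> 0" using exists_line_avoiding_centres by blast
  define Z where "Z = {y \<in> C. ev (lin_form w) (rep (y 0)) = 0}"
  have "zariski_closed K Z"
    unfolding Z_def by (rule zariski_closed_form[OF _ curve_closed _ homogeneous_lin_form]) auto
  have on_line: "off_centres x" if x: "cdot x w = 0" "x \<noteq> 0" for x
    unfolding off_centres_def using cross_nonzero_if_separated(1)[OF x] w(2) x(2) by simp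
  have Z: "Z = \<sigma> ` ({x. cdot x w = 0} - {0})"
  proof (intro equalityI subsetI)
    fix y assume y: "y \<in> Z"
    then have l: "cdot (rep (y 0)) w = 0" by (simp add: Z_def)
    then have "y = \<sigma> (rep (y 0))" using y curve_in_blowup on_line by (intro blowup_eq_lift) (auto simp: Z_def)
    then show "y \<in> \<sigma> ` ({x. cdot x w = 0} - {0})" using l by (metis (mono_tags, lifting) DiffI image_eqI mem_Collect_eq rep_nonzero singletonD)
  next
    fix y assume "y \<in> \<sigma> ` ({x. cdot x w = 0} - {0})"
    then obtain x where x: "y = \<sigma> x" "cdot x w = 0" "x \<noteq> 0" by auto
    then show "y \<in> Z" using lift[OF on_line[OF x(2,3)]] ev_rep_pt[OF homogeneous_lin_form x(3), of w]
      by (simp add: Z_def)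
  qed
  have irr: "irreducible_closed K Z"
    by (rule lift_line_irreducible[OF \<open>zariski_closed K Z\<close> w(2,1) Z])
  obtain a b where ab: "cross a b = w" using exists_cross_eq w(1) by blast
  then have ab0: "a \<noteq> 0" "b \<noteq> 0" "cdot a w = 0" "cdot b w = 0" using w(1) by auto
  have "Z = C"
  proof (rule no_chain_below_curve[OF is_irreducible_curve irr])
    show "Z \<subseteq> C" by (auto simp: Z_def)
    show "\<sigma> a \<in> Z" "\<sigma> b \<in> Z" using ab0 unfolding Z by auto
    show "\<sigma> a \<noteq> \<sigma> b" using ab0 ab w(1) by (intro lift_inj) auto
  qed
  moreover obtain x where x: "off_centres x" "cdot x w \<noteq> 0" using exists_point_off w(1) by blast
  then have "\<sigma> x \<in> C" "\<sigma> x \<notin> Z"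
    using lift ev_rep_pt[OF homogeneous_lin_form, of x w] by (auto simp: Z_def off_centres_def)
  ultimately show False by simp
qed

text \<open>Let \<open>F\<close> be a nonzero form of least degree that vanishes on the image of \<open>C\<close>. Since \<open>C\<close> is irreducible, one of
  the prime factors of \<open>F\<close> vanishes as well. A further form that is not divisible by this factor would
  have only finitely many zeros in common with it, and \<open>C\<close> would lie over one point.\<close>

theorem plane_equation:
  "\<exists>G e. prime_elem G \<and> homogeneous e G \<and> plane_vanishing C G \<and>
    (\<forall>d A. homogeneous d A \<longrightarrow> plane_vanishing C A \<longrightarrow> G dvd A)"
proof -
  define Q where "Q d \<longleftrightarrow> (\<exists>F. F \<noteq> 0 \<and> homogeneous d F \<and> plane_vanishing C F)" for d
  have "\<exists>d. Q d" using plane_equation_exists by (auto simp: Q_def)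
  define e where "e = (LEAST d. Q d)"
  have "Q e" unfolding e_def using \<open>\<exists>d. Q d\<close> by (rule LeastI_ex)
  then obtain F where F: "F \<noteq> 0" "homogeneous e F" "plane_vanishing C F" by (auto simp: Q_def)
  obtain y where y: "y \<in> C" using curve_irreducible by (auto simp: irreducible_closed_def)
  have "\<not> F dvd 1"
  proof
    assume "F dvd 1"
    moreover have "ev F (rep (y 0)) = 0" using F(3) y by (simp add: plane_vanishing_def)
    ultimately have "ev 1 (rep (y 0)) = 0" by (rule eval_zero_of_dvd)
    then show False by simp
  qed
  then obtain q where q: "prime_elem q" "q dvd F" using cpoly_prime_divisor_exists F(1) by blast
  then obtain s where s: "F = q * s" by auto
  then obtain a b where ab: "homogeneous a q" "homogeneous b s" "a + b = e"
    using homogeneous_factor[of e q s] F by auto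
  have "\<not> plane_vanishing C s"
  proof
    assume "plane_vanishing C s"
    then have "Q b" using ab s F(1) by (auto simp: Q_def)
    then have "e \<le> b" unfolding e_def by (rule Least_le)
    then show False using ab(3) prime_form_degree_pos[OF q(1) ab(1)] by simp
  qed
  then have q_van: "plane_vanishing C q" using plane_vanishing_mult[OF ab(1,2)] F(3) s by auto
  have "q dvd A" if A: "homogeneous d A" "plane_vanishing C A" for d A
  proof (rule ccontr)
    assume "\<not> q dvd A"
    define X where "X = {x. ev q (rep x) = 0 \<and> ev A (rep x) = 0}"
    have "finite X" unfolding X_def by (rule finite_common_zeros[OF q(1) ab(1) A(1) \<open>\<not> q dvd A\<close>])
    moreover have "C \<subseteq> (\<Union>x\<in>X. {y \<in> C. y 0 = x})"
      using q_van A(2) by (auto simp: X_def plane_vanishing_def)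
    ultimately obtain x where x: "C \<subseteq> {y \<in> C. y 0 = x}"
      using irreducible_closed_finite_cover[OF _ curve_irreducible, of X "\<lambda>x. {y \<in> C. y 0 = x}"] 
        zariski_closed_factor_eq[OF _ curve_closed, of 0] by auto
    have "x \<noteq> p j" if "j \<in> {1..r}" for j using not_exc[OF that] x by auto
    then have off: "off_centres (rep x)" by (simp add: off_centres_rep)
    have "C \<subseteq> {\<sigma> (rep x)}"
    proof
      fix y assume "y \<in> C"
      then have "y 0 = x" "y \<in> blowup r p" using x curve_in_blowup by auto
      then show "y \<in> {\<sigma> (rep x)}" using blowup_eq_lift off by auto
    qed
    then show False using curve_not_singleton[OF is_irreducible_curve] by blast
  qed
  then show ?thesis using q(1) ab(1) q_van by blast
qed

text \<open>An exceptional divisor contained in \<open>C\<close>, with a point on it, would be a chain below \<open>C\<close>.\<close>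

lemma exceptional_divisor_not_contained:
  assumes j: "j \<in> {1..r}" and w: "cdot (P j) w \<noteq> 0"
  shows "\<exists>x. cdot x w = 0 \<and> x \<noteq> 0 \<and> \<tau> j x \<notin> C"
proof (rule ccontr)
  assume no: "\<not> ?thesis"
  define Z where "Z = {y \<in> C. y 0 = p j}"
  have "zariski_closed K Z" unfolding Z_def by (rule zariski_closed_factor_eq[OF _ curve_closed]) auto
  have Z: "Z = \<tau> j ` ({x. cdot x w = 0} - {0})"
  proof (intro equalityI subsetI)
    fix y assume "y \<in> Z"
    then show "y \<in> \<tau> j ` ({x. cdot x w = 0} - {0})"
      using blowup_eq_exceptional[OF _ _ j w, of y] curve_in_blowup by (auto simp: Z_def)
  next
    fix y assume "y \<in> \<tau> j ` ({x. cdot x w = 0} - {0})"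
    then show "y \<in> Z" using no by (auto simp: Z_def exceptional_point_def)
  qed
  have irr: "irreducible_closed K Z" by (rule exceptional_irreducible[OF \<open>zariski_closed K Z\<close> j w Z])
  have "w \<noteq> 0" using w by (auto simp: cdot_3)
  then obtain a b where ab: "cross a b = w" using exists_cross_eq by blast
  then have ab0: "a \<noteq> 0" "b \<noteq> 0" "cdot a w = 0" "cdot b w = 0" using \<open>w \<noteq> 0\<close> by auto
  have ne: "cross (P j) x \<noteq> 0" if "cdot x w = 0" "x \<noteq> 0" for x
    using that w by (rule cross_nonzero_if_separated(2))
  have "Z = C"
  proof (rule no_chain_below_curve[OF is_irreducible_curve irr])
    show "Z \<subseteq> C" by (auto simp: Z_def)
    show "\<tau> j a \<in> Z" "\<tau> j b \<in> Z" using ab0 unfolding Z by auto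
    have "cross (cross (P j) a) (cross (P j) b) = cdot (P j) (cross a b) *s P j"
      by (simp add: vec3_eq_iff cdot_3 algebra_simps)
    then have "cross (cross (P j) a) (cross (P j) b) \<noteq> 0" using w by (simp add: ab)
    then have "pt (cross (P j) a) \<noteq> pt (cross (P j) b)"
      using pt_eq_iff[OF ne ne] ab0 by blast
    moreover have "\<tau> j a j = pt (cross (P j) a)" "\<tau> j b j = pt (cross (P j) b)"
      using j by (auto simp: exceptional_point_def)
    ultimately show "\<tau> j a \<noteq> \<tau> j b" by metis
  qed
  then show False using not_exc[OF j] by (auto simp: Z_def)
qed

text \<open>If \<open>x\<close> is on the curve \<open>G = 0\<close>, then each equation of \<open>C\<close>, multiplied by linear forms that vanish at the
  centres but not at \<open>x\<close>, is divisible by \<open>G\<close>.\<close>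

lemma curve_off_centres:
  assumes G: "\<And>d A. homogeneous d A \<Longrightarrow> plane_vanishing C A \<Longrightarrow> G dvd A" "plane_vanishing C G" "homogeneous e G"
    and x: "off_centres x"
  shows "\<sigma> x \<in> C \<longleftrightarrow> ev G x = 0"
proof
  assume "\<sigma> x \<in> C"
  then have "ev G (rep (\<sigma> x 0)) = 0" using G(2) unfolding plane_vanishing_def by blast
  then have "ev G (rep (pt x)) = 0" by simp
  then show "ev G x = 0" using ev_rep_pt[OF G(3)] x by (auto simp: off_centres_def)
next
  assume Gx: "ev G x = 0"
  obtain S where S: "\<forall>f\<in>S. \<exists>b. multihomogeneous K b f" 
    "C = {y \<in> multiproj K. \<forall>f\<in>S. vanishes_at K f y}" using curve_equations by (elim exE conjE) (rule that)
  have "\<exists>u. cdot (P j) u = 0 \<and> cdot x u \<noteq> 0" if j: "j \<in> {1..r}" for j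
  proof -
    have "cross x (P j) \<noteq> 0" using x j by (simp add: off_centres_def)
    then obtain v where "cdot v (cross x (P j)) \<noteq> 0" using exists_cdot_nonzero by blast
    then show ?thesis using cdot_cross_rotate[of x "P j" v] by (intro exI[of _ "cross (P j) v"]) simp
  qed
  then obtain u where u: "\<And>j. j \<in> {1..r} \<Longrightarrow> cdot (P j) (u j) = 0 \<and> cdot x (u j) \<noteq> 0" by metis
  have "vanishes_at K f (\<sigma> x)" if f: "f \<in> S" for f
  proof -
    obtain b where b: "multihomogeneous K b f" using bspec[OF S(1) f] by (rule exE)
    have v: "vanishes_at K f y" if "y \<in> C" for y using that f unfolding S(2) by simp
    have "G dvd pullback f * (\<Prod>j\<in>{1..r}. lin_form (u j))"
      using plane_vanishing_pullback[OF b v, of u] u G(1) by blast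
    then have "ev (pullback f * (\<Prod>j\<in>{1..r}. lin_form (u j))) x = 0" using Gx by (rule eval_zero_of_dvd)
    then have "ev (pullback f) x = 0" using u by auto
    then show ?thesis using vanishes_at_lift[OF b x] by simp
  qed
  then show "\<sigma> x \<in> C" using lift_in_multiproj unfolding S(2) by simp
qed

end

end

section \<open>Degrees of curves on the blow up\<close>

context blown_up_plane
begin

definition exceptional_pullback :: "nat \<Rightarrow> (nat \<times> 3) cpoly \<Rightarrow> 3 cpoly" where
  "exceptional_pullback j f = poly_subst Cst (\<lambda>(k, i). if k = 0 then Cst (P j $ i) 
     else if k = j then lin_form (cross (axis i 1) (P j)) else Cst (cross (P j) (P k) $ i)) f"

lemma ev_exc_pullback: "ev (exceptional_pullback j f) x = 
  cpoly_eval (\<lambda>(k, i). (if k = 0 then P j else if k = j then cross (P j) x else cross (P j) (P k)) $ i) f"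
proof -
  have "cdot x (cross (axis i 1) (P j)) = cross (P j) x $ i" for i
    using exhaust_3[of i] by (auto simp: cdot_3 axis_def)
  then have "(\<lambda>v. cpoly_eval (($) x) (case v of (k, i) \<Rightarrow> if k = 0 then Cst (P j $ i) 
     else if k = j then lin_form (cross (axis i 1) (P j)) else Cst (cross (P j) (P k) $ i))) =
    (\<lambda>(k, i). (if k = 0 then P j else if k = j then cross (P j) x else cross (P j) (P k)) $ i)"
    by (intro ext) (auto split: prod.split)
  then show ?thesis by (simp add: exceptional_pullback_def cpoly_eval_subst)
qed

lemma vanishes_at_exceptional:
  assumes "multihomogeneous K b f" "j \<in> {1..r}" "cross (P j) x \<noteq> 0"
  shows "vanishes_at K f (\<tau> j x) \<longleftrightarrow> ev (exceptional_pullback j f) x = 0"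
  unfolding ev_exc_pullback using assms(3) cross_centres[OF assms(2)]
  by (intro vanishes_at_iff[OF assms(1)]) (auto simp: exceptional_point_def)

text \<open>The class of \<open>H - c \<Sum> E\<^sub>j\<close> is \<open>(1 - c r) L\<^sub>0 + c \<Sum> L\<^sub>j\<close>.\<close>

lemma intersection_number_uniform:
  "intersection_number r (\<lambda>k. div_H k - c * (\<Sum>j=1..r. div_E j k)) C = 
     (1 - c * real r) * real (line_degree C 0) + c * (\<Sum>k\<in>{1..r}. real (line_degree C k))"
proof -
  have 0: "(\<Sum>j=1..r. div_E j 0) = real r" by (simp add: div_E_def)
  have k: "(\<Sum>j=1..r. div_E j k) = -1" if "k \<in> {1..r}" for k
  proof -
    have "(\<Sum>j=1..r. div_E j k) = (\<Sum>j=1..r. if j = k then -1 else 0)"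
      using that by (intro sum.cong) (auto simp: div_E_def)
    then show ?thesis using that by simp
  qed
  have "{0..r} = insert 0 {1..r}" by auto
  then have "intersection_number r (\<lambda>k. div_H k - c * (\<Sum>j=1..r. div_E j k)) C =
      (1 - c * real r) * real (line_degree C 0) + 
      (\<Sum>k\<in>{1..r}. (div_H k - c * (\<Sum>j=1..r. div_E j k)) * real (line_degree C k))"
    unfolding intersection_number_def by (simp add: 0 div_H_def del: One_nat_def)
  also have "(\<Sum>k\<in>{1..r}. (div_H k - c * (\<Sum>j=1..r. div_E j k)) * real (line_degree C k)) = 
      (\<Sum>k\<in>{1..r}. c * real (line_degree C k))"
    by (intro sum.cong refl) (simp only: k div_H_def, simp)
  finally show ?thesis by (simp add: sum_distrib_left)
qed

lemma line_degree_0_exceptional: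
  assumes "\<forall>y\<in>C. y 0 = p j"
  shows "line_degree C 0 = 0"
proof (rule line_degreeI[where Q = "lin_form (P j)"])
  fix w assume w: "w \<noteq> 0" "ev (lin_form (P j)) w \<noteq> 0"
  have "\<not> incident (p j) (pt w)" using incident_pt[OF P_nonzero[of j] w(1)] w(2) by (simp add: cdot_commute)
  then have e: "{y \<in> C. incident (y 0) (pt w)} = {}" using assms by auto
  show "finite {y \<in> C. incident (y 0) (pt w)} \<and> card {y \<in> C. incident (y 0) (pt w)} = 0" unfolding e by simp
qed simp

context
  fixes C G e 
  assumes C: "nonexceptional_curve C" and G: "prime_elem G" "homogeneous e G" "plane_vanishing C G"
    and dvd: "\<forall>d A. homogeneous d A \<longrightarrow> plane_vanishing C A \<longrightarrow> G dvd A"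
begin

lemma lift_mem_curve_iff: "off_centres x \<Longrightarrow> \<sigma> x \<in> C \<longleftrightarrow> ev G x = 0"
  using curve_off_centres[OF C dvd[rule_format] G(3,2)] .

lemma mem_blowup: "y \<in> C \<Longrightarrow> y \<in> blowup r p"
  using curve_in_blowup[OF C] by blast

lemma form_vanishes_below: "y \<in> C \<Longrightarrow> ev G (rep (y 0)) = 0"
  using G(3) by (simp add: plane_vanishing_def)

lemma card_lift:
  assumes "\<And>x. x \<in> X \<Longrightarrow> \<sigma> (rep x) \<in> Y" "\<And>y. y \<in> Y \<Longrightarrow> y \<in> C \<and> off_centres (rep (y 0)) \<and> y 0 \<in> X"
  shows "finite Y \<longleftrightarrow> finite X" "card Y = card X"
proof -
  have "bij_betw (\<lambda>x. \<sigma> (rep x)) X Y"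
  proof (intro bij_betw_imageI inj_onI equalityI subsetI)
    fix x x' assume "\<sigma> (rep x) = \<sigma> (rep x')"
    then have "\<sigma> (rep x) 0 = \<sigma> (rep x') 0" by (rule arg_cong)
    then show "x = x'" by simp
  next
    fix y assume "y \<in> Y"
    then have "y = \<sigma> (rep (y 0))" "y 0 \<in> X"
      using assms(2)[of y] blowup_eq_lift[of y] mem_blowup[of y] by auto
    then show "y \<in> (\<lambda>x. \<sigma> (rep x)) ` X" by blast
  qed (use assms(1) in blast)
  then show "finite Y \<longleftrightarrow> finite X" "card Y = card X"
    using bij_betw_finite[of _ X Y] bij_betw_same_card[of _ X Y] by fastforce+
qed

text \<open>A general line avoids the centres, so its inverse image is in bijection with its points on
  the curve \<open>G = 0\<close>.\<close>

lemma line_degree_plane: "line_degree C 0 = e"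
proof -
  obtain Q where Q: "Q \<noteq> 0" "\<And>w. ev Q w \<noteq> 0 \<Longrightarrow>
      finite {x. cdot (rep x) w = 0 \<and> ev G (rep x) = 0} \<and>
      card {x. cdot (rep x) w = 0 \<and> ev G (rep x) = 0} = e"
    using general_line_count[OF G(1,2)] by blast
  have "(\<Prod>j\<in>{1..r}. lin_form (P j)) \<noteq> 0" by (intro cpoly_prod_nonzero) auto
  then have Q0: "Q * (\<Prod>j\<in>{1..r}. lin_form (P j)) \<noteq> 0" using Q(1) by simp
  show ?thesis
  proof (rule line_degreeI[OF Q0])
    fix w assume w: "w \<noteq> 0" "ev (Q * (\<Prod>j\<in>{1..r}. lin_form (P j))) w \<noteq> 0"
    then have wQ: "ev Q w \<noteq> 0" and wP: "\<And>j. j \<in> {1..r} \<Longrightarrow> cdot (P j) w \<noteq> 0"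
      by (auto simp: cdot_commute)
    let ?A = "{x. cdot (rep x) w = 0 \<and> ev G (rep x) = 0}" and ?B = "{y \<in> C. incident (y 0) (pt w)}"
    have inc: "incident x (pt w) \<longleftrightarrow> cdot (rep x) w = 0" for x
      using incident_pt[OF rep_nonzero[of x] w(1)] by simp
    have off: "off_centres (rep x)" if "cdot (rep x) w = 0" for x
      unfolding off_centres_rep using wP that by (auto simp: P_def)
    have l1: "\<sigma> (rep x) \<in> ?B" if "x \<in> ?A" for x
      using that lift_mem_curve_iff[OF off, of x] inc[of x] by simp
    have l2: "y \<in> C \<and> off_centres (rep (y 0)) \<and> y 0 \<in> ?A" if "y \<in> ?B" for y
      using that inc[of "y 0"] off form_vanishes_below by auto
    have c: "finite ?B \<longleftrightarrow> finite ?A" by (rule card_lift(1)[OF l1 l2])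
    have c': "card ?B = card ?A" by (rule card_lift(2)[OF l1 l2])
    show "finite ?B \<and> card ?B = e" unfolding c c' using Q(2)[OF wQ] by blast
  qed
qed

text \<open>The points of \<open>C\<close> whose \<open>j\<close>-th coordinate is a line through a general point \<open>w\<close> lie over the line through \<open>P j\<close>
  and \<open>w\<close>. For general \<open>w\<close>, this line contains no other centre, and it is not one of the tangent directions
  that are points of \<open>C\<close> over \<open>P j\<close>. So the points correspond to the points of the curve \<open>G = 0\<close> on this line
  other than \<open>P j\<close>.\<close>

lemma line_degree_centre:
  assumes j: "j \<in> {1..r}"
  shows "\<exists>N\<le>e. line_degree C j = N \<and> (\<forall>v k. k < e - N \<longrightarrow> coeff (along (($) (P j)) v G) k = 0)"
proof -
  obtain N Q where N: "N \<le> e" "\<forall>v k. k < e - N \<longrightarrow> coeff (along (($) (P j)) v G) k = 0"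
    and Q: "Q \<noteq> 0" "\<And>v. ev Q v \<noteq> 0 \<Longrightarrow> cross v (P j) \<noteq> 0 \<and> 
      finite {x. x \<noteq> p j \<and> cdot (rep x) (cross v (P j)) = 0 \<and> ev G (rep x) = 0} \<and>
      card {x. x \<noteq> p j \<and> cdot (rep x) (cross v (P j)) = 0 \<and> ev G (rep x) = 0} = N"
    using lines_through_point_count[OF G(1,2) P_nonzero[of j]] unfolding pt_P by blast
  obtain w0 where "cdot w0 (P j) \<noteq> 0" using exists_cdot_nonzero P_nonzero by blast
  then have w0: "cdot (P j) w0 \<noteq> 0" by (simp add: cdot_commute)
  obtain x0 where x0: "cdot x0 w0 = 0" "x0 \<noteq> 0" "\<tau> j x0 \<notin> C"
    using exceptional_divisor_not_contained[OF C j w0] by blast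
  have x0P: "cross (P j) x0 \<noteq> 0" using x0(1,2) w0 by (rule cross_nonzero_if_separated(2))
  obtain S where S: "\<forall>f\<in>S. \<exists>b. multihomogeneous K b f" 
    "C = {y \<in> multiproj K. \<forall>f\<in>S. vanishes_at K f y}" using curve_equations[OF C] by (elim exE conjE) (rule that)
  obtain f where f: "f \<in> S" "\<not> vanishes_at K f (\<tau> j x0)" using x0(3) exceptional_in_multiproj unfolding S(2) by blast
  obtain b where b: "multihomogeneous K b f" using bspec[OF S(1) f(1)] by (rule exE)
  have "ev (exceptional_pullback j f) x0 \<noteq> 0" using f(2) vanishes_at_exceptional[OF b j x0P] by simp
  then have E0: "exceptional_pullback j f \<noteq> 0" by auto
  define Q' where "Q' = Q * exceptional_pullback j f * (\<Prod>k\<in>{1..r} - {j}. lin_form (cross (P j) (P k)))"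
  have "(\<Prod>k\<in>{1..r} - {j}. lin_form (cross (P j) (P k))) \<noteq> 0"
    using cross_centres[OF j] by (intro cpoly_prod_nonzero) auto
  then have Q': "Q' \<noteq> 0" using Q(1) E0 by (simp add: Q'_def)
  have "line_degree C j = N"
  proof (rule line_degreeI[OF Q'])
    fix w assume w: "w \<noteq> 0" "ev Q' w \<noteq> 0"
    then have wQ: "ev Q w \<noteq> 0" and wE: "ev (exceptional_pullback j f) w \<noteq> 0"
      and wP: "\<And>k. k \<in> {1..r} \<Longrightarrow> k \<noteq> j \<Longrightarrow> cdot w (cross (P j) (P k)) \<noteq> 0"
      by (auto simp: Q'_def)
    have wj: "cross w (P j) \<noteq> 0" using Q(2)[OF wQ] by blast
    have wj': "cross (P j) w \<noteq> 0" using wj cross_swap[of w "P j"] by auto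
    let ?A = "{x. x \<noteq> p j \<and> cdot (rep x) (cross w (P j)) = 0 \<and> ev G (rep x) = 0}" 
      and ?B = "{y \<in> C. incident (y j) (pt w)}"
    have inc: "incident x (pt w) \<longleftrightarrow> cdot (rep x) w = 0" for x
      using incident_pt[OF rep_nonzero[of x] w(1)] by simp
    have not_centre: "\<not> (y 0 = p k)" if y: "y \<in> ?B" and k: "k \<in> {1..r}" for y k
    proof
      assume yk: "y 0 = p k"
      have n: "cdot (P k) (rep (y j)) = 0" "cdot (P j) (rep (y j)) = 0" "cdot w (rep (y j)) = 0"
        using blowup_incidence[OF mem_blowup j, of y] y inc[of "y j"] yk cdot_commute[of w] by (auto simp: P_def)
      show False
      proof (cases "k = j")
        case False
        have "cross (P j) (P k) \<noteq> 0" using cross_centres[OF j k] False by simp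
        then obtain c where c: "rep (y j) = c *s cross (P j) (P k)" 
          using orthogonal_imp_scale_cross[OF n(2,1)] by blast
        then have "c \<noteq> 0" by (metis rep_nonzero vec.scale_zero_left)
        then show False using wP[OF k False] n(3) c by simp
      next
        case True
        obtain x where x: "cdot x w0 = 0" "x \<noteq> 0" "y = \<tau> j x"
          using blowup_eq_exceptional[OF mem_blowup _ j w0, of y] y yk True by auto
        obtain c where c: "rep (y j) = c *s cross (P j) w" 
          using orthogonal_imp_scale_cross[OF n(2,3) wj'] by blast
        then have "c \<noteq> 0" by (metis rep_nonzero vec.scale_zero_left)
        then have yj: "y j = pt (cross (P j) w)" using c pt_scale[OF wj'] pt_rep[of "y j"] by metis
        have "y = \<tau> j w"
        proof (rule PiE_ext[of y K "\<lambda>_. UNIV"])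
          show "y \<in> K \<rightarrow>\<^sub>E UNIV" using x(3) exceptional_in_multiproj by (simp add: multiproj_def)
          show "\<tau> j w \<in> K \<rightarrow>\<^sub>E UNIV" using exceptional_in_multiproj by (simp add: multiproj_def)
          fix k assume "k \<in> K"
          then show "y k = \<tau> j w k" using yj j unfolding x(3) by (auto simp: exceptional_point_def)
        qed
        moreover have "vanishes_at K f y" using y f(1) unfolding S(2) by simp
        ultimately show False using vanishes_at_exceptional[OF b j wj'] wE by simp
      qed
    qed
    have offB: "off_centres (rep (y 0))" if "y \<in> ?B" for y
      unfolding off_centres_rep using not_centre[OF that] by blast
    have offA: "off_centres (rep x)" if x: "x \<in> ?A" for x
      unfolding off_centres_rep
    proof
      fix k assume k: "k \<in> {1..r}"
      show "x \<noteq> p k"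
      proof
        assume xk: "x = p k"
        then have "k \<noteq> j" using x by auto
        have "cdot w (cross (P j) (P k)) = cdot (rep x) (cross w (P j))"
          unfolding xk P_def[symmetric] by (rule cdot_cross_rotate)
        then show False using wP[OF k \<open>k \<noteq> j\<close>] x by simp
      qed
    qed
    have inc_lift: "incident (\<sigma> x j) (pt w) \<longleftrightarrow> cdot x (cross w (P j)) = 0" if "off_centres x" for x
    proof -
      have "cross x (P j) \<noteq> 0" using that j by (simp add: off_centres_def)
      then have "incident (\<sigma> x j) (pt w) \<longleftrightarrow> cdot (cross x (P j)) w = 0"
        using incident_pt[OF _ w(1)] by (simp add: lift_j[OF j])
      moreover have "cdot (cross x (P j)) w = - cdot x (cross w (P j))"
        by (simp add: cdot_3 algebra_simps)
      ultimately show ?thesis by simp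
    qed
    have l1: "\<sigma> (rep x) \<in> ?B" if "x \<in> ?A" for x
      using that lift_mem_curve_iff[OF offA[OF that]] inc_lift[OF offA[OF that]] by simp
    have l2: "y \<in> C \<and> off_centres (rep (y 0)) \<and> y 0 \<in> ?A" if y: "y \<in> ?B" for y
    proof -
      have "y = \<sigma> (rep (y 0))" using blowup_eq_lift[of y, OF mem_blowup offB[OF y]] y by blast
      then have "incident (\<sigma> (rep (y 0)) j) (pt w)" using y by auto
      then have "cdot (rep (y 0)) (cross w (P j)) = 0" using inc_lift[OF offB[OF y]] by simp
      then show ?thesis using y form_vanishes_below not_centre[OF y j] offB[OF y] by blast
    qed
    have c: "finite ?B \<longleftrightarrow> finite ?A" by (rule card_lift(1)[OF l1 l2])
    have c': "card ?B = card ?A" by (rule card_lift(2)[OF l1 l2])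
    show "finite ?B \<and> card ?B = N" unfolding c c' using Q(2)[OF wQ] by blast
  qed
  then show ?thesis using N by blast
qed

end

text \<open>The second alternative is that of a curve that is not contained in an exceptional divisor.\<close>

lemma intersection_number_nonneg_or_eq:
  assumes C: "irreducible_curve K C" "C \<subseteq> blowup r p" and c: "c \<ge> 0"
  shows "intersection_number r (\<lambda>k. div_H k - c * (\<Sum>j=1..r. div_E j k)) C \<ge> 0 \<or>
    (\<exists>G e \<mu>. G \<noteq> 0 \<and> homogeneous e G \<and> (\<forall>j\<in>{1..r}. \<mu> j \<le> e \<and> 
      (\<forall>v k. k < \<mu> j \<longrightarrow> coeff (along (($) (P j)) v G) k = 0)) \<and>
      intersection_number r (\<lambda>k. div_H k - c * (\<Sum>j=1..r. div_E j k)) C = 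
        real e - c * real (\<Sum>j\<in>{1..r}. \<mu> j))"
proof (cases "\<exists>j\<in>{1..r}. \<forall>y\<in>C. y 0 = p j")
  case True
  then have "line_degree C 0 = 0" using line_degree_0_exceptional by blast
  then show ?thesis using c by (simp only: intersection_number_uniform) (simp add: sum_nonneg)
next
  case False
  then have nC: "nonexceptional_curve C" using C by (auto simp: nonexceptional_curve_def)
  obtain G e where G: "prime_elem G" "homogeneous e G" "plane_vanishing C G"
    "\<forall>d A. homogeneous d A \<longrightarrow> plane_vanishing C A \<longrightarrow> G dvd A"
    using plane_equation[OF nC] by (elim exE conjE) (rule that)
  have "\<exists>N. \<forall>j\<in>{1..r}. N j \<le> e \<and> line_degree C j = N j \<and> (\<forall>v k. k < e - N j \<longrightarrow> coeff (along (($) (P j)) v G) k = 0)"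
    using line_degree_centre[OF nC G] by (intro bchoice ballI) blast
  then obtain N where N: "\<And>j. j \<in> {1..r} \<Longrightarrow> N j \<le> e" "\<And>j. j \<in> {1..r} \<Longrightarrow> line_degree C j = N j"
    "\<And>j v k. j \<in> {1..r} \<Longrightarrow> k < e - N j \<Longrightarrow> coeff (along (($) (P j)) v G) k = 0"
    by blast
  have "intersection_number r (\<lambda>k. div_H k - c * (\<Sum>j=1..r. div_E j k)) C = 
      (1 - c * real r) * real e + c * (\<Sum>k\<in>{1..r}. real (N k))"
    unfolding intersection_number_uniform line_degree_plane[OF nC G] using N(2) by simp
  also have "(\<Sum>k\<in>{1..r}. real (N k)) = real r * real e - (\<Sum>j\<in>{1..r}. real (e - N j))"
    using N(1) by (simp add: of_nat_diff sum_subtractf)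
  finally have "intersection_number r (\<lambda>k. div_H k - c * (\<Sum>j=1..r. div_E j k)) C = 
      real e - c * real (\<Sum>j\<in>{1..r}. e - N j)"
    by (simp add: algebra_simps)
  moreover have "G \<noteq> 0" using G(1) by auto
  moreover have "\<forall>j\<in>{1..r}. e - N j \<le> e \<and> (\<forall>v k. k < e - N j \<longrightarrow> coeff (along (($) (P j)) v G) k = 0)"
    using N(3) by simp
  ultimately show ?thesis using G(2) by (intro disjI2 exI[of _ G] exI[of _ e] exI[of _ "\<lambda>j. e - N j"]) simp
qed

end

section \<open>Nefness\<close>

lemma exists_local_frame:
  assumes "v \<noteq> 0" shows "\<exists>A B. cdot v (cross A B) \<noteq> 0"
proof -
  obtain w where "cdot w v \<noteq> 0" using exists_cdot_nonzero[OF assms] by blast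
  then have w: "cdot v w \<noteq> 0" by (simp add: cdot_commute)
  then have "w \<noteq> 0" by (auto simp: cdot_3)
  then show ?thesis using exists_cross_eq w by metis
qed

text \<open>The expected dimension is nonnegative, so its definition does not involve the cutoff at \<open>- 1\<close>, and
  the dimension hypothesis says that the common kernel of the Taylor coefficients is as small as possible.\<close>

lemma interpolates_if_expected_dim:
  assumes frame: "\<And>j. cdot (rep (p j)) (cross (A j) (B j)) \<noteq> 0"
    and dim: "linsys_dim d r (m + 1) p = expected_dim d r (m + 1)" and nonneg: "expected_dim d r (m + 1) \<ge> 0"
  shows "interpolates (\<lambda>j. local_expansion (rep (p j)) (A j) (B j)) {1..r} d m"
proof (rule interpolates_if_dim[OF frame])
  let ?L = "linsys_at (\<lambda>j. rep (p j)) A B {1..r} d (\<lambda>_. Suc m)"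
  have "?L \<subseteq> linsys d r (m + 1) p"
  proof
    fix F assume F: "F \<in> ?L"
    then have hF: "homogeneous d F" by (simp add: linsys_at_def[OF frame] forms_def)
    have "mult_ge (m + 1) F (p j)" if j: "j \<in> {1..r}" for j
    proof -
      have "mult_ge (m + 1) F (pt (rep (p j)))"
        using F j by (intro mult_ge_if_local_expansion[OF hF frame[of j]]) (simp add: linsys_at_def[OF frame])
      then show ?thesis by simp
    qed
    then show "F \<in> linsys d r (m + 1) p" using hF by (simp add: linsys_def)
  qed
  moreover have "linsys d r (m + 1) p \<subseteq> cpoly.span (form_basis d)"
    using forms_subset_span[of d] by (auto simp: linsys_def forms_def)
  ultimately have "cpoly.dim ?L \<le> cpoly.dim (linsys d r (m + 1) p)"
    by (rule cpoly.dim_mono_of_span) simp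
  moreover have "int (cpoly.dim (linsys d r (m + 1) p)) + int (r * ((m + 1) * (m + 1 + 1) div 2)) = int (d * (d + 3) div 2) + 1"
    using dim nonneg unfolding linsys_dim_def expected_dim_def by linarith
  moreover have "d * (d + 3) div 2 + 1 = cpoly.dim (forms d)"
  proof -
    have "(d + 1) * (d + 2) = d * (d + 3) + 2 * 1" by (simp add: algebra_simps)
    then show ?thesis unfolding dim_forms by simp
  qed
  ultimately have "cpoly.dim ?L + r * ((m + 1) * (m + 1 + 1) div 2) \<le> cpoly.dim (forms d)" by linarith
  then show "cpoly.dim ?L + (\<Sum>j\<in>{1..r}. Suc m * (Suc m + 1) div 2) \<le> cpoly.dim (forms d)" by simp
qed simp

lemma distinct_if_interpolates:
  assumes "interpolates (\<lambda>j. local_expansion (rep (p j)) (A j) (B j)) {1..r} d m"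
  shows "inj_on p {1..r}"
proof (rule inj_onI, rule ccontr)
  fix j k assume j: "j \<in> {1..r}" and k: "k \<in> {1..r}" and eq: "p j = p k" and "j \<noteq> k"
  have "(0, 0) \<in> jet_index (Suc m)" by (simp add: jet_index_def)
  then obtain F where F: "coeff (local_expansion (rep (p j)) (A j) (B j) F) 0 = monom 1 0"
    "coeff (local_expansion (rep (p k)) (A k) (B k) F) 0 = 0"
    using assms j k \<open>j \<noteq> k\<close> unfolding interpolates_def by blast
  have "poly (coeff (local_expansion (rep (p j)) (A j) (B j) F) 0) 0 = ev F (rep (p j))" for j
    unfolding coeff_local_expansion_along by (simp add: poly_0_coeff_0[symmetric] poly_along)
  from this[of j] this[of k] show False using F eq by simp
qed

lemma nef_if_interpolates:
  assumes frame: "\<And>j. cdot (rep (p j)) (cross (A j) (B j)) \<noteq> 0"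
    and int: "\<And>i. interpolates (\<lambda>j. local_expansion (rep (p j)) (A j) (B j)) {1..r} (d i) (m i)"
    and pos: "\<And>i. d i > 0" "\<And>i. m i > 0"
    and lim: "(\<lambda>i. real (m i) / real (d i)) \<longlonglongrightarrow> c" and c: "c \<ge> 0"
  shows "nef r p (\<lambda>k. div_H k - c * (\<Sum>j=1..r. div_E j k))"
  unfolding nef_def
proof (intro allI impI, elim conjE)
  fix C assume C: "irreducible_curve {0..r} C" "C \<subseteq> blowup r p"
  interpret blown_up_plane r p
    by unfold_locales (rule distinct_if_interpolates[OF int])
  let ?I = "intersection_number r (\<lambda>k. div_H k - c * (\<Sum>j=1..r. div_E j k)) C"
  show "?I \<ge> 0"
  proof (cases "?I \<ge> 0")
    case False
    then obtain G e \<mu> where G: "G \<noteq> 0" "homogeneous e G" 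
      and mu: "\<forall>j\<in>{1..r}. \<mu> j \<le> e \<and> (\<forall>v k. k < \<mu> j \<longrightarrow> coeff (along (($) (P j)) v G) k = 0)"
      and I: "?I = real e - c * real (\<Sum>j\<in>{1..r}. \<mu> j)"
      using intersection_number_nonneg_or_eq[OF C c] by blast
    have "m i * (\<Sum>j\<in>{1..r}. \<mu> j) \<le> d i * e" for i
    proof (rule sum_multiplicities_le[OF frame _ int pos(1) G(2,1)])
      show "\<mu> j \<le> e" if "j \<in> {1..r}" for j using mu that by blast
      show "coeff (local_expansion (rep (p j)) (A j) (B j) G) n = 0" if "j \<in> {1..r}" "n < \<mu> j" for j n
        using mu that by (intro local_expansion_vanish_if_along[where M = "\<mu> j"]) (auto simp: P_def)
    qed (use pos in auto)
    then have "real (m i * (\<Sum>j\<in>{1..r}. \<mu> j)) \<le> real (d i * e)" for i by (simp only: of_nat_le_iff)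
    then have "real (m i) / real (d i) * real (\<Sum>j\<in>{1..r}. \<mu> j) \<le> real e" for i
      using pos(1)[of i] by (simp add: field_simps)
    moreover have "(\<lambda>i. real (m i) / real (d i) * real (\<Sum>j\<in>{1..r}. \<mu> j)) \<longlonglongrightarrow> c * real (\<Sum>j\<in>{1..r}. \<mu> j)"
      by (intro tendsto_mult lim tendsto_const)
    ultimately have "c * real (\<Sum>j\<in>{1..r}. \<mu> j) \<le> real e"
      by (intro LIMSEQ_le_const2) auto
    then show ?thesis unfolding I by (simp only: diff_ge_0_iff_ge)
  qed
qed

lemma ratio_tendsto:
  fixes d m :: "nat \<Rightarrow> nat"
  assumes "r > 0" "a > 0" "\<And>i. d i > 0" "\<And>i. m i > 0"
    and lim: "(\<lambda>i. (real (d i))\<^sup>2 / ((real (m i))\<^sup>2 * real r)) \<longlonglongrightarrow> 1 / a\<^sup>2"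
  shows "(\<lambda>i. real (m i) / real (d i)) \<longlonglongrightarrow> a * sqrt (1 / real r)"
proof -
  have "(\<lambda>i. sqrt (inverse ((real (d i))\<^sup>2 / ((real (m i))\<^sup>2 * real r)) * (1 / real r))) \<longlonglongrightarrow> 
      sqrt (inverse (1 / a\<^sup>2) * (1 / real r))"
    using assms by (intro tendsto_intros lim) auto
  moreover have "sqrt (inverse ((real (d i))\<^sup>2 / ((real (m i))\<^sup>2 * real r)) * (1 / real r)) = real (m i) / real (d i)" for i
  proof -
    have "inverse ((real (d i))\<^sup>2 / ((real (m i))\<^sup>2 * real r)) * (1 / real r) = (real (m i) / real (d i))\<^sup>2"
      using assms(1) assms(3)[of i] by (simp add: field_simps power_divide)
    then show ?thesis by simp
  qed
  moreover have "sqrt (inverse (1 / a\<^sup>2) * (1 / real r)) = a * sqrt (1 / real r)"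
    using assms(2) by (simp add: real_sqrt_divide)
  ultimately show ?thesis by simp
qed

theorem theorem5p2:
  fixes r :: nat and a :: real and d m :: "nat \<Rightarrow> nat"
  assumes "r > 9" and "a > 0"
    and "\<And>i. d i > 0" and "\<And>i. m i > 0"
    and "(\<lambda>i. (real (d i))\<^sup>2 / ((real (m i))\<^sup>2 * real r)) \<longlonglongrightarrow> 1 / a\<^sup>2"
    and "1 / a\<^sup>2 \<ge> 1"
    and "\<And>i. has_expected_dim (d i) r (m i + 1)"
    and "\<And>i. expected_dim (d i) r (m i + 1) \<ge> 0"
  shows "for_very_general r (\<lambda>p. nef r p
           (\<lambda>k. div_H k - a * sqrt (1 / real r) * (\<Sum>j=1..r. div_E j k))) \<and>
         (a = 1 \<longrightarrow> for_very_general r (\<lambda>p. nef r p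
           (\<lambda>k. div_H k - sqrt (1 / real r) * (\<Sum>j=1..r. div_E j k))))"
proof -
  have lim: "(\<lambda>i. real (m i) / real (d i)) \<longlonglongrightarrow> a * sqrt (1 / real r)"
    using assms(1-5) by (intro ratio_tendsto) auto
  have "\<exists>Z. \<forall>i. zariski_closed {1..r} (Z i) \<and> Z i \<noteq> multiproj {1..r} \<and>
      (\<forall>p\<in>multiproj {1..r} - Z i. linsys_dim (d i) r (m i + 1) p = expected_dim (d i) r (m i + 1))"
    using assms(7) unfolding has_expected_dim_def for_general_def by (intro choice) blast
  then obtain Z where Z: "\<And>i. zariski_closed {1..r} (Z i)" "\<And>i. Z i \<noteq> multiproj {1..r}"
      "\<And>i p. p \<in> multiproj {1..r} - Z i \<Longrightarrow> linsys_dim (d i) r (m i + 1) p = expected_dim (d i) r (m i + 1)"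
    by blast
  have "nef r p (\<lambda>k. div_H k - a * sqrt (1 / real r) * (\<Sum>j=1..r. div_E j k))"
    if p: "p \<in> multiproj {1..r} - \<Union>(range Z)" for p
  proof -
    have "\<forall>j. \<exists>A B. cdot (rep (p j)) (cross A B) \<noteq> 0"
      using exists_local_frame rep_nonzero by blast
    then obtain A B where frame: "\<And>j. cdot (rep (p j)) (cross (A j) (B j)) \<noteq> 0"
      by metis
    have "interpolates (\<lambda>j. local_expansion (rep (p j)) (A j) (B j)) {1..r} (d i) (m i)" for i
      using p by (intro interpolates_if_expected_dim frame Z(3) assms(8)) auto
    then show ?thesis
      using assms(2-4) lim by (intro nef_if_interpolates[OF frame]) auto
  qed
  then have "for_very_general r (\<lambda>p. nef r p (\<lambda>k. div_H k - a * sqrt (1 / real r) * (\<Sum>j=1..r. div_E j k)))"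
    unfolding for_very_general_def using Z(1,2) by (intro exI[of _ "range Z"]) auto
  then show ?thesis by auto
qed

end
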